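(* Consider the adaptive algorithm AILFEM described in the context with arbitrary parameters $0<\theta\le 1$, $C_{\rm mark}\ge 1$, $\lambda_{\rm lin}>0$, $0<\rho<1$, $\alpha_{\min}>0$, $J_{\max}\in\mathbb N$, $\tau\ge 0$, and arbitrary initial guess $u_0^{0,0}\in\mathcal X_0$. Suppose that the estimator satisfies stability (A1), reduction (A2), and reliability (A3). Define, for $(\ell,k,j)\in\mathcal Q$, the quasi-error $$\mathrm H_\ell^{k,j}:=\eta_\ell(u_\ell^\star)+|||u_\ell^\star-u_\ell^{k,\star}|||+|||u_\ell^{k,\star}-u_\ell^{k,j}|||.$$ Then the algorithm guarantees full R-linear convergence of the quasi-error, i.e., there exist constants $0<q_{\rm lin}<1$ and $C_{\rm lin}>0$ such that $$\mathrm H_\ell^{k,j}\le C_{\rm lin}\,q_{\rm lin}^{|\ell,k,j|-|\ell',k',j'|}\,\mathrm H_{\ell'}^{k',j'}\quad\text{for all }(\ell',k',j'),(\ell,k,j)\in\mathcal Q\text{ with }|\ell',k',j'|<|\ell,k,j|.$$ The constants $C_{\rm lin}$ and $q_{\rm lin}$ depend only on $L,\alpha,q_{\rm red},q_{\rm nrg},C_{\rm stab},C_{\rm rel},\theta,\lambda_{\rm lin},j_0$, and $q_{\rm nrg}^\star$.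
   Context: **Problem.** $\Omega\subset\mathbb R^d$ ($d\ge1$) is a bounded Lipschitz domain, $\mathcal X=H^1_0(\Omega)$ with dual $\mathcal X'$, $|||v|||:=\|\nabla v\|_{L^2(\Omega)}$. $\mu:\mathbb R_{\ge0}\to\mathbb R_{\ge0}$ is $C^1$ and there are $0<\alpha\le L/3$ with $\alpha(t-s)\le\mu(t^2)t-\mu(s^2)s\le\frac L3(t-s)$ for all $t\ge s\ge0$. Data: $f\in L^2(\Omega)$, $\boldsymbol f\in[L^2(\Omega)]^d$. Set $\langle\mathcal Au,v\rangle:=\int_\Omega\mu(|\nabla u|^2)\nabla u\cdot\nabla v\,dx$, $F(v):=\int_\Omega fv\,dx+\int_\Omega\boldsymbol f\cdot\nabla v\,dx$. Then $\alpha|||u-v|||^2\le\langle\mathcal Au-\mathcal Av,u-v\rangle$ and $\langle\mathcal Au-\mathcal Av,w\rangle\le L|||u-v|||\,|||w|||$ for all $u,v,w\in\mathcal X$. For each closed subspace $\mathcal X_H\subseteq\mathcal X$, $u_H^\star\in\mathcal X_H$ is the unique solution of $\langle\mathcal Au_H^\star,v_H\rangle=F(v_H)$ for all $v_H\in\mathcal X_H$; $u^\star$ denotes the solution for $\mathcal X_H=\mathcal X$. Energy: $\mathcal E(v):=\frac12\int_\Omega\int_0^{|\nabla v|^2}\mu(t)\,dt\,dx-F(v)$; energy difference: $\mathrm d^2(v,w):=\mathcal E(w)-\mathcal E(v)$ (may be negative). **Meshes and spaces.** $\mathcal T_0$ is a conforming simplicial mesh of $\Omega$ (admissible for newest vertex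 bisection, NVB). $\mathtt{refine}(\mathcal T_H,\mathcal M_H)$ is the coarsest conforming NVB refinement of $\mathcal T_H$ in which at least all elements of $\mathcal M_H\subseteq\mathcal T_H$ are refined. $\mathbb T(\mathcal T_H)$ is the set of meshes obtained from $\mathcal T_H$ by finitely many refinement steps; $\mathbb T:=\mathbb T(\mathcal T_0)$. For fixed $p\in\mathbb N$, $\mathcal X_H:=\{v\in H_0^1(\Omega): v|_T\text{ polynomial of degree}\le p\ \forall T\in\mathcal T_H\}$. Index $\ell$ refers to the mesh $\mathcal T_\ell$. **Linearization.** For each $u\in\mathcal X$, $a(u;\cdot,\cdot)$ is a symmetric bilinear form on $\mathcal X$ with $C_{\rm ell}|||v|||^2\le a(u;v,v)$ and $|a(u;v,w)|\le C_{\rm cnt}|||v|||\,|||w|||$, with $C_{\rm ell},C_{\rm cnt}>0$ independent of $u$. For $u_H\in\mathcal X_H$, $\Phi_H(u_H)\in\mathcal X_H$ is the unique solution of $a(u_H;\Phi_H(u_H),v_H)=a(u_H;u_H,v_H)+F(v_H)-\langle\mathcal Au_H,v_H\rangle$ for all $v_H\in\mathcal X_H$. It is assumed that there is $C_{\rm nrg}^\star>0$, independent of $\mathcal X_H$ and $u_H$, with $C_{\rm nrg}^\star|||\Phi_H(u_H)-u_H|||^2\le\mathrm d^2(\Phi_H(u_H),u_H)$ for all $u_H\in\mathcal X_H$. Then there is $0<q_{\rm nrg}^\star\le1-\frac{2C_{\rm nrg}^\star}{L}\frac{\alpha^2}{C_{\rm cnt}^2}<1$ with $0\le\mathrm d^2(u_H^\star,\Phi_H(u_H))\le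 q_{\rm nrg}^\star\,\mathrm d^2(u_H^\star,u_H)$ for all $u_H\in\mathcal X_H$ and all $\mathcal X_H$. **Algebraic solver.** Given $u_H^{k,0}\in\mathcal X_H$ and $u_H^{k,\star}:=\Phi_H(u_H^{k,0})$, the solver is an iteration map $\Psi_H(u_H^{k,\star};\cdot):\mathcal X_H\to\mathcal X_H$ with iterates $u_H^{k,j}:=\Psi_H(u_H^{k,\star};u_H^{k,j-1})$ satisfying $|||u_H^{k,\star}-u_H^{k,j}|||\le q_{\rm alg}|||u_H^{k,\star}-u_H^{k,j-1}|||$ for all $j\ge1$, with $0<q_{\rm alg}<1$ independent of $\mathcal X_H$ and $u_H^{k,0}$. **Estimator.** For $T\in\mathcal T_H$, $v_H\in\mathcal X_H$, with $\boldsymbol A(\nabla v)=\mu(|\nabla v|^2)\nabla v$: $\eta_H(T,v_H)^2:=|T|^{2/d}\|f+\mathrm{div}(\boldsymbol A(\nabla v_H)-\boldsymbol f)\|_{L^2(T)}^2+|T|^{1/d}\|[\![(\boldsymbol A(\nabla v_H)-\boldsymbol f)\cdot n]\!]\|^2_{L^2(\partial T\cap\Omega)}$ (assumed well defined and finite), where $[\![\cdot]\!]$ is the jump across faces; $\eta_H(\mathcal U,v_H):=(\sum_{T\in\mathcal U}\eta_H(T,v_H)^2)^{1/2}$ for $\mathcal U\subseteq\mathcal T_H$, $\eta_H(v_H):=\eta_H(\mathcal T_H,v_H)$. Properties (required only where a statement assumes them), for all $\mathcal T_H\in\mathbb T$, $\mathcal T_h\in\mathbb T(\mathcal T_H)$,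 $v_H\in\mathcal X_H$, $v_h\in\mathcal X_h$, with constants $C_{\rm stab},C_{\rm rel}>0$, $0<q_{\rm red}<1$: (A1) $|\eta_h(\mathcal T_h\cap\mathcal T_H,v_h)-\eta_H(\mathcal T_h\cap\mathcal T_H,v_H)|\le C_{\rm stab}|||v_h-v_H|||$; (A2) $\eta_h(\mathcal T_h\setminus\mathcal T_H,v_H)\le q_{\rm red}\,\eta_H(\mathcal T_H\setminus\mathcal T_h,v_H)$; (A3) $|||u^\star-u_H^\star|||\le C_{\rm rel}\,\eta_H(u_H^\star)$. **Algorithm AILFEM.** Input: $\mathcal T_0$, $u_0^{0,0}=u_0^{0,\underline j}=u_0^{0,\star}\in\mathcal X_0$, $\theta,C_{\rm mark},\lambda_{\rm lin},\rho,\tau$, and initial values of the variables $\alpha_{\min}>0$, $J_{\max}\in\mathbb N$. For $\ell=0,1,\dots$: (i) For $k=1,2,\dots$: (a) set $u_\ell^{k,0}:=u_\ell^{k-1,\underline j}$ and $u_\ell^{k,\star}:=\Phi_\ell(u_\ell^{k-1,\underline j})$ (not computed). (b) For $j=1,2,\dots$: compute $u_\ell^{k,j}$ from $u_\ell^{k,j-1}$ by one solver step; if $\eta_\ell(u_\ell^{k,j})+|||u_\ell^{k,j}-u_\ell^{k-1,\underline j}|||+|||u_\ell^{k,j}-u_\ell^{k,j-1}|||\le\tau$, set $\underline\ell:=\ell$, $\underline k[\underline\ell]:=k$, $\underline j[\underline\ell,\underline k]:=j$ and terminate the algorithm; set $\alpha_\ell^{k,j}:=\mathrm d^2(u_\ell^{k,j},u_\ell^{k-1,\underline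 j})/|||u_\ell^{k,j}-u_\ell^{k-1,\underline j}|||^2$; leave the $j$-loop as soon as $\alpha_\ell^{k,j}\ge\alpha_{\min}$, or $u_\ell^{k,j}=u_\ell^{k-1,\underline j}$, or [$\alpha_\ell^{k,j}>0$ and $j>J_{\max}$]. (c) Set $\underline j[\ell,k]:=j$. (d) If $\underline j[\ell,k]>J_{\max}$, update $J_{\max}\leftarrow\underline j[\ell,k]$ and $\alpha_{\min}\leftarrow\rho\,\alpha_{\min}$. Leave the $k$-loop as soon as $\mathrm d^2(u_\ell^{k,\underline j},u_\ell^{k-1,\underline j})\le\lambda_{\rm lin}\,\eta_\ell(u_\ell^{k,\underline j})^2$. (ii) Set $\underline k[\ell]:=k$. (iii) Choose $\mathcal M_\ell\subseteq\mathcal T_\ell$ with $\theta\,\eta_\ell(u_\ell^{\underline k,\underline j})^2\le\eta_\ell(\mathcal M_\ell,u_\ell^{\underline k,\underline j})^2$ whose cardinality is at most $C_{\rm mark}$ times the minimal cardinality of sets with this property. (iv) $\mathcal T_{\ell+1}:=\mathtt{refine}(\mathcal T_\ell,\mathcal M_\ell)$, $u_{\ell+1}^{0,0}:=u_{\ell+1}^{0,\underline j}:=u_{\ell+1}^{0,\star}:=u_\ell^{\underline k,\underline j}$. **Indices.** $\mathcal Q\subset\mathbb N_0^3$ is the set of triples $(\ell,k,j)$ used by the algorithm (i.e., $u_\ell^{k,j}$ is defined), ordered by order of appearance (lexicographic); $|\ell,k,j|$ is the number of elements of $\mathcal Q$ preceding $(\ell,k,j)$. $\underline\ell,\underline k[\ell],\underline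 j[\ell,k]$ are the suprema (possibly $\infty$) of the indices $\ell$, of $k$ for given $\ell$, and of $j$ for given $(\ell,k)$, occurring in $\mathcal Q$; $\underline j[\ell,0]=0$. Arguments are omitted if clear: $u_\ell^{k,\underline j}=u_\ell^{k,\underline j[\ell,k]}$, $u_\ell^{\underline k,\underline j}=u_\ell^{\underline k[\ell],\underline j[\ell,\underline k[\ell]]}$, $(\ell,k,\underline j)=(\ell,k,\underline j[\ell,k])$. **Further constants.** $j_0\in\mathbb N$ is a uniform bound $\underline j[\ell,k]\le j_0$ for all $(\ell,k,0)\in\mathcal Q$ (it exists). $0<C_{\rm nrg}<C_{\rm nrg}^\star$ is a constant with $C_{\rm nrg}|||u_\ell^{k,\underline j}-u_\ell^{k-1,\underline j}|||^2\le\mathrm d^2(u_\ell^{k,\underline j},u_\ell^{k-1,\underline j})$ for all $(\ell,k,0)\in\mathcal Q$ with $k\ge1$. $q_{\rm nrg}$ is the contraction constant of the inexact linearization: $0\le\mathrm d^2(u_\ell^\star,u_\ell^{k,\underline j})\le q_{\rm nrg}\,\mathrm d^2(u_\ell^\star,u_\ell^{k-1,\underline j})$ for all $(\ell,k,\underline j)\in\mathcal Q$ with $k\ge1$, where $0<q_{\rm nrg}\le1-\frac{2C_{\rm nrg}}{L}\frac{\alpha^2}{C_{\rm cnt}^2}(1-q_{\rm alg})^2<1$. The paper establishes the existence of $C_{\rm nrg}$ and $q_{\rm nrg}$ for the same arbitrary parameters. *)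

theory Defs
  imports "HOL-Analysis.Analysis"
begin

text \<open>
  The constants of the theorem must not depend on the space dimension, so the dimension \<open>d\<close> has
  to be a variable of the logic and not a type. Points of \<open>d\<close>-dimensional space are the elements
  of the topological space \<^const>\<open>Euclidean_space\<close> \<open>d\<close>, i.e. the sequences that vanish from index
  \<open>d\<close> on. Functions are defined on the whole type; only their values on \<open>d\<close>-dimensional space
  matter.
\<close>

type_synonym pt = "nat \<Rightarrow> real"
type_synonym fn = "pt \<Rightarrow> real"
type_synonym vfn = "pt \<Rightarrow> pt"

abbreviation Rd :: "nat \<Rightarrow> pt set" where
  "Rd d \<equiv> topspace (Euclidean_space d)"

abbreviation vnorm :: "nat \<Rightarrow> pt \<Rightarrow> real" where
  "vnorm d x \<equiv> L2_set x {..<d}"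

definition dot :: "nat \<Rightarrow> pt \<Rightarrow> pt \<Rightarrow> real" where
  "dot d x y = (\<Sum>i<d. x i * y i)"

text \<open>A measure on the whole type that is carried by \<^term>\<open>Rd d\<close>.\<close>

definition leb :: "nat \<Rightarrow> pt measure" where
  "leb d = distr (\<Pi>\<^sub>M i\<in>{..<d}. lborel) borel (\<lambda>x i. if i < d then x i else 0)"

definition pd :: "nat \<Rightarrow> fn \<Rightarrow> fn" where
  "pd i \<phi> x = deriv (\<lambda>t. \<phi> (x(i := t))) (x i)"

definition cgrad :: "fn \<Rightarrow> vfn" where
  "cgrad \<phi> x = (\<lambda>i. pd i \<phi> x)"

primrec Ck :: "nat \<Rightarrow> nat \<Rightarrow> fn \<Rightarrow> bool" where
  "Ck d 0 \<phi> \<longleftrightarrow> continuous_map (Euclidean_space d) euclideanreal \<phi>"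
| "Ck d (Suc k) \<phi> \<longleftrightarrow> continuous_map (Euclidean_space d) euclideanreal \<phi> \<and>
     (\<forall>i<d. (\<forall>x\<in>Rd d. (\<lambda>t. \<phi> (x(i := t))) differentiable (at (x i))) \<and> Ck d k (pd i \<phi>))"

definition test_fn :: "nat \<Rightarrow> pt set \<Rightarrow> fn \<Rightarrow> bool" where
  "test_fn d \<Omega> \<phi> \<longleftrightarrow> (\<forall>k. Ck d k \<phi>) \<and>
     (\<exists>K. compactin (Euclidean_space d) K \<and> K \<subseteq> \<Omega> \<and> (\<forall>x\<in>Rd d - K. \<phi> x = 0))"

text \<open>
  A bounded Lipschitz domain. Locally, and after a rotation that makes the unit vector \<open>n\<close> the
  last coordinate direction, \<open>\<Omega>\<close> is the strict epigraph of a Lipschitz function \<open>\<gamma>\<close> of the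
  remaining coordinates, i.e. of a Lipschitz function that is constant in the direction \<open>n\<close>.
\<close>

definition lipschitz_domain :: "nat \<Rightarrow> pt set \<Rightarrow> bool" where
  "lipschitz_domain d \<Omega> \<longleftrightarrow>
     openin (Euclidean_space d) \<Omega> \<and> \<Omega> \<noteq> {} \<and> connectedin (Euclidean_space d) \<Omega> \<and>
     (\<exists>R. \<forall>x\<in>\<Omega>. vnorm d x \<le> R) \<and>
     (\<forall>x \<in> Euclidean_space d frontier_of \<Omega>. \<exists>r>0. \<exists>n\<in>Rd d. \<exists>\<gamma> K. vnorm d n = 1 \<and>
        (\<forall>y\<in>Rd d. \<forall>z\<in>Rd d. \<bar>\<gamma> y - \<gamma> z\<bar> \<le> K * vnorm d (y - z)) \<and>
        (\<forall>y\<in>Rd d. \<forall>t. \<gamma> (\<lambda>i. y i + t * n i) = \<gamma> y) \<and>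
        (\<forall>y\<in>Rd d. vnorm d (y - x) < r \<longrightarrow> (y \<in> \<Omega> \<longleftrightarrow> \<gamma> y < dot d y n)))"

text \<open>
  Elements of Lebesgue and Sobolev spaces are represented by functions; two functions represent
  the same element iff they agree almost everywhere on \<open>\<Omega>\<close>.
\<close>

definition L2_on :: "nat \<Rightarrow> pt set \<Rightarrow> fn \<Rightarrow> bool" where
  "L2_on d S v \<longleftrightarrow> set_borel_measurable (leb d) S v \<and> set_integrable (leb d) S (\<lambda>x. (v x)\<^sup>2)"

text \<open>\<open>v\<close> is in the Sobolev space of order 1, with weak gradient \<open>g\<close>.\<close>

definition H1_grad :: "nat \<Rightarrow> pt set \<Rightarrow> fn \<Rightarrow> vfn \<Rightarrow> bool" where
  "H1_grad d \<Omega> v g \<longleftrightarrow> L2_on d \<Omega> v \<and> (\<forall>i<d. L2_on d \<Omega> (\<lambda>x. g x i)) \<and>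
     (\<forall>\<phi> i. test_fn d \<Omega> \<phi> \<and> i < d \<longrightarrow>
        (LINT x:\<Omega>|leb d. v x * pd i \<phi> x) = - (LINT x:\<Omega>|leb d. g x i * \<phi> x))"

text \<open>\<open>H\<^sup>1\<^sub>0\<close> is the closure of the test functions in \<open>H\<^sup>1\<close>.\<close>

definition H10_grad :: "nat \<Rightarrow> pt set \<Rightarrow> fn \<Rightarrow> vfn \<Rightarrow> bool" where
  "H10_grad d \<Omega> v g \<longleftrightarrow> H1_grad d \<Omega> v g \<and>
     (\<exists>\<phi>. (\<forall>n::nat. test_fn d \<Omega> (\<phi> n)) \<and>
        (\<lambda>n. LINT x:\<Omega>|leb d. (v x - \<phi> n x)\<^sup>2) \<longlonglongrightarrow> 0 \<and>
        (\<lambda>n. LINT x:\<Omega>|leb d. (vnorm d (g x - cgrad (\<phi> n) x))\<^sup>2) \<longlonglongrightarrow> 0)"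

definition H10 :: "nat \<Rightarrow> pt set \<Rightarrow> fn set" where
  "H10 d \<Omega> = {v. \<exists>g. H10_grad d \<Omega> v g}"

definition grad :: "nat \<Rightarrow> pt set \<Rightarrow> fn \<Rightarrow> vfn" where
  "grad d \<Omega> v = (SOME g. H10_grad d \<Omega> v g)"

text \<open>Dimension, domain, nonlinearity \<open>\<mu>\<close>, scalar and vector-valued right-hand side.\<close>

record problem =
  pdim :: nat
  pdom :: "pt set"
  pmu :: "real \<Rightarrow> real"
  pf :: fn
  pvf :: vfn

abbreviation XX :: "problem \<Rightarrow> fn set" where
  "XX P \<equiv> H10 (pdim P) (pdom P)"

abbreviation pgrad :: "problem \<Rightarrow> fn \<Rightarrow> vfn" where
  "pgrad P \<equiv> grad (pdim P) (pdom P)"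

definition problem_data :: "problem \<Rightarrow> real \<Rightarrow> real \<Rightarrow> bool" where
  "problem_data P \<alpha> L \<longleftrightarrow>
     1 \<le> pdim P \<and> lipschitz_domain (pdim P) (pdom P) \<and>
     (\<forall>t\<ge>0. 0 \<le> pmu P t) \<and>
     (\<exists>\<mu>'. continuous_on {0..} \<mu>' \<and>
        (\<forall>t\<ge>0. (pmu P has_real_derivative \<mu>' t) (at t within {0..}))) \<and>
     0 < \<alpha> \<and> \<alpha> \<le> L / 3 \<and>
     (\<forall>s t. 0 \<le> s \<and> s \<le> t \<longrightarrow>
        \<alpha> * (t - s) \<le> pmu P (t\<^sup>2) * t - pmu P (s\<^sup>2) * s \<and>
        pmu P (t\<^sup>2) * t - pmu P (s\<^sup>2) * s \<le> L / 3 * (t - s)) \<and>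
     L2_on (pdim P) (pdom P) (pf P) \<and>
     (\<forall>i<pdim P. L2_on (pdim P) (pdom P) (\<lambda>x. pvf P x i))"

definition enorm :: "problem \<Rightarrow> fn \<Rightarrow> real" where
  "enorm P v = sqrt (LINT x:pdom P|leb (pdim P). (vnorm (pdim P) (pgrad P v x))\<^sup>2)"

definition ae_eq :: "problem \<Rightarrow> fn \<Rightarrow> fn \<Rightarrow> bool" where
  "ae_eq P v w \<longleftrightarrow> (AE x in leb (pdim P). x \<in> pdom P \<longrightarrow> v x = w x)"

definition opA :: "problem \<Rightarrow> fn \<Rightarrow> fn \<Rightarrow> real" where
  "opA P u v = (LINT x:pdom P|leb (pdim P).
     pmu P ((vnorm (pdim P) (pgrad P u x))\<^sup>2) * dot (pdim P) (pgrad P u x) (pgrad P v x))"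

definition rhs :: "problem \<Rightarrow> fn \<Rightarrow> real" where
  "rhs P v = (LINT x:pdom P|leb (pdim P). pf P x * v x) +
     (LINT x:pdom P|leb (pdim P). dot (pdim P) (pvf P x) (pgrad P v x))"

definition energy :: "problem \<Rightarrow> fn \<Rightarrow> real" where
  "energy P v = 1/2 * (LINT x:pdom P|leb (pdim P).
       integral {0..(vnorm (pdim P) (pgrad P v x))\<^sup>2} (pmu P)) - rhs P v"

definition dsq :: "problem \<Rightarrow> fn \<Rightarrow> fn \<Rightarrow> real" where
  "dsq P v w = energy P w - energy P v"

definition galerkin_solution :: "problem \<Rightarrow> fn set \<Rightarrow> fn \<Rightarrow> bool" where
  "galerkin_solution P V u \<longleftrightarrow> u \<in> V \<and> (\<forall>v\<in>V. opA P u v = rhs P v)"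

text \<open>
  An element is a tagged simplex in the sense of Maubach and Traxler: the list
  \<open>[z\<^sub>0, \<dots>, z\<^sub>d]\<close> of its vertices together with its type in \<open>{0, \<dots>, d-1}\<close>; the refinement edge
  is the segment between \<open>z\<^sub>0\<close> and \<open>z\<^sub>d\<close>.
\<close>

type_synonym elem = "pt list \<times> nat"
type_synonym mesh = "elem set"

definition hull_of :: "pt set \<Rightarrow> pt set" where
  "hull_of S = {x. \<exists>c. (\<forall>z\<in>S. 0 \<le> c z) \<and> (\<Sum>z\<in>S. c z) = 1 \<and> x = (\<lambda>i. \<Sum>z\<in>S. c z * z i)}"

definition verts :: "elem \<Rightarrow> pt set" where
  "verts T = set (fst T)"

definition region :: "elem \<Rightarrow> pt set" where
  "region T = hull_of (verts T)"

definition open_region :: "nat \<Rightarrow> elem \<Rightarrow> pt set" where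
  "open_region d T = Euclidean_space d interior_of (region T)"

definition faces :: "elem \<Rightarrow> pt set set" where
  "faces T = (\<lambda>z. hull_of (verts T - {z})) ` verts T"

definition tagged_simplex :: "nat \<Rightarrow> elem \<Rightarrow> bool" where
  "tagged_simplex d T \<longleftrightarrow> length (fst T) = Suc d \<and> distinct (fst T) \<and> verts T \<subseteq> Rd d \<and> snd T < d \<and>
     (\<forall>c. (\<Sum>z\<in>verts T. c z) = 0 \<and> (\<forall>i. (\<Sum>z\<in>verts T. c z * z i) = 0) \<longrightarrow> (\<forall>z\<in>verts T. c z = 0))"

definition conforming :: "mesh \<Rightarrow> bool" where
  "conforming \<T> \<longleftrightarrow> (\<forall>T\<in>\<T>. \<forall>T'\<in>\<T>. T \<noteq> T' \<longrightarrow>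
     verts T \<noteq> verts T' \<and> region T \<inter> region T' = hull_of (verts T \<inter> verts T'))"

text \<open>
  The two children of \<open>(z\<^sub>0, \<dots>, z\<^sub>d)\<close> of type \<open>g\<close>, with midpoint \<open>z' = (z\<^sub>0 + z\<^sub>d) / 2\<close>, are
  \<open>(z\<^sub>0, z', z\<^sub>1, \<dots>, z\<^sub>g, z\<^sub>g\<^sub>+\<^sub>1, \<dots>, z\<^sub>d\<^sub>-\<^sub>1)\<close> and \<open>(z\<^sub>d, z', z\<^sub>1, \<dots>, z\<^sub>g, z\<^sub>d\<^sub>-\<^sub>1, \<dots>, z\<^sub>g\<^sub>+\<^sub>1)\<close>, both of type
  \<open>g + 1\<close> modulo \<open>d\<close>.
\<close>

definition children :: "nat \<Rightarrow> elem \<Rightarrow> mesh" where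
  "children d T = (let zs = fst T; g = snd T; m = (\<lambda>i. (hd zs i + last zs i) / 2) in
     {(hd zs # m # map ((!) zs) [1..<d], Suc g mod d),
      (last zs # m # map ((!) zs) [1..<Suc g] @ rev (map ((!) zs) [Suc g..<d]), Suc g mod d)})"

definition bisect_step :: "nat \<Rightarrow> mesh \<Rightarrow> mesh \<Rightarrow> bool" where
  "bisect_step d \<T> \<T>' \<longleftrightarrow> (\<exists>T\<in>\<T>. \<T>' = (\<T> - {T}) \<union> children d T)"

definition nvb_refinement :: "nat \<Rightarrow> mesh \<Rightarrow> mesh \<Rightarrow> bool" where
  "nvb_refinement d = (bisect_step d)\<^sup>*\<^sup>*"

definition conforming_refinement :: "nat \<Rightarrow> mesh \<Rightarrow> mesh \<Rightarrow> mesh \<Rightarrow> bool" where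
  "conforming_refinement d \<T> \<M> \<T>' \<longleftrightarrow>
     nvb_refinement d \<T> \<T>' \<and> conforming \<T>' \<and> \<M> \<inter> \<T>' = {}"

text \<open>\<open>is_refine d \<T> \<M> \<T>'\<close> says \<open>\<T>' = refine(\<T>, \<M>)\<close>: the coarsest conforming refinement of \<open>\<T>\<close>
  in which all elements of \<open>\<M>\<close> are refined.\<close>

definition is_refine :: "nat \<Rightarrow> mesh \<Rightarrow> mesh \<Rightarrow> mesh \<Rightarrow> bool" where
  "is_refine d \<T> \<M> \<T>' \<longleftrightarrow> conforming_refinement d \<T> \<M> \<T>' \<and>
     (\<forall>\<T>''. conforming_refinement d \<T> \<M> \<T>'' \<longrightarrow> nvb_refinement d \<T>' \<T>'')"

inductive_set meshes :: "nat \<Rightarrow> mesh \<Rightarrow> mesh set" for d \<T>\<^sub>0 where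
  base: "\<T>\<^sub>0 \<in> meshes d \<T>\<^sub>0"
| step: "\<T> \<in> meshes d \<T>\<^sub>0 \<Longrightarrow> \<M> \<subseteq> \<T> \<Longrightarrow> is_refine d \<T> \<M> \<T>' \<Longrightarrow> \<T>' \<in> meshes d \<T>\<^sub>0"

text \<open>
  Admissibility of the tagged initial mesh is the property that makes \<open>refine\<close> well defined on
  all meshes that can be generated from it. It is implied by the usual matching conditions on the tags.
\<close>

definition initial_mesh :: "nat \<Rightarrow> pt set \<Rightarrow> mesh \<Rightarrow> bool" where
  "initial_mesh d \<Omega> \<T>\<^sub>0 \<longleftrightarrow>
     finite \<T>\<^sub>0 \<and> (\<forall>T\<in>\<T>\<^sub>0. tagged_simplex d T) \<and> conforming \<T>\<^sub>0 \<and>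
     (\<Union>T\<in>\<T>\<^sub>0. region T) = Euclidean_space d closure_of \<Omega> \<and>
     (\<forall>\<T>\<in>meshes d \<T>\<^sub>0. \<forall>\<M>\<subseteq>\<T>. \<exists>\<T>'. is_refine d \<T> \<M> \<T>')"

definition polynomial_fn :: "nat \<Rightarrow> nat \<Rightarrow> fn \<Rightarrow> bool" where
  "polynomial_fn d p q \<longleftrightarrow> (\<exists>c :: (nat \<Rightarrow> nat) \<Rightarrow> real. \<forall>x.
     q x = (\<Sum>\<kappa> | (\<forall>i\<ge>d. \<kappa> i = 0) \<and> (\<Sum>i<d. \<kappa> i) \<le> p. c \<kappa> * (\<Prod>i<d. x i ^ \<kappa> i)))"

definition fe_space :: "problem \<Rightarrow> nat \<Rightarrow> mesh \<Rightarrow> fn set" where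
  "fe_space P p \<T> = {v \<in> XX P. \<forall>T\<in>\<T>. \<exists>q. polynomial_fn (pdim P) p q \<and>
     (AE x in leb (pdim P). x \<in> open_region (pdim P) T \<longrightarrow> v x = q x)}"

definition linearization_form ::
  "problem \<Rightarrow> (fn \<Rightarrow> fn \<Rightarrow> fn \<Rightarrow> real) \<Rightarrow> real \<Rightarrow> real \<Rightarrow> bool" where
  "linearization_form P a C_ell C_cnt \<longleftrightarrow> 0 < C_ell \<and> 0 < C_cnt \<and>
     (\<forall>u\<in>XX P.
        (\<forall>v\<in>XX P. \<forall>w\<in>XX P. a u v w = a u w v) \<and>
        (\<forall>v\<in>XX P. \<forall>w\<in>XX P. \<forall>z\<in>XX P. \<forall>c. a u (\<lambda>x. v x + c * w x) z = a u v z + c * a u w z) \<and>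
        (\<forall>v\<in>XX P. C_ell * (enorm P v)\<^sup>2 \<le> a u v v) \<and>
        (\<forall>v\<in>XX P. \<forall>w\<in>XX P. \<bar>a u v w\<bar> \<le> C_cnt * enorm P v * enorm P w))"

definition linearization_map ::
  "problem \<Rightarrow> nat \<Rightarrow> mesh \<Rightarrow> (fn \<Rightarrow> fn \<Rightarrow> fn \<Rightarrow> real) \<Rightarrow> (mesh \<Rightarrow> fn \<Rightarrow> fn) \<Rightarrow> bool" where
  "linearization_map P p \<T>\<^sub>0 a \<Phi> \<longleftrightarrow>
     (\<forall>\<T>\<in>meshes (pdim P) \<T>\<^sub>0. \<forall>u\<in>fe_space P p \<T>. \<Phi> \<T> u \<in> fe_space P p \<T> \<and>
        (\<forall>v\<in>fe_space P p \<T>. a u (\<Phi> \<T> u) v = a u u v + rhs P v - opA P u v))"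

text \<open>The map \<open>\<Psi> \<T> u\<^sup>\<star>\<close> is one solver step for the linear problem with exact solution \<open>u\<^sup>\<star>\<close>.\<close>

definition contractive_solver ::
  "problem \<Rightarrow> nat \<Rightarrow> mesh \<Rightarrow> (mesh \<Rightarrow> fn \<Rightarrow> fn) \<Rightarrow> (mesh \<Rightarrow> fn \<Rightarrow> fn \<Rightarrow> fn) \<Rightarrow> real \<Rightarrow> bool" where
  "contractive_solver P p \<T>\<^sub>0 \<Phi> \<Psi> q_alg \<longleftrightarrow> 0 < q_alg \<and> q_alg < 1 \<and>
     (\<forall>\<T>\<in>meshes (pdim P) \<T>\<^sub>0. \<forall>u\<in>fe_space P p \<T>.
        (\<forall>w\<in>fe_space P p \<T>. \<Psi> \<T> (\<Phi> \<T> u) w \<in> fe_space P p \<T>) \<and>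
        (\<forall>j\<ge>1. enorm P (\<Phi> \<T> u - (\<Psi> \<T> (\<Phi> \<T> u) ^^ j) u)
          \<le> q_alg * enorm P (\<Phi> \<T> u - (\<Psi> \<T> (\<Phi> \<T> u) ^^ (j - 1)) u)))"

definition flux :: "problem \<Rightarrow> fn \<Rightarrow> vfn" where
  "flux P v x = (\<lambda>i. pmu P ((vnorm (pdim P) (pgrad P v x))\<^sup>2) * pgrad P v x i - pvf P x i)"

text \<open>
  The vector-valued right-hand side is only square integrable, so the divergence on an element
  and the normal traces are understood in the weak sense. Integrals over an element \<open>T\<close> are taken
  over its interior: the boundary is a null set, and gradients of functions on \<open>\<Omega>\<close> are
  unspecified outside \<open>\<Omega>\<close>.
\<close>

definition is_elem_div :: "nat \<Rightarrow> elem \<Rightarrow> vfn \<Rightarrow> fn \<Rightarrow> bool" where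
  "is_elem_div d T \<sigma> w \<longleftrightarrow> L2_on d (open_region d T) w \<and>
     (\<forall>\<phi>. test_fn d (open_region d T) \<phi> \<longrightarrow>
        (LINT x:open_region d T|leb d. w x * \<phi> x) =
        - (LINT x:open_region d T|leb d. dot d (\<sigma> x) (cgrad \<phi> x)))"

definition elem_div :: "nat \<Rightarrow> elem \<Rightarrow> vfn \<Rightarrow> fn" where
  "elem_div d T \<sigma> = (SOME w. is_elem_div d T \<sigma> w)"

text \<open>
  Surface measure of a subset \<open>F\<close> of a hyperplane: the measure of a piece of \<open>F\<close> is the volume of
  the right prism of height 1 over it. For \<open>d = 1\<close> it is the unit mass in the point \<open>F\<close>.
\<close>

definition unit_normal :: "nat \<Rightarrow> pt set \<Rightarrow> pt" where
  "unit_normal d F = (SOME n. n \<in> Rd d \<and> vnorm d n = 1 \<and> (\<forall>x\<in>F. \<forall>y\<in>F. dot d n (x - y) = 0))"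

definition surface_measure :: "nat \<Rightarrow> pt set \<Rightarrow> pt measure" where
  "surface_measure d F =
     (let n = unit_normal d F; b = (SOME b. b \<in> F);
          proj = (\<lambda>x i. x i - dot d (x - b) n * n i)
      in distr (restrict_space (leb d)
           {x \<in> Rd d. proj x \<in> F \<and> 0 \<le> dot d (x - b) n \<and> dot d (x - b) n \<le> 1}) borel proj)"

text \<open>
  The outward normal component of \<open>\<sigma>\<close> on \<open>\<partial>T \<inter> \<Omega>\<close>, seen from \<open>T\<close>, is characterized by
  integration by parts on \<open>T\<close>. The jump across a face is the sum of the outward normal components
  from the elements that have this face.
\<close>

definition is_normal_trace :: "nat \<Rightarrow> pt set \<Rightarrow> elem \<Rightarrow> vfn \<Rightarrow> fn \<Rightarrow> bool" where
  "is_normal_trace d \<Omega> T \<sigma> \<gamma> \<longleftrightarrow>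
     (\<forall>\<phi>. test_fn d \<Omega> \<phi> \<longrightarrow>
        (\<forall>F\<in>faces T. set_integrable (surface_measure d F) \<Omega> (\<lambda>x. \<gamma> x * \<phi> x)) \<and>
        (\<Sum>F\<in>faces T. LINT x:\<Omega>|surface_measure d F. \<gamma> x * \<phi> x) =
        (LINT x:open_region d T|leb d. dot d (\<sigma> x) (cgrad \<phi> x) + elem_div d T \<sigma> x * \<phi> x))"

definition normal_trace :: "nat \<Rightarrow> pt set \<Rightarrow> elem \<Rightarrow> vfn \<Rightarrow> fn" where
  "normal_trace d \<Omega> T \<sigma> = (SOME \<gamma>. is_normal_trace d \<Omega> T \<sigma> \<gamma>)"

definition normal_jump :: "nat \<Rightarrow> pt set \<Rightarrow> mesh \<Rightarrow> vfn \<Rightarrow> pt set \<Rightarrow> fn" where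
  "normal_jump d \<Omega> \<T> \<sigma> F x = (\<Sum>T | T \<in> \<T> \<and> F \<in> faces T. normal_trace d \<Omega> T \<sigma> x)"

definition eta_elem_sq :: "problem \<Rightarrow> mesh \<Rightarrow> elem \<Rightarrow> fn \<Rightarrow> real" where
  "eta_elem_sq P \<T> T v =
     (let d = pdim P; \<Omega> = pdom P; vol = measure (leb d) (region T); \<sigma> = flux P v in
        vol powr (2 / real d) * (LINT x:open_region d T|leb d. (pf P x + elem_div d T \<sigma> x)\<^sup>2) +
        vol powr (1 / real d) *
          (\<Sum>F\<in>faces T. LINT x:\<Omega>|surface_measure d F. (normal_jump d \<Omega> \<T> \<sigma> F x)\<^sup>2))"

definition eta_on :: "problem \<Rightarrow> mesh \<Rightarrow> elem set \<Rightarrow> fn \<Rightarrow> real" where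
  "eta_on P \<T> \<U> v = sqrt (\<Sum>T\<in>\<U>. eta_elem_sq P \<T> T v)"

abbreviation eta :: "problem \<Rightarrow> mesh \<Rightarrow> fn \<Rightarrow> real" where
  "eta P \<T> v \<equiv> eta_on P \<T> \<T> v"

definition estimator_well_defined :: "problem \<Rightarrow> nat \<Rightarrow> mesh \<Rightarrow> bool" where
  "estimator_well_defined P p \<T>\<^sub>0 \<longleftrightarrow>
     (\<forall>\<T>\<in>meshes (pdim P) \<T>\<^sub>0. \<forall>v\<in>fe_space P p \<T>. \<forall>T\<in>\<T>.
        (\<exists>w. is_elem_div (pdim P) T (flux P v) w) \<and>
        (\<exists>\<gamma>. is_normal_trace (pdim P) (pdom P) T (flux P v) \<gamma>) \<and>
        (\<forall>F\<in>faces T. set_integrable (surface_measure (pdim P) F) (pdom P)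
           (\<lambda>x. (normal_jump (pdim P) (pdom P) \<T> (flux P v) F x)\<^sup>2)))"

definition stability :: "problem \<Rightarrow> nat \<Rightarrow> mesh \<Rightarrow> real \<Rightarrow> bool" where
  "stability P p \<T>\<^sub>0 C_stab \<longleftrightarrow> 0 < C_stab \<and>
     (\<forall>\<T>\<^sub>H\<in>meshes (pdim P) \<T>\<^sub>0. \<forall>\<T>\<^sub>h\<in>meshes (pdim P) \<T>\<^sub>H.
      \<forall>v\<^sub>H\<in>fe_space P p \<T>\<^sub>H. \<forall>v\<^sub>h\<in>fe_space P p \<T>\<^sub>h.
        \<bar>eta_on P \<T>\<^sub>h (\<T>\<^sub>h \<inter> \<T>\<^sub>H) v\<^sub>h - eta_on P \<T>\<^sub>H (\<T>\<^sub>h \<inter> \<T>\<^sub>H) v\<^sub>H\<bar> \<le> C_stab * enorm P (v\<^sub>h - v\<^sub>H))"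

definition reduction :: "problem \<Rightarrow> nat \<Rightarrow> mesh \<Rightarrow> real \<Rightarrow> bool" where
  "reduction P p \<T>\<^sub>0 q_red \<longleftrightarrow> 0 < q_red \<and> q_red < 1 \<and>
     (\<forall>\<T>\<^sub>H\<in>meshes (pdim P) \<T>\<^sub>0. \<forall>\<T>\<^sub>h\<in>meshes (pdim P) \<T>\<^sub>H. \<forall>v\<^sub>H\<in>fe_space P p \<T>\<^sub>H.
        eta_on P \<T>\<^sub>h (\<T>\<^sub>h - \<T>\<^sub>H) v\<^sub>H \<le> q_red * eta_on P \<T>\<^sub>H (\<T>\<^sub>H - \<T>\<^sub>h) v\<^sub>H)"

text \<open>\<open>us\<close> is the exact solution and \<open>ush \<T>\<close> the exact discrete solution on the mesh \<open>\<T>\<close>.\<close>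

definition reliability :: "problem \<Rightarrow> mesh \<Rightarrow> fn \<Rightarrow> (mesh \<Rightarrow> fn) \<Rightarrow> real \<Rightarrow> bool" where
  "reliability P \<T>\<^sub>0 us ush C_rel \<longleftrightarrow> 0 < C_rel \<and>
     (\<forall>\<T>\<in>meshes (pdim P) \<T>\<^sub>0. enorm P (us - ush \<T>) \<le> C_rel * eta P \<T> (ush \<T>))"

text \<open>Input parameters; \<open>amin\<close> and \<open>jmax\<close> are the initial values of the two variables.\<close>

record params =
  theta :: real
  cmark :: real
  lam_lin :: real
  rho :: real
  amin :: real
  jmax :: nat
  tau :: real

definition admissible_params :: "params \<Rightarrow> bool" where
  "admissible_params A \<longleftrightarrow> 0 < theta A \<and> theta A \<le> 1 \<and> 1 \<le> cmark A \<and> 0 < lam_lin A \<and>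
     0 < rho A \<and> rho A < 1 \<and> 0 < amin A \<and> 1 \<le> jmax A \<and> 0 \<le> tau A"

text \<open>
  A run is described by the meshes \<open>\<T> l\<close>, the marked sets \<open>\<M> l\<close> and the iterates \<open>u l k j\<close>; their
  values matter only for indices that the run reaches. The final iterate of the previous
  linearization step, with which \<open>u l k j\<close> is compared, is \<open>u l k 0\<close>.
\<close>

definition tau_stop :: "problem \<Rightarrow> params \<Rightarrow> (nat \<Rightarrow> mesh) \<Rightarrow> (nat \<Rightarrow> nat \<Rightarrow> nat \<Rightarrow> fn) \<Rightarrow>
    nat \<Rightarrow> nat \<Rightarrow> nat \<Rightarrow> bool" where
  "tau_stop P A \<T> u l k j \<longleftrightarrow>
     eta P (\<T> l) (u l k j) + enorm P (u l k j - u l k 0) + enorm P (u l k j - u l k (j - 1)) \<le> tau A"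

definition leave_j :: "problem \<Rightarrow> (nat \<Rightarrow> nat \<Rightarrow> nat \<Rightarrow> fn) \<Rightarrow> nat \<Rightarrow> nat \<Rightarrow> nat \<Rightarrow> real \<Rightarrow> nat \<Rightarrow> bool" where
  "leave_j P u l k j am Jm \<longleftrightarrow>
     (let ratio = dsq P (u l k j) (u l k 0) / (enorm P (u l k j - u l k 0))\<^sup>2 in
        ae_eq P (u l k j) (u l k 0) \<or> am \<le> ratio \<or> (0 < ratio \<and> Jm < j))"

definition leave_k :: "problem \<Rightarrow> params \<Rightarrow> (nat \<Rightarrow> mesh) \<Rightarrow> (nat \<Rightarrow> nat \<Rightarrow> nat \<Rightarrow> fn) \<Rightarrow>
    nat \<Rightarrow> nat \<Rightarrow> nat \<Rightarrow> bool" where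
  "leave_k P A \<T> u l k j \<longleftrightarrow>
     dsq P (u l k j) (u l k 0) \<le> lam_lin A * (eta P (\<T> l) (u l k j))\<^sup>2"

text \<open>\<open>reached P A \<T> u l k j am Jm\<close>: the run defines \<open>u l k j\<close>, and at that moment the variables
  \<open>\<alpha>\<^sub>m\<^sub>i\<^sub>n\<close> and \<open>J\<^sub>m\<^sub>a\<^sub>x\<close> have the values \<open>am\<close> and \<open>Jm\<close>.\<close>

inductive reached :: "problem \<Rightarrow> params \<Rightarrow> (nat \<Rightarrow> mesh) \<Rightarrow> (nat \<Rightarrow> nat \<Rightarrow> nat \<Rightarrow> fn) \<Rightarrow>
    nat \<Rightarrow> nat \<Rightarrow> nat \<Rightarrow> real \<Rightarrow> nat \<Rightarrow> bool" for P A \<T> u where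
  start: "reached P A \<T> u 0 0 0 (amin A) (jmax A)"
| first_k: "reached P A \<T> u l 0 0 am Jm \<Longrightarrow> reached P A \<T> u l 1 0 am Jm"
| first_j: "reached P A \<T> u l k 0 am Jm \<Longrightarrow> 1 \<le> k \<Longrightarrow> reached P A \<T> u l k 1 am Jm"
| next_j: "reached P A \<T> u l k j am Jm \<Longrightarrow> 1 \<le> k \<Longrightarrow> 1 \<le> j \<Longrightarrow> \<not> tau_stop P A \<T> u l k j \<Longrightarrow>
    \<not> leave_j P u l k j am Jm \<Longrightarrow> reached P A \<T> u l k (Suc j) am Jm"
| next_k: "reached P A \<T> u l k j am Jm \<Longrightarrow> 1 \<le> k \<Longrightarrow> 1 \<le> j \<Longrightarrow> \<not> tau_stop P A \<T> u l k j \<Longrightarrow>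
    leave_j P u l k j am Jm \<Longrightarrow> \<not> leave_k P A \<T> u l k j \<Longrightarrow>
    reached P A \<T> u l (Suc k) 0 (if Jm < j then rho A * am else am) (if Jm < j then j else Jm)"
| next_l: "reached P A \<T> u l k j am Jm \<Longrightarrow> 1 \<le> k \<Longrightarrow> 1 \<le> j \<Longrightarrow> \<not> tau_stop P A \<T> u l k j \<Longrightarrow>
    leave_j P u l k j am Jm \<Longrightarrow> leave_k P A \<T> u l k j \<Longrightarrow>
    reached P A \<T> u (Suc l) 0 0 (if Jm < j then rho A * am else am) (if Jm < j then j else Jm)"

definition marking :: "problem \<Rightarrow> params \<Rightarrow> mesh \<Rightarrow> fn \<Rightarrow> mesh \<Rightarrow> bool" where
  "marking P A \<T> v \<M> \<longleftrightarrow> \<M> \<subseteq> \<T> \<and> theta A * (eta P \<T> v)\<^sup>2 \<le> (eta_on P \<T> \<M> v)\<^sup>2 \<and>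
     (\<forall>\<N>\<subseteq>\<T>. theta A * (eta P \<T> v)\<^sup>2 \<le> (eta_on P \<T> \<N> v)\<^sup>2 \<longrightarrow>
        real (card \<M>) \<le> cmark A * real (card \<N>))"

definition ailfem_run :: "problem \<Rightarrow> nat \<Rightarrow> mesh \<Rightarrow> params \<Rightarrow> (mesh \<Rightarrow> fn \<Rightarrow> fn) \<Rightarrow>
    (mesh \<Rightarrow> fn \<Rightarrow> fn \<Rightarrow> fn) \<Rightarrow> (nat \<Rightarrow> mesh) \<Rightarrow> (nat \<Rightarrow> mesh) \<Rightarrow> (nat \<Rightarrow> nat \<Rightarrow> nat \<Rightarrow> fn) \<Rightarrow> bool" where
  "ailfem_run P p \<T>\<^sub>0 A \<Phi> \<Psi> \<T> \<M> u \<longleftrightarrow>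
     \<T> 0 = \<T>\<^sub>0 \<and> u 0 0 0 \<in> fe_space P p \<T>\<^sub>0 \<and>
     (\<forall>l am Jm. reached P A \<T> u l 0 0 am Jm \<longrightarrow> u l 1 0 = u l 0 0) \<and>
     (\<forall>l k j am Jm. reached P A \<T> u l k j am Jm \<and> 1 \<le> k \<and> 1 \<le> j \<longrightarrow>
        u l k j = \<Psi> (\<T> l) (\<Phi> (\<T> l) (u l k 0)) (u l k (j - 1))) \<and>
     (\<forall>l k j am Jm. reached P A \<T> u l k j am Jm \<and> 1 \<le> k \<and> 1 \<le> j \<and>
        \<not> tau_stop P A \<T> u l k j \<and> leave_j P u l k j am Jm \<longrightarrow>
        (if leave_k P A \<T> u l k j
         then marking P A (\<T> l) (u l k j) (\<M> l) \<and>
              is_refine (pdim P) (\<T> l) (\<M> l) (\<T> (Suc l)) \<and> u (Suc l) 0 0 = u l k j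
         else u l (Suc k) 0 = u l k j))"

definition QQ :: "problem \<Rightarrow> params \<Rightarrow> (nat \<Rightarrow> mesh) \<Rightarrow> (nat \<Rightarrow> nat \<Rightarrow> nat \<Rightarrow> fn) \<Rightarrow>
    (nat \<times> nat \<times> nat) set" where
  "QQ P A \<T> u = {(l, k, j). \<exists>am Jm. reached P A \<T> u l k j am Jm}"

abbreviation lex_order :: "((nat \<times> nat \<times> nat) \<times> (nat \<times> nat \<times> nat)) set" where
  "lex_order \<equiv> less_than <*lex*> less_than <*lex*> less_than"

definition steps :: "(nat \<times> nat \<times> nat) set \<Rightarrow> nat \<times> nat \<times> nat \<Rightarrow> nat" where
  "steps Q q = card {q' \<in> Q. (q', q) \<in> lex_order}"

definition j_last :: "(nat \<times> nat \<times> nat) set \<Rightarrow> nat \<Rightarrow> nat \<Rightarrow> enat" where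
  "j_last Q l k = (SUP j \<in> {j. (l, k, j) \<in> Q}. enat j)"

text \<open>The final iterate \<open>u l k j\<close> with \<open>j = j_last Q l k\<close>; used only if \<open>j_last\<close> is finite.\<close>

definition u_last :: "(nat \<times> nat \<times> nat) set \<Rightarrow> (nat \<Rightarrow> nat \<Rightarrow> nat \<Rightarrow> fn) \<Rightarrow> nat \<Rightarrow> nat \<Rightarrow> fn" where
  "u_last Q u l k = u l k (the_enat (j_last Q l k))"

definition u_lin :: "(mesh \<Rightarrow> fn \<Rightarrow> fn) \<Rightarrow> (nat \<Rightarrow> mesh) \<Rightarrow> (nat \<Rightarrow> nat \<Rightarrow> nat \<Rightarrow> fn) \<Rightarrow> nat \<Rightarrow> nat \<Rightarrow> fn" where
  "u_lin \<Phi> \<T> u l k = (if k = 0 then u l 0 0 else \<Phi> (\<T> l) (u l k 0))"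

definition quasi_error :: "problem \<Rightarrow> (mesh \<Rightarrow> fn) \<Rightarrow> (mesh \<Rightarrow> fn \<Rightarrow> fn) \<Rightarrow> (nat \<Rightarrow> mesh) \<Rightarrow>
    (nat \<Rightarrow> nat \<Rightarrow> nat \<Rightarrow> fn) \<Rightarrow> nat \<times> nat \<times> nat \<Rightarrow> real" where
  "quasi_error P ush \<Phi> \<T> u = (\<lambda>(l, k, j).
     eta P (\<T> l) (ush (\<T> l)) + enorm P (ush (\<T> l) - u_lin \<Phi> \<T> u l k) +
     enorm P (u_lin \<Phi> \<T> u l k - u l k j))"

end

theory Submission
  imports Defs
begin

text \<open>
  The energy is convex, and \<open>\<alpha>/2 |||v - u\<^sub>H\<^sup>\<star>|||\<^sup>2 \<le> d\<^sup>2(u\<^sub>H\<^sup>\<star>, v) \<le> L/2 |||v - u\<^sub>H\<^sup>\<star>|||\<^sup>2\<close> on every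
  Galerkin space. Consider \<open>\<Lambda> = d\<^sup>2(u\<^sup>\<star>, w) + \<gamma> \<eta>(w)\<^sup>2\<close> for the final iterate \<open>w\<close> of a
  linearization step. It is the sum of \<open>D = d\<^sup>2(u\<^sup>\<star>, u\<^sub>H\<^sup>\<star>)\<close> and
  \<open>Z = d\<^sup>2(u\<^sub>H\<^sup>\<star>, w) + \<gamma> \<eta>(w)\<^sup>2\<close>, and reliability and stability give \<open>D \<le> K Z\<close>. After the next
  step, \<open>\<Lambda>\<close> is at most \<open>D + s Z\<close> with \<open>s < 1\<close>: if the mesh is kept, the violated stopping
  criterion bounds the new estimator by the energy; if the mesh is refined, Doerfler marking
  reduces the estimator, while the increase of \<open>d\<^sup>2(u\<^sub>H\<^sup>\<star>, w)\<close> is exactly the decrease of \<open>D\<close>. In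
  either case the perturbations are absorbed by choosing the weight \<open>\<gamma>\<close> small, so no parameter of
  the algorithm has to be small. Hence \<open>\<Lambda>\<close> contracts from one linearization step to the next. As
  the solver loops have at most \<open>j\<^sub>0\<close> steps and do not increase the quasi-error, the quasi-error
  inherits the linear convergence.
\<close>

section \<open>Square integrable functions\<close>

text \<open>Energy differences are additive by definition, so splitting \<Lambda> at a discrete
  solution is an identity and not an estimate. On refinement the split is made at the solution of
  the old mesh; the one on the new mesh does not occur. A step shrinks only Z, and the bound of D by
  a multiple of Z turns this into a loss for the sum.

  Gradients are picked by \<open>SOME\<close> and functions matter only up to null sets. Hence weak
  gradients are first shown to be unique almost everywhere; only then is the gradient of a
  difference the difference of the gradients, and pointwise convexity of the energy density can be
  integrated. The outcome of this analysis is \<open>dsq_galerkin\<close>.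

  The contraction happens once per linearization step, whereas the claim counts solver steps, during
  which \<Lambda> does not change. A weight \<open>\<omega> ^ Suc j\<close> therefore credits in
  advance the gain of the whole loop, so that every transition contracts; since the loops are
  bounded, the weight stays away from 0.

  Finally, \<open>q_lin\<close> and \<open>C_lin\<close> must be fixed before the problem is given,
  so all constants are built from numbers alone.\<close>

definition sq_integrable :: "'a measure \<Rightarrow> ('a \<Rightarrow> real) \<Rightarrow> bool" where
  "sq_integrable N f \<longleftrightarrow> f \<in> borel_measurable N \<and> integrable N (\<lambda>x. (f x)\<^sup>2)"

lemma sq_integrable_measurable [measurable_dest]:
  "sq_integrable N f \<Longrightarrow> f \<in> borel_measurable N"
  by (simp add: sq_integrable_def)

lemma sq_integrable_mult:
  assumes "sq_integrable N f" "sq_integrable N g"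
  shows "integrable N (\<lambda>x. f x * g x)"
proof (rule Bochner_Integration.integrable_bound)
  show "integrable N (\<lambda>x. (f x)\<^sup>2 + (g x)\<^sup>2)"
    using assms by (auto simp: sq_integrable_def)
  show "(\<lambda>x. f x * g x) \<in> borel_measurable N"
    using assms by (auto simp: sq_integrable_def)
  have "\<bar>a * b\<bar> \<le> a\<^sup>2 + b\<^sup>2" for a b :: real
  proof -
    have "0 \<le> \<bar>a\<bar> * \<bar>b\<bar>" "2 * \<bar>a\<bar> * \<bar>b\<bar> \<le> a\<^sup>2 + b\<^sup>2"
      using sum_squares_bound[of "\<bar>a\<bar>" "\<bar>b\<bar>"] by simp_all
    then show ?thesis
      unfolding abs_mult by linarith
  qed
  then show "AE x in N. norm (f x * g x) \<le> norm ((f x)\<^sup>2 + (g x)\<^sup>2)"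
    by simp
qed

lemma sq_integrable_diff:
  assumes "sq_integrable N f" "sq_integrable N g"
  shows "sq_integrable N (\<lambda>x. f x - g x)"
proof -
  have "integrable N (\<lambda>x. (f x)\<^sup>2 + (g x)\<^sup>2 - 2 * (f x * g x))"
    using assms sq_integrable_mult[OF assms] by (intro Bochner_Integration.integrable_diff
        Bochner_Integration.integrable_add integrable_mult_right) (auto simp: sq_integrable_def)
  moreover have "(\<lambda>x. (f x - g x)\<^sup>2) = (\<lambda>x. (f x)\<^sup>2 + (g x)\<^sup>2 - 2 * (f x * g x))"
    by (simp add: power2_diff algebra_simps)
  ultimately show ?thesis
    using assms by (auto simp: sq_integrable_def)
qed

lemma vnorm_sq: "(vnorm d x)\<^sup>2 = (\<Sum>i<d. (x i)\<^sup>2)"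
  by (simp add: L2_set_def sum_nonneg)

lemma vnorm_diff_sq_le: "(vnorm d (x - y))\<^sup>2 \<le> 2 * (vnorm d x)\<^sup>2 + 2 * (vnorm d y)\<^sup>2"
proof -
  have "(a - b)\<^sup>2 \<le> 2 * a\<^sup>2 + 2 * b\<^sup>2" for a b :: real
    using zero_le_power2[of "a + b"] by (simp add: power2_eq_square algebra_simps)
  then show ?thesis
    by (simp add: vnorm_sq sum_distrib_left flip: sum.distrib) (intro sum_mono, simp)
qed

abbreviation sq_integrable_vec :: "'a measure \<Rightarrow> nat \<Rightarrow> ('a \<Rightarrow> pt) \<Rightarrow> bool" where
  "sq_integrable_vec N d g \<equiv> \<forall>i<d. sq_integrable N (\<lambda>x. g x i)"

lemma integrable_vnorm_sq:
  assumes "sq_integrable_vec N d g"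
  shows "integrable N (\<lambda>x. (vnorm d (g x))\<^sup>2)"
  unfolding vnorm_sq using assms by (intro Bochner_Integration.integrable_sum) (auto simp: sq_integrable_def)

lemma integrable_dot:
  assumes "sq_integrable_vec N d g" "sq_integrable_vec N d h"
  shows "integrable N (\<lambda>x. dot d (g x) (h x))"
  unfolding dot_def using assms by (intro Bochner_Integration.integrable_sum) (auto intro!: sq_integrable_mult)

lemma measurable_vnorm_sq:
  assumes "sq_integrable_vec N d g"
  shows "(\<lambda>x. (vnorm d (g x))\<^sup>2) \<in> borel_measurable N"
  using integrable_vnorm_sq[OF assms] by blast

section \<open>Test functions\<close>

lemma upd_in_Rd: "x \<in> Rd d \<Longrightarrow> i < d \<Longrightarrow> x(i := t) \<in> Rd d"
  by (auto simp: topspace_Euclidean_space)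

lemma differentiable_pd:
  assumes "(\<lambda>t. \<phi> (x(i := t))) differentiable (at (x i))"
  shows "((\<lambda>t. \<phi> (x(i := t))) has_real_derivative pd i \<phi> x) (at (x i))"
  using assms unfolding pd_def real_differentiable_def by (metis DERIV_imp_deriv)

text \<open>Functions are arbitrary off \<open>Rd d\<close>, so the partial derivatives of a
  difference are known only at points of \<open>Rd d\<close>. A free \<zeta> that agrees with the
  difference there lets the induction hypothesis apply to \<open>pd i \<zeta>\<close>.\<close>

lemma Ck_diff:
  assumes "Ck d k \<phi>" "Ck d k \<psi>" "\<And>x. x \<in> Rd d \<Longrightarrow> \<zeta> x = \<phi> x - \<psi> x"
  shows "Ck d k \<zeta>"
  using assms
proof (induction k arbitrary: \<phi> \<psi> \<zeta>)
  case 0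
  then have "continuous_map (Euclidean_space d) euclideanreal (\<lambda>x. \<phi> x - \<psi> x)"
    by (intro continuous_map_diff) auto
  with 0 show ?case
    by (auto elim: continuous_map_eq)
next
  case (Suc k)
  have "continuous_map (Euclidean_space d) euclideanreal (\<lambda>x. \<phi> x - \<psi> x)"
    using Suc.prems by (intro continuous_map_diff) auto
  then have "continuous_map (Euclidean_space d) euclideanreal \<zeta>"
    using Suc.prems by (auto elim: continuous_map_eq)
  moreover have deriv: "((\<lambda>t. \<zeta> (x(i := t))) has_real_derivative pd i \<phi> x - pd i \<psi> x) (at (x i))"
    if "x \<in> Rd d" "i < d" for x i
  proof -
    have "(\<lambda>t. \<zeta> (x(i := t))) = (\<lambda>t. \<phi> (x(i := t)) - \<psi> (x(i := t)))"
      using Suc.prems(3) upd_in_Rd[OF that] by blast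
    then show ?thesis
      using Suc.prems that by (auto intro!: DERIV_diff differentiable_pd)
  qed
  moreover have "Ck d k (pd i \<zeta>)" if "i < d" for i
  proof (rule Suc.IH)
    show "pd i \<zeta> x = pd i \<phi> x - pd i \<psi> x" if "x \<in> Rd d" for x
      unfolding pd_def[of i \<zeta>] using deriv[OF that \<open>i < d\<close>] by (rule DERIV_imp_deriv)
  qed (use Suc.prems that in auto)
  ultimately show ?case
    by (auto simp: real_differentiable_def)
qed

lemma test_fn_differentiable:
  assumes "test_fn d \<Omega> \<phi>" "x \<in> Rd d" "i < d"
  shows "((\<lambda>t. \<phi> (x(i := t))) has_real_derivative pd i \<phi> x) (at (x i))"
proof -
  have "Ck d (Suc 0) \<phi>"
    using assms by (simp only: test_fn_def)
  with assms show ?thesis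
    by (intro differentiable_pd) simp
qed

lemma pd_diff:
  assumes "test_fn d \<Omega> \<phi>" "test_fn d \<Omega> \<psi>" "x \<in> Rd d" "i < d"
  shows "pd i (\<phi> - \<psi>) x = pd i \<phi> x - pd i \<psi> x"
  unfolding pd_def[of i "\<phi> - \<psi>"] minus_apply
  by (rule DERIV_imp_deriv, rule DERIV_diff) (use assms test_fn_differentiable in auto)

lemma test_fn_diff:
  assumes "test_fn d \<Omega> \<phi>" "test_fn d \<Omega> \<psi>"
  shows "test_fn d \<Omega> (\<phi> - \<psi>)"
proof -
  from assms obtain K K' where
    "compactin (Euclidean_space d) K" "K \<subseteq> \<Omega>" "\<forall>x\<in>Rd d - K. \<phi> x = 0"
    "compactin (Euclidean_space d) K'" "K' \<subseteq> \<Omega>" "\<forall>x\<in>Rd d - K'. \<psi> x = 0"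
    unfolding test_fn_def by metis
  then have "compactin (Euclidean_space d) (K \<union> K') \<and> K \<union> K' \<subseteq> \<Omega> \<and>
      (\<forall>x\<in>Rd d - (K \<union> K'). (\<phi> - \<psi>) x = 0)"
    by (auto intro: compactin_Un)
  moreover have "Ck d k (\<phi> - \<psi>)" for k
    by (rule Ck_diff[of _ _ \<phi> \<psi>]) (use assms in \<open>auto simp: test_fn_def\<close>)
  ultimately show ?thesis
    unfolding test_fn_def by blast
qed

text \<open>The compact set \<open>K\<close> of \<phi> serves again: its complement in
  \<open>Rd d\<close> is open, and changing a coordinate below \<open>d\<close> stays in
  \<open>Rd d\<close>, so near a point off \<open>K\<close> the function vanishes along the
  coordinate line.\<close>

lemma test_fn_pd:
  assumes "test_fn d \<Omega> \<phi>" "i < d"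
  shows "test_fn d \<Omega> (pd i \<phi>)"
proof -
  from assms obtain K where K:
    "compactin (Euclidean_space d) K" "K \<subseteq> \<Omega>" "\<forall>x\<in>Rd d - K. \<phi> x = 0"
    unfolding test_fn_def by metis
  have "Ck d k (pd i \<phi>)" for k
  proof -
    have "Ck d (Suc k) \<phi>"
      using assms by (simp only: test_fn_def)
    with assms show ?thesis by simp
  qed
  moreover have "pd i \<phi> x = 0" if x: "x \<in> Rd d - K" for x
  proof -
    have "closedin (Euclidean_space d) K"
      using K(1) Hausdorff_Euclidean_space compactin_imp_closedin by blast
    then have "openin (Euclidean_space d) (Rd d - K)"
      by blast
    moreover have "continuous_map euclideanreal (Euclidean_space d) (\<lambda>t. x(i := t))"
      using x assms(2) unfolding continuous_map_componentwise_Euclidean_space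
      by (auto simp: Euclidean_space_def continuous_map_in_subtopology continuous_map_componentwise_UNIV
          intro!: continuous_intros)
    ultimately have "open {t. x(i := t) \<in> Rd d - K}"
      using openin_continuous_map_preimage by fastforce
    then have "\<forall>\<^sub>F t in nhds (x i). t \<in> {t. x(i := t) \<in> Rd d - K}"
      using x by (intro eventually_nhds_in_open) auto
    then have "\<forall>\<^sub>F t in nhds (x i). \<phi> (x(i := t)) = 0"
      by eventually_elim (use K in auto)
    then have "((\<lambda>t. \<phi> (x(i := t))) has_real_derivative 0) (at (x i))"
      by (subst DERIV_cong_ev[where g = "\<lambda>_. 0"]) auto
    then show ?thesis
      unfolding pd_def by (rule DERIV_imp_deriv)
  qed
  ultimately show ?thesis
    using K unfolding test_fn_def by blast
qed

section \<open>Weak gradients\<close>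

lemma space_leb [simp]: "space (leb d) = UNIV"
  by (simp add: leb_def)

lemma sets_leb [simp, measurable_cong]: "sets (leb d) = sets borel"
  by (simp add: leb_def)

lemma Rd_borel: "Rd d \<in> sets borel"
  using closedin_Euclidean_space_iff[of d "Rd d"] by (simp add: borel_closed)

lemma openin_borel:
  assumes "openin (Euclidean_space d) S"
  shows "S \<in> sets borel"
proof -
  obtain T where "open T" "S = T \<inter> {x. \<forall>i\<ge>d. x i = 0}"
    using assms unfolding Euclidean_space_def euclidean_product_topology openin_subtopology
      open_openin[symmetric] by blast
  moreover have "{x. \<forall>i\<ge>d. x i = 0} \<in> sets (borel :: pt measure)"
    using Rd_borel[of d] by (simp add: topspace_Euclidean_space)
  ultimately show ?thesis
    by auto
qed

lemma sq_le_vnorm_sq: "i < d \<Longrightarrow> (x i)\<^sup>2 \<le> (vnorm d x)\<^sup>2"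
  unfolding vnorm_sq by (rule member_le_sum) auto

section \<open>Square integrability on a bounded open set\<close>

locale bounded_domain =
  fixes d :: nat and \<Omega> :: "pt set"
  assumes openin: "openin (Euclidean_space d) \<Omega>"
    and bounded: "\<exists>R. \<forall>x\<in>\<Omega>. vnorm d x \<le> R"
begin

definition N :: "pt measure" where
  "N = restrict_space (leb d) \<Omega>"

lemma dom_borel: "\<Omega> \<in> sets borel"
  using openin by (rule openin_borel)

lemma dom_subset: "\<Omega> \<subseteq> Rd d"
  using openin by (rule openin_subset)

lemma space_N [simp]: "space N = \<Omega>"
  by (simp add: N_def space_restrict_space)

lemma LINT_N: "(LINT x:\<Omega>|leb d. f x) = integral\<^sup>L N (f :: fn)"
  by (simp add: N_def set_lebesgue_integral_def integral_restrict_space dom_borel)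

lemma L2_on_N: "L2_on d \<Omega> v \<longleftrightarrow> sq_integrable N v"
  by (simp add: L2_on_def N_def sq_integrable_def set_borel_measurable_def set_integrable_def
      integrable_restrict_space borel_measurable_restrict_space_iff dom_borel)

text \<open>\<open>leb d\<close> is the image of a product measure, and the preimage of a bounded
  set lies in the box \<open>?B\<close>, whose product measure is finite.\<close>

lemma finite_N: "finite_measure N"
proof
  obtain R where R: "\<And>x. x \<in> \<Omega> \<Longrightarrow> vnorm d x \<le> R"
    using bounded by blast
  interpret product_sigma_finite "\<lambda>_ :: nat. lborel :: real measure" ..
  let ?M = "\<Pi>\<^sub>M i\<in>{..<d}. (lborel :: real measure)"
  let ?ext = "\<lambda>x i. if i < d then x i else (0 :: real)"
  let ?B = "\<Pi>\<^sub>E i\<in>{..<d}. {- R..R}"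
  have [measurable]: "?ext \<in> ?M \<rightarrow>\<^sub>M borel"
  proof (rule measurable_coordinatewise_then_product)
    show "(\<lambda>x. ?ext x i) \<in> borel_measurable ?M" for i
      by (cases "i < d") auto
  qed
  have "?ext -` \<Omega> \<inter> space ?M \<subseteq> ?B"
  proof
    fix x assume x: "x \<in> ?ext -` \<Omega> \<inter> space ?M"
    then have "vnorm d (?ext x) \<le> R"
      using R by blast
    moreover have "\<bar>?ext x i\<bar> \<le> vnorm d (?ext x)" if "i < d" for i
      using sq_le_vnorm_sq[OF that, of "?ext x"] by (rule abs_le_square_iff[THEN iffD2, of _ "vnorm d (?ext x)", simplified])
    ultimately have "\<bar>x i\<bar> \<le> R" if "i < d" for i
      using that by fastforce
    with x show "x \<in> ?B"
      by (auto simp: space_PiM PiE_def abs_le_iff minus_le_iff)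
  qed
  then have "emeasure ?M (?ext -` \<Omega> \<inter> space ?M) \<le> emeasure ?M ?B"
    by (rule emeasure_mono) (rule sets_PiM_I_finite; simp)
  also have "\<dots> = (\<Prod>i<d. emeasure lborel {- R..R})"
    by (rule emeasure_PiM) auto
  also have "\<dots> < top"
    by (auto simp: less_top[symmetric] emeasure_lborel_Icc_eq power_eq_top_ennreal_iff power_0_left)
  finally show "emeasure N (space N) \<noteq> \<infinity>"
    using dom_borel by (simp add: N_def emeasure_restrict_space space_restrict_space leb_def emeasure_distr)
qed

text \<open>Bounded on a compact set by continuity and zero off it, hence bounded on a space of
  finite measure.\<close>

lemma sq_integrable_test_fn:
  assumes "test_fn d \<Omega> \<phi>"
  shows "sq_integrable N \<phi>"
proof -
  have "Ck d 0 \<phi>"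
    using assms unfolding test_fn_def by blast
  then have cont: "continuous_on (Rd d) \<phi>"
    by (simp add: continuous_map_Euclidean_space_iff)
  have "\<phi> \<in> borel_measurable (restrict_space borel \<Omega>)"
    using cont dom_subset by (intro borel_measurable_continuous_on_restrict) (rule continuous_on_subset)
  moreover have "sets N = sets (restrict_space borel \<Omega>)"
    unfolding N_def by (rule sets_restrict_space_cong) simp
  ultimately have meas: "\<phi> \<in> borel_measurable N"
    using measurable_cong_sets by blast
  obtain K where K: "compactin (Euclidean_space d) K" "\<forall>x\<in>Rd d - K. \<phi> x = 0"
    using assms unfolding test_fn_def by metis
  have "compactin euclideanreal (\<phi> ` K)"
    using K(1) \<open>Ck d 0 \<phi>\<close> unfolding Ck.simps by (rule image_compactin)
  then obtain B where "\<And>x. x \<in> K \<Longrightarrow> \<bar>\<phi> x\<bar> \<le> B"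
    using compact_imp_bounded[of "\<phi> ` K"] by (auto simp: bounded_iff)
  then have "\<bar>\<phi> x\<bar> \<le> max B 0" if "x \<in> \<Omega>" for x
    using K(2) dom_subset that by (cases "x \<in> K") fastforce+
  then have "(\<phi> x)\<^sup>2 \<le> (max B 0)\<^sup>2" if "x \<in> \<Omega>" for x
    using that by (metis abs_ge_zero power2_abs power_mono)
  then have "integrable N (\<lambda>x. (\<phi> x)\<^sup>2)"
    using meas by (intro finite_measure.integrable_const_bound[OF finite_N, of _ "(max B 0)\<^sup>2"]) auto
  with meas show ?thesis
    by (simp add: sq_integrable_def)
qed

lemma sq_integrable_cgrad:
  assumes "test_fn d \<Omega> \<phi>"
  shows "sq_integrable_vec N d (cgrad \<phi>)"
  unfolding cgrad_def using assms by (blast intro: sq_integrable_test_fn test_fn_pd)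

lemma H1_grad_N:
  "H1_grad d \<Omega> v g \<longleftrightarrow> sq_integrable N v \<and> sq_integrable_vec N d g \<and>
     (\<forall>\<phi> i. test_fn d \<Omega> \<phi> \<and> i < d \<longrightarrow>
        integral\<^sup>L N (\<lambda>x. v x * pd i \<phi> x) = - integral\<^sup>L N (\<lambda>x. g x i * \<phi> x))"
  by (simp add: H1_grad_def L2_on_N LINT_N)

lemma H10_grad_N:
  "H10_grad d \<Omega> v g \<longleftrightarrow> H1_grad d \<Omega> v g \<and>
     (\<exists>\<phi>. (\<forall>n::nat. test_fn d \<Omega> (\<phi> n)) \<and>
        (\<lambda>n. integral\<^sup>L N (\<lambda>x. (v x - \<phi> n x)\<^sup>2)) \<longlonglongrightarrow> 0 \<and>
        (\<lambda>n. integral\<^sup>L N (\<lambda>x. (vnorm d (g x - cgrad (\<phi> n) x))\<^sup>2)) \<longlonglongrightarrow> 0)"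
  by (simp add: H10_grad_def LINT_N)

lemma H10_grad_sq_integrable:
  assumes "H10_grad d \<Omega> v g"
  shows "sq_integrable N v" "sq_integrable_vec N d g"
  using assms unfolding H10_grad_N H1_grad_N by blast+

lemma sq_integrable_vec_diff:
  assumes "sq_integrable_vec N d g" "sq_integrable_vec N d h"
  shows "sq_integrable_vec N d (\<lambda>x. g x - h x)"
  using assms by (auto intro: sq_integrable_diff)

lemma integral_sq_diff_le:
  assumes "sq_integrable N f" "sq_integrable N g"
  shows "integral\<^sup>L N (\<lambda>x. (f x - g x)\<^sup>2)
    \<le> 2 * integral\<^sup>L N (\<lambda>x. (f x)\<^sup>2) + 2 * integral\<^sup>L N (\<lambda>x. (g x)\<^sup>2)"
proof -
  have "integral\<^sup>L N (\<lambda>x. (f x - g x)\<^sup>2) \<le> integral\<^sup>L N (\<lambda>x. 2 * (f x)\<^sup>2 + 2 * (g x)\<^sup>2)"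
  proof (rule integral_mono)
    show "(f x - g x)\<^sup>2 \<le> 2 * (f x)\<^sup>2 + 2 * (g x)\<^sup>2" for x
      using zero_le_power2[of "f x + g x"] by (simp add: power2_eq_square algebra_simps)
  qed (use assms sq_integrable_diff[OF assms] in \<open>auto simp: sq_integrable_def\<close>)
  also have "\<dots> = 2 * integral\<^sup>L N (\<lambda>x. (f x)\<^sup>2) + 2 * integral\<^sup>L N (\<lambda>x. (g x)\<^sup>2)"
    using assms by (simp add: sq_integrable_def)
  finally show ?thesis .
qed

lemma integral_vnorm_sq_diff_le:
  assumes "sq_integrable_vec N d g" "sq_integrable_vec N d h"
  shows "integral\<^sup>L N (\<lambda>x. (vnorm d (g x - h x))\<^sup>2)
    \<le> 2 * integral\<^sup>L N (\<lambda>x. (vnorm d (g x))\<^sup>2) + 2 * integral\<^sup>L N (\<lambda>x. (vnorm d (h x))\<^sup>2)"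
proof -
  have "integrable N (\<lambda>x. (vnorm d (g x - h x))\<^sup>2)"
    by (rule integrable_vnorm_sq) (rule sq_integrable_vec_diff[OF assms])
  then have "integral\<^sup>L N (\<lambda>x. (vnorm d (g x - h x))\<^sup>2)
      \<le> integral\<^sup>L N (\<lambda>x. 2 * (vnorm d (g x))\<^sup>2 + 2 * (vnorm d (h x))\<^sup>2)"
    using integrable_vnorm_sq[OF assms(1)] integrable_vnorm_sq[OF assms(2)]
    by (intro integral_mono vnorm_diff_sq_le) auto
  also have "\<dots> = 2 * integral\<^sup>L N (\<lambda>x. (vnorm d (g x))\<^sup>2) + 2 * integral\<^sup>L N (\<lambda>x. (vnorm d (h x))\<^sup>2)"
    using integrable_vnorm_sq[OF assms(1)] integrable_vnorm_sq[OF assms(2)] by simp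
  finally show ?thesis .
qed

lemma tendsto_zero_sandwich:
  fixes a b c :: "nat \<Rightarrow> real"
  assumes "a \<longlonglongrightarrow> 0" "b \<longlonglongrightarrow> 0" "\<And>n. c n \<le> 2 * a n + 2 * b n" "\<And>n. 0 \<le> c n"
  shows "c \<longlonglongrightarrow> 0"
proof (rule tendsto_sandwich[of "\<lambda>_. 0" c _ "\<lambda>n. 2 * a n + 2 * b n"])
  have "(\<lambda>n. 2 * a n + 2 * b n) \<longlonglongrightarrow> 2 * 0 + 2 * 0"
    using assms by (intro tendsto_intros)
  then show "(\<lambda>n. 2 * a n + 2 * b n) \<longlonglongrightarrow> 0" by simp
qed (use assms in auto)

section \<open>Weak gradients of differences and their uniqueness\<close>

lemma H1_grad_diff:
  assumes "H1_grad d \<Omega> v g" "H1_grad d \<Omega> w h"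
  shows "H1_grad d \<Omega> (v - w) (\<lambda>x. g x - h x)"
proof -
  have "integral\<^sup>L N (\<lambda>x. (v - w) x * pd i \<phi> x) = - integral\<^sup>L N (\<lambda>x. (g x - h x) i * \<phi> x)"
    if "test_fn d \<Omega> \<phi>" "i < d" for \<phi> i
  proof -
    note t = sq_integrable_test_fn[OF that(1)] sq_integrable_test_fn[OF test_fn_pd[OF that]]
    have "integral\<^sup>L N (\<lambda>x. v x * pd i \<phi> x - w x * pd i \<phi> x)
        = integral\<^sup>L N (\<lambda>x. v x * pd i \<phi> x) - integral\<^sup>L N (\<lambda>x. w x * pd i \<phi> x)"
      using assms t by (intro Bochner_Integration.integral_diff sq_integrable_mult) (auto simp: H1_grad_N)
    moreover have "integral\<^sup>L N (\<lambda>x. g x i * \<phi> x - h x i * \<phi> x)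
        = integral\<^sup>L N (\<lambda>x. g x i * \<phi> x) - integral\<^sup>L N (\<lambda>x. h x i * \<phi> x)"
      using assms t that by (intro Bochner_Integration.integral_diff sq_integrable_mult) (auto simp: H1_grad_N)
    ultimately show ?thesis
      using assms that by (simp add: H1_grad_N left_diff_distrib)
  qed
  moreover have "sq_integrable N (v - w)"
    using assms sq_integrable_diff[of N v w] by (simp add: H1_grad_N fun_diff_def)
  ultimately show ?thesis
    using assms sq_integrable_vec_diff[of g h] by (simp add: H1_grad_N)
qed

text \<open>The approximating test functions are subtracted as well. Subtraction is the one linear
  operation performed on functions of the space: errors are differences, and \<open>v - u\<close> is
  the test function put into the Galerkin equation.\<close>

lemma H10_grad_diff:
  assumes "H10_grad d \<Omega> v g" "H10_grad d \<Omega> w h"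
  shows "H10_grad d \<Omega> (v - w) (\<lambda>x. g x - h x)"
proof -
  note sq = H10_grad_sq_integrable[OF assms(1)] H10_grad_sq_integrable[OF assms(2)]
  obtain \<phi> where \<phi>: "\<And>n::nat. test_fn d \<Omega> (\<phi> n)"
    "(\<lambda>n. integral\<^sup>L N (\<lambda>x. (v x - \<phi> n x)\<^sup>2)) \<longlonglongrightarrow> 0"
    "(\<lambda>n. integral\<^sup>L N (\<lambda>x. (vnorm d (g x - cgrad (\<phi> n) x))\<^sup>2)) \<longlonglongrightarrow> 0"
    using assms(1) unfolding H10_grad_N by blast
  obtain \<psi> where \<psi>: "\<And>n::nat. test_fn d \<Omega> (\<psi> n)"
    "(\<lambda>n. integral\<^sup>L N (\<lambda>x. (w x - \<psi> n x)\<^sup>2)) \<longlonglongrightarrow> 0"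
    "(\<lambda>n. integral\<^sup>L N (\<lambda>x. (vnorm d (h x - cgrad (\<psi> n) x))\<^sup>2)) \<longlonglongrightarrow> 0"
    using assms(2) unfolding H10_grad_N by blast
  let ?\<zeta> = "\<lambda>n. \<phi> n - \<psi> n"
  have "(\<lambda>n. integral\<^sup>L N (\<lambda>x. ((v - w) x - ?\<zeta> n x)\<^sup>2)) \<longlonglongrightarrow> 0"
  proof (rule tendsto_zero_sandwich[OF \<phi>(2) \<psi>(2)])
    fix n
    have "integral\<^sup>L N (\<lambda>x. ((v x - \<phi> n x) - (w x - \<psi> n x))\<^sup>2)
        \<le> 2 * integral\<^sup>L N (\<lambda>x. (v x - \<phi> n x)\<^sup>2) + 2 * integral\<^sup>L N (\<lambda>x. (w x - \<psi> n x)\<^sup>2)"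
      by (rule integral_sq_diff_le; rule sq_integrable_diff)
        (use sq \<phi>(1) \<psi>(1) in \<open>auto intro: sq_integrable_test_fn\<close>)
    then show "integral\<^sup>L N (\<lambda>x. ((v - w) x - ?\<zeta> n x)\<^sup>2)
        \<le> 2 * integral\<^sup>L N (\<lambda>x. (v x - \<phi> n x)\<^sup>2) + 2 * integral\<^sup>L N (\<lambda>x. (w x - \<psi> n x)\<^sup>2)"
      by (simp add: algebra_simps)
  qed simp
  moreover have "(\<lambda>n. integral\<^sup>L N (\<lambda>x. (vnorm d (g x - h x - cgrad (?\<zeta> n) x))\<^sup>2)) \<longlonglongrightarrow> 0"
  proof (rule tendsto_zero_sandwich[OF \<phi>(3) \<psi>(3)])
    fix n
    have "vnorm d (g x - h x - cgrad (?\<zeta> n) x)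
        = vnorm d ((g x - cgrad (\<phi> n) x) - (h x - cgrad (\<psi> n) x))" if "x \<in> \<Omega>" for x
      using that dom_subset pd_diff[OF \<phi>(1) \<psi>(1)]
      by (intro L2_set_cong) (auto simp: cgrad_def)
    then have "integral\<^sup>L N (\<lambda>x. (vnorm d (g x - h x - cgrad (?\<zeta> n) x))\<^sup>2)
        = integral\<^sup>L N (\<lambda>x. (vnorm d ((g x - cgrad (\<phi> n) x) - (h x - cgrad (\<psi> n) x)))\<^sup>2)"
      by (intro Bochner_Integration.integral_cong) auto
    also have "\<dots> \<le> 2 * integral\<^sup>L N (\<lambda>x. (vnorm d (g x - cgrad (\<phi> n) x))\<^sup>2)
        + 2 * integral\<^sup>L N (\<lambda>x. (vnorm d (h x - cgrad (\<psi> n) x))\<^sup>2)"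
      using sq \<phi>(1) \<psi>(1)
      by (intro integral_vnorm_sq_diff_le sq_integrable_vec_diff sq_integrable_cgrad) auto
    finally show "integral\<^sup>L N (\<lambda>x. (vnorm d (g x - h x - cgrad (?\<zeta> n) x))\<^sup>2)
      \<le> 2 * integral\<^sup>L N (\<lambda>x. (vnorm d (g x - cgrad (\<phi> n) x))\<^sup>2)
        + 2 * integral\<^sup>L N (\<lambda>x. (vnorm d (h x - cgrad (\<psi> n) x))\<^sup>2)" .
  qed simp
  moreover have "test_fn d \<Omega> (?\<zeta> n)" for n
    using \<phi>(1) \<psi>(1) by (rule test_fn_diff)
  ultimately show ?thesis
    using H1_grad_diff[of v g w h] assms unfolding H10_grad_N
    by (intro conjI exI[of _ ?\<zeta>]) simp_all
qed

text \<open>No mollification is needed: a weak gradient \<open>g\<close> of 0 is orthogonal to the partial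
  derivatives of test functions, which are test functions themselves, and it is a limit of those.\<close>

lemma H10_grad_zero:
  assumes "H10_grad d \<Omega> (\<lambda>_. 0) g"
  shows "AE x in N. \<forall>i<d. g x i = 0"
proof -
  note sq = H10_grad_sq_integrable(2)[OF assms]
  obtain \<phi> where \<phi>: "\<And>n::nat. test_fn d \<Omega> (\<phi> n)"
    "(\<lambda>n. integral\<^sup>L N (\<lambda>x. (vnorm d (g x - cgrad (\<phi> n) x))\<^sup>2)) \<longlonglongrightarrow> 0"
    using assms unfolding H10_grad_N by blast
  have "AE x in N. g x i = 0" if i: "i < d" for i
  proof -
    have gi: "sq_integrable N (\<lambda>x. g x i)"
      using sq i by blast
    have "integral\<^sup>L N (\<lambda>x. (g x i)\<^sup>2) \<le> integral\<^sup>L N (\<lambda>x. (vnorm d (g x - cgrad (\<phi> n) x))\<^sup>2)" for n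
    proof -
      note pt = sq_integrable_test_fn[OF test_fn_pd[OF \<phi>(1)[of n] i]]
      have "integral\<^sup>L N (\<lambda>x. g x i * pd i (\<phi> n) x) = 0"
        using assms i test_fn_pd[OF \<phi>(1)[of n] i] unfolding H10_grad_N H1_grad_N by fastforce
      then have "integral\<^sup>L N (\<lambda>x. (g x i)\<^sup>2) =
          integral\<^sup>L N (\<lambda>x. (g x i)\<^sup>2) - 2 * integral\<^sup>L N (\<lambda>x. g x i * pd i (\<phi> n) x)"
        by simp
      also have "\<dots> = integral\<^sup>L N (\<lambda>x. (g x i)\<^sup>2 - 2 * (g x i * pd i (\<phi> n) x))"
        using gi pt sq_integrable_mult[OF gi pt] by (simp add: sq_integrable_def)
      also have "\<dots> \<le> integral\<^sup>L N (\<lambda>x. (vnorm d (g x - cgrad (\<phi> n) x))\<^sup>2)"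
      proof (rule integral_mono)
        show "integrable N (\<lambda>x. (g x i)\<^sup>2 - 2 * (g x i * pd i (\<phi> n) x))"
          using gi pt sq_integrable_mult[OF gi pt] by (simp add: sq_integrable_def)
        show "integrable N (\<lambda>x. (vnorm d (g x - cgrad (\<phi> n) x))\<^sup>2)"
          using sq \<phi>(1) by (intro integrable_vnorm_sq sq_integrable_vec_diff sq_integrable_cgrad)
        fix x
        have "(g x i)\<^sup>2 - 2 * (g x i * pd i (\<phi> n) x) \<le> ((g x - cgrad (\<phi> n) x) i)\<^sup>2"
          by (simp add: cgrad_def power2_diff)
        also have "\<dots> \<le> (vnorm d (g x - cgrad (\<phi> n) x))\<^sup>2"
          using i by (rule sq_le_vnorm_sq)
        finally show "(g x i)\<^sup>2 - 2 * (g x i * pd i (\<phi> n) x)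
          \<le> (vnorm d (g x - cgrad (\<phi> n) x))\<^sup>2" .
      qed
      finally show ?thesis .
    qed
    then have "integral\<^sup>L N (\<lambda>x. (g x i)\<^sup>2) \<le> 0"
      using \<phi>(2) by (auto intro: LIMSEQ_le_const)
    then have "integral\<^sup>L N (\<lambda>x. (g x i)\<^sup>2) = 0"
      by (simp add: antisym)
    then show ?thesis
      using gi integral_nonneg_eq_0_iff_AE[of N "\<lambda>x. (g x i)\<^sup>2"] by (auto simp: sq_integrable_def)
  qed
  then show ?thesis
    by (auto simp: AE_all_countable)
qed

lemma H10_grad_grad:
  assumes "v \<in> H10 d \<Omega>"
  shows "H10_grad d \<Omega> v (grad d \<Omega> v)"
  using assms someI_ex[of "H10_grad d \<Omega> v"] unfolding H10_def grad_def by auto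

lemma H10_diff:
  assumes "v \<in> H10 d \<Omega>" "w \<in> H10 d \<Omega>"
  shows "v - w \<in> H10 d \<Omega>"
  using assms H10_grad_diff unfolding H10_def by blast

text \<open>\<open>grad\<close> is a choice, so linearity has to come from uniqueness: the three
  chosen gradients combine to a weak gradient of \<open>(v - w) - (v - w)\<close>, which is the zero
  function, and \<open>H10_grad_zero\<close> makes this combination vanish.\<close>

lemma grad_diff:
  assumes "v \<in> H10 d \<Omega>" "w \<in> H10 d \<Omega>"
  shows "AE x in N. \<forall>i<d. grad d \<Omega> (v - w) x i = grad d \<Omega> v x i - grad d \<Omega> w x i"
proof -
  have "H10_grad d \<Omega> ((v - w) - (v - w))
      (\<lambda>x. grad d \<Omega> (v - w) x - (grad d \<Omega> v x - grad d \<Omega> w x))"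
    using assms by (intro H10_grad_diff H10_grad_grad H10_diff)
  moreover have "(v - w) - (v - w) = (\<lambda>_. 0)"
    by (simp add: fun_eq_iff)
  ultimately have "AE x in N. \<forall>i<d. (grad d \<Omega> (v - w) x - (grad d \<Omega> v x - grad d \<Omega> w x)) i = 0"
    by (intro H10_grad_zero) (simp only:)
  then show ?thesis
    by eventually_elim simp
qed

lemma sq_integrable_grad:
  assumes "v \<in> H10 d \<Omega>"
  shows "sq_integrable N v" "sq_integrable_vec N d (grad d \<Omega> v)"
  using H10_grad_sq_integrable[OF H10_grad_grad[OF assms]] .

end

section \<open>The energy density\<close>

text \<open>Serves both quadratic bounds on the potential. The derivative is required at positive
  arguments only, where \<open>deriv_pot\<close> supplies it; continuity covers the endpoint
  0.\<close>

lemma min_if_deriv_sign: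
  fixes h :: "real \<Rightarrow> real"
  assumes "0 \<le> a" "0 \<le> b" "continuous_on {0..} h"
    and deriv: "\<And>r. 0 < r \<Longrightarrow> (h has_real_derivative h' r) (at r)"
    and pos: "\<And>r. a \<le> r \<Longrightarrow> 0 \<le> h' r"
    and neg: "\<And>r. 0 \<le> r \<Longrightarrow> r \<le> a \<Longrightarrow> h' r \<le> 0"
  shows "h a \<le> h b"
proof (cases "a \<le> b")
  case True
  then show ?thesis
  proof (rule DERIV_nonneg_imp_increasing_open)
    fix x assume "a < x" "x < b"
    then show "\<exists>y. (h has_real_derivative y) (at x) \<and> 0 \<le> y"
      using \<open>0 \<le> a\<close> by (intro exI[of _ "h' x"] conjI deriv pos) auto
  next
    show "continuous_on {a..b} h"
      using assms(3) by (rule continuous_on_subset) (use \<open>0 \<le> a\<close> in auto)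
  qed
next
  case False
  then have "b \<le> a" by simp
  then show ?thesis
  proof (rule DERIV_nonpos_imp_decreasing_open)
    fix x assume "b < x" "x < a"
    then show "\<exists>y. (h has_real_derivative y) (at x) \<and> y \<le> 0"
      using \<open>0 \<le> b\<close> by (intro exI[of _ "h' x"] conjI deriv neg) auto
  next
    show "continuous_on {b..a} h"
      using assms(3) by (rule continuous_on_subset) (use \<open>0 \<le> b\<close> in auto)
  qed
qed

lemma dot_le_vnorm: "\<bar>dot d x y\<bar> \<le> vnorm d x * vnorm d y"
proof -
  have "\<bar>dot d x y\<bar> \<le> (\<Sum>i<d. \<bar>x i\<bar> * \<bar>y i\<bar>)"
    unfolding dot_def by (rule order_trans[OF sum_abs]) (simp add: abs_mult)
  also have "\<dots> \<le> vnorm d x * vnorm d y"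
    by (rule L2_set_mult_ineq)
  finally show ?thesis .
qed

lemma dot_diff_right: "dot d x (y - z) = dot d x y - dot d x z"
  by (simp add: dot_def right_diff_distrib sum_subtractf)

lemma dot_self: "dot d x x = (vnorm d x)\<^sup>2"
  unfolding vnorm_sq by (simp add: dot_def power2_eq_square)

lemma vnorm_diff_sq: "(vnorm d (x - y))\<^sup>2 = (vnorm d x)\<^sup>2 + (vnorm d y)\<^sup>2 - 2 * dot d x y"
  by (simp add: vnorm_sq dot_def power2_diff sum.distrib sum_subtractf sum_distrib_left mult.assoc)

locale monotone_flux =
  fixes \<mu> :: "real \<Rightarrow> real" and \<alpha> \<beta> :: real
  assumes cont: "continuous_on {0..} \<mu>"
    and nonneg: "\<And>t. 0 \<le> t \<Longrightarrow> 0 \<le> \<mu> t"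
    and \<alpha>_pos: "0 < \<alpha>"
    and lower: "\<And>s t. 0 \<le> s \<Longrightarrow> s \<le> t \<Longrightarrow> \<alpha> * (t - s) \<le> \<mu> (t\<^sup>2) * t - \<mu> (s\<^sup>2) * s"
    and upper: "\<And>s t. 0 \<le> s \<Longrightarrow> s \<le> t \<Longrightarrow> \<mu> (t\<^sup>2) * t - \<mu> (s\<^sup>2) * s \<le> \<beta> * (t - s)"
begin

text \<open>By the substitution \<open>t = s\<^sup>2\<close>, \<open>pot r\<close> is the integral of the scalar flux \<open>\<mu> (s\<^sup>2) s\<close> over \<open>[0, r]\<close>.\<close>

definition pot :: "real \<Rightarrow> real" where
  "pot r = integral {0..r\<^sup>2} \<mu> / 2"

lemma integrable_mu: "\<mu> integrable_on {0..b}"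
  by (rule integrable_continuous_real) (rule continuous_on_subset[OF cont], auto)

text \<open>For negative \<open>s\<close> the interval is empty and the integral 0, so monotonicity
  holds on the whole line and yields Borel measurability.\<close>

lemma mono_integral_mu: "mono (\<lambda>s. integral {0..s} \<mu>)"
  by (rule monoI) (auto intro!: integral_subset_le integrable_mu nonneg)

lemma borel_measurable_integral_mu: "(\<lambda>s. integral {0..s} \<mu>) \<in> borel_measurable borel"
  using mono_integral_mu by (rule borel_measurable_mono)

lemma deriv_integral_mu:
  assumes "0 < s"
  shows "((\<lambda>s. integral {0..s} \<mu>) has_real_derivative \<mu> s) (at s)"
proof -
  have "((\<lambda>s. integral {0..s} \<mu>) has_real_derivative \<mu> s) (at s within {0..s + 1})"
    using assms by (intro integral_has_real_derivative) (auto intro: continuous_on_subset[OF cont])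
  moreover have "at s within {0..s + 1} = at s"
    using assms by (intro at_within_interior) simp
  ultimately show ?thesis by simp
qed

lemma continuous_integral_mu: "continuous_on {0..} (\<lambda>s. integral {0..s} \<mu>)"
proof (unfold continuous_on_eq_continuous_within, intro ballI)
  fix s :: real assume "s \<in> {0..}"
  moreover have "continuous_on {0..s + 1} (\<lambda>s. integral {0..s} \<mu>)"
    by (rule indefinite_integral_continuous_1[OF integrable_mu])
  ultimately have "continuous (at s within {0..s + 1}) (\<lambda>s. integral {0..s} \<mu>)"
    by (auto simp: continuous_on_eq_continuous_within)
  moreover have "at s within {0..s + 1} = at s within {0..}"
    by (rule at_within_nhd[of _ "{..<s + 1}"]) auto
  ultimately show "continuous (at s within {0..}) (\<lambda>s. integral {0..s} \<mu>)"
    by simp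
qed

lemma deriv_pot:
  assumes "0 < r"
  shows "(pot has_real_derivative \<mu> (r\<^sup>2) * r) (at r)"
proof -
  have "((\<lambda>r. r\<^sup>2) has_real_derivative 2 * r) (at r)"
    by (auto intro!: derivative_eq_intros)
  then have "((\<lambda>r. integral {0..r\<^sup>2} \<mu>) has_real_derivative \<mu> (r\<^sup>2) * (2 * r)) (at r)"
    using assms by (intro DERIV_chain2[OF deriv_integral_mu]) auto
  then have "((\<lambda>r. integral {0..r\<^sup>2} \<mu> / 2) has_real_derivative \<mu> (r\<^sup>2) * (2 * r) / 2) (at r)"
    by (rule DERIV_cdivide)
  then show ?thesis
    by (simp add: pot_def[abs_def])
qed

lemma continuous_pot: "continuous_on {0..} pot"
  unfolding pot_def[abs_def]
  by (intro continuous_on_divide continuous_on_compose2[OF continuous_integral_mu] continuous_intros) auto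

text \<open>Right side minus left side, as a function of \<open>b\<close>, vanishes at
  \<open>a\<close>. Its derivative at \<open>r\<close> is the slack of \<open>lower\<close> between
  \<open>a\<close> and \<open>r\<close>, which changes sign from minus to plus at \<open>a\<close>,
  so \<open>a\<close> is a minimum. \<open>pot_upper\<close> is the mirror image with
  \<open>upper\<close>.\<close>

lemma pot_lower:
  assumes "0 \<le> a" "0 \<le> b"
  shows "\<mu> (a\<^sup>2) * a * (b - a) + \<alpha> / 2 * (b - a)\<^sup>2 \<le> pot b - pot a"
proof -
  let ?h = "\<lambda>r. pot r - \<mu> (a\<^sup>2) * a * (r - a) - \<alpha> / 2 * (r - a)\<^sup>2"
  have "?h a \<le> ?h b"
  proof (rule min_if_deriv_sign[OF assms])
    show "continuous_on {0..} ?h"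
      by (intro continuous_intros continuous_pot)
    show "(?h has_real_derivative \<mu> (r\<^sup>2) * r - \<mu> (a\<^sup>2) * a - \<alpha> * (r - a)) (at r)" if "0 < r" for r
      using that by (auto intro!: derivative_eq_intros deriv_pot)
    show "0 \<le> \<mu> (r\<^sup>2) * r - \<mu> (a\<^sup>2) * a - \<alpha> * (r - a)" if "a \<le> r" for r
      using lower[OF assms(1) that] by simp
    show "\<mu> (r\<^sup>2) * r - \<mu> (a\<^sup>2) * a - \<alpha> * (r - a) \<le> 0" if "0 \<le> r" "r \<le> a" for r
      using lower[OF that] by (simp add: algebra_simps)
  qed
  then show ?thesis by simp
qed

lemma pot_upper:
  assumes "0 \<le> a" "0 \<le> b"
  shows "pot b - pot a \<le> \<mu> (a\<^sup>2) * a * (b - a) + \<beta> / 2 * (b - a)\<^sup>2"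
proof -
  let ?h = "\<lambda>r. \<beta> / 2 * (r - a)\<^sup>2 + \<mu> (a\<^sup>2) * a * (r - a) - pot r"
  have "?h a \<le> ?h b"
  proof (rule min_if_deriv_sign[OF assms])
    show "continuous_on {0..} ?h"
      by (intro continuous_intros continuous_pot)
    show "(?h has_real_derivative \<beta> * (r - a) + \<mu> (a\<^sup>2) * a - \<mu> (r\<^sup>2) * r) (at r)" if "0 < r" for r
      using that by (auto intro!: derivative_eq_intros deriv_pot)
    show "0 \<le> \<beta> * (r - a) + \<mu> (a\<^sup>2) * a - \<mu> (r\<^sup>2) * r" if "a \<le> r" for r
      using upper[OF assms(1) that] by simp
    show "\<beta> * (r - a) + \<mu> (a\<^sup>2) * a - \<mu> (r\<^sup>2) * r \<le> 0" if "0 \<le> r" "r \<le> a" for r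
      using upper[OF that] by (simp add: algebra_simps)
  qed
  then show ?thesis by simp
qed

lemma mu_bounds:
  assumes "0 < r"
  shows "\<alpha> \<le> \<mu> (r\<^sup>2)" "\<mu> (r\<^sup>2) \<le> \<beta>"
  using lower[of 0 r] upper[of 0 r] assms by simp_all

text \<open>The bounds on \<mu> arise by dividing by \<open>r\<close> and so concern positive
  \<open>r\<close>. Where the norm is zero the factor \<open>c\<close> has to vanish
  instead.\<close>

lemma mu_vnorm_bounds:
  assumes "0 \<le> c" "vnorm d x = 0 \<Longrightarrow> c = 0"
  shows "\<alpha> * c \<le> \<mu> ((vnorm d x)\<^sup>2) * c" "\<mu> ((vnorm d x)\<^sup>2) * c \<le> \<beta> * c"
proof -
  consider "c = 0" | "0 < vnorm d x"
    using assms(2) by (metis L2_set_nonneg less_eq_real_def)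
  then show "\<alpha> * c \<le> \<mu> ((vnorm d x)\<^sup>2) * c" "\<mu> ((vnorm d x)\<^sup>2) * c \<le> \<beta> * c"
    by (cases; use mu_bounds assms(1) in \<open>simp add: mult_right_mono\<close>)+
qed

text \<open>\<delta> is the Bregman distance of the energy density. With \<open>a\<close>,
  \<open>b\<close> the two norms and \<open>c\<close> the defect in the Cauchy-Schwarz inequality,
  \<delta> is the scalar Bregman distance plus \<open>\<mu> (a\<^sup>2) * c\<close>, while the
  squared distance is \<open>(b - a)\<^sup>2 + 2 * c\<close>. The two parts are compared separately,
  so passing to vectors costs no constant.\<close>

lemma pot_vector:
  fixes x y :: pt and d :: nat
  defines "\<delta> \<equiv> pot (vnorm d y) - pot (vnorm d x) - \<mu> ((vnorm d x)\<^sup>2) * dot d x (y - x)"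
  shows "\<alpha> / 2 * (vnorm d (y - x))\<^sup>2 \<le> \<delta>" "\<delta> \<le> \<beta> / 2 * (vnorm d (y - x))\<^sup>2"
proof -
  let ?a = "vnorm d x" and ?b = "vnorm d y"
  define c where "c = ?a * ?b - dot d x y"
  have ab: "0 \<le> ?a" "0 \<le> ?b"
    by simp_all
  have c: "0 \<le> c"
    using dot_le_vnorm[of d x y] by (simp add: c_def)
  have c0: "c = 0" if "?a = 0"
    using dot_le_vnorm[of d x y] that by (simp add: c_def)
  have mc: "\<alpha> * c \<le> \<mu> (?a\<^sup>2) * c" "\<mu> (?a\<^sup>2) * c \<le> \<beta> * c"
    using mu_vnorm_bounds[OF c, of x d] c0 by auto
  have \<delta>: "\<delta> = pot ?b - pot ?a - \<mu> (?a\<^sup>2) * ?a * (?b - ?a) + \<mu> (?a\<^sup>2) * c"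
    unfolding \<delta>_def c_def dot_diff_right dot_self by (simp add: algebra_simps power2_eq_square)
  have sq: "(vnorm d (y - x))\<^sup>2 = (?b - ?a)\<^sup>2 + 2 * c"
    unfolding vnorm_diff_sq c_def by (simp add: power2_diff dot_def mult.commute algebra_simps)
  show "\<alpha> / 2 * (vnorm d (y - x))\<^sup>2 \<le> \<delta>"
    unfolding \<delta> sq using pot_lower[OF ab] mc(1) by (simp add: algebra_simps)
  show "\<delta> \<le> \<beta> / 2 * (vnorm d (y - x))\<^sup>2"
    unfolding \<delta> sq using pot_upper[OF ab] mc(2) by (simp add: algebra_simps)
qed

lemma pot_bounds: "0 \<le> pot (vnorm d x)" "pot (vnorm d x) \<le> \<beta> / 2 * (vnorm d x)\<^sup>2"
proof -
  show "0 \<le> pot (vnorm d x)"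
    by (auto simp: pot_def intro!: integral_nonneg integrable_mu nonneg)
  show "pot (vnorm d x) \<le> \<beta> / 2 * (vnorm d x)\<^sup>2"
    using pot_upper[of 0 "vnorm d x"] by (simp add: pot_def)
qed

lemma mu_dot_bound: "\<bar>\<mu> ((vnorm d x)\<^sup>2) * dot d x y\<bar> \<le> \<beta> * (vnorm d x * vnorm d y)"
proof -
  have "\<bar>\<mu> ((vnorm d x)\<^sup>2) * dot d x y\<bar> \<le> \<mu> ((vnorm d x)\<^sup>2) * (vnorm d x * vnorm d y)"
    using dot_le_vnorm nonneg by (simp add: abs_mult mult_left_mono)
  also have "\<dots> \<le> \<beta> * (vnorm d x * vnorm d y)"
    by (rule mu_vnorm_bounds) auto
  finally show ?thesis .
qed

end

section \<open>Energy and norm\<close>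

locale pde =
  fixes P :: problem and \<alpha> L :: real
  assumes data: "problem_data P \<alpha> L"
begin

sublocale bounded_domain "pdim P" "pdom P"
  using data by unfold_locales (auto simp: problem_data_def lipschitz_domain_def)

lemma L_pos: "0 < L"
  using data by (simp add: problem_data_def)

sublocale monotone_flux "pmu P" \<alpha> "L / 3"
proof
  show "continuous_on {0..} (pmu P)"
    using data DERIV_continuous unfolding problem_data_def continuous_on_eq_continuous_within
    by (metis atLeast_iff)
qed (use data in \<open>auto simp: problem_data_def\<close>)

lemma enorm_sq: "(enorm P v)\<^sup>2 = integral\<^sup>L N (\<lambda>x. (vnorm (pdim P) (pgrad P v x))\<^sup>2)"
  unfolding enorm_def LINT_N by (simp add: integral_nonneg_AE)

lemma enorm_nonneg [simp]: "0 \<le> enorm P v"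
  unfolding enorm_def LINT_N by (simp add: integral_nonneg_AE)

lemma grad_diff_vnorm:
  assumes "v \<in> XX P" "w \<in> XX P"
  shows "AE x in N. vnorm (pdim P) (pgrad P (v - w) x) = vnorm (pdim P) (pgrad P v x - pgrad P w x)"
  using grad_diff[OF assms] by eventually_elim (auto intro: L2_set_cong)

lemma enorm_diff_sq:
  assumes "v \<in> XX P" "w \<in> XX P"
  shows "(enorm P (v - w))\<^sup>2 = integral\<^sup>L N (\<lambda>x. (vnorm (pdim P) (pgrad P v x - pgrad P w x))\<^sup>2)"
  unfolding enorm_sq
proof (rule integral_cong_AE)
  show "AE x in N. (vnorm (pdim P) (pgrad P (v - w) x))\<^sup>2 = (vnorm (pdim P) (pgrad P v x - pgrad P w x))\<^sup>2"
    using grad_diff_vnorm[OF assms] by eventually_elim simp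
  show "(\<lambda>x. (vnorm (pdim P) (pgrad P (v - w) x))\<^sup>2) \<in> borel_measurable N"
    by (rule measurable_vnorm_sq[OF sq_integrable_grad(2)[OF H10_diff[OF assms]]])
  show "(\<lambda>x. (vnorm (pdim P) (pgrad P v x - pgrad P w x))\<^sup>2) \<in> borel_measurable N"
    by (rule measurable_vnorm_sq, rule sq_integrable_vec_diff) (use sq_integrable_grad(2) assms in auto)
qed

lemma enorm_commute:
  assumes "v \<in> XX P" "w \<in> XX P"
  shows "enorm P (v - w) = enorm P (w - v)"
proof -
  have "(enorm P (v - w))\<^sup>2 = (enorm P (w - v))\<^sup>2"
    unfolding enorm_diff_sq[OF assms] enorm_diff_sq[OF assms(2,1)] vnorm_diff_sq
    by (simp add: dot_def mult.commute add.commute)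
  then show ?thesis
    by (simp add: power2_eq_iff_nonneg)
qed

lemma enorm_self: "v \<in> XX P \<Longrightarrow> enorm P (v - v) = 0"
  using enorm_diff_sq[of v v] by (simp add: vnorm_diff_sq dot_self)

text \<open>The squared form with factor 2 is inherited from a pointwise inequality. It takes the
  place of the triangle inequality in all error estimates below.\<close>

lemma enorm_diff_le:
  assumes "u \<in> XX P" "v \<in> XX P" "w \<in> XX P"
  shows "(enorm P (u - w))\<^sup>2 \<le> 2 * (enorm P (u - v))\<^sup>2 + 2 * (enorm P (v - w))\<^sup>2"
proof -
  have "pgrad P u x - pgrad P w x = (pgrad P u x - pgrad P v x) - (pgrad P w x - pgrad P v x)" for x
    by (simp add: fun_eq_iff)
  then have "(enorm P (u - w))\<^sup>2 \<le> 2 * (enorm P (u - v))\<^sup>2 + 2 * (enorm P (w - v))\<^sup>2"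
    unfolding enorm_diff_sq[OF assms(1,3)] enorm_diff_sq[OF assms(1,2)] enorm_diff_sq[OF assms(3,2)]
    using integral_vnorm_sq_diff_le[of "\<lambda>x. pgrad P u x - pgrad P v x" "\<lambda>x. pgrad P w x - pgrad P v x"]
      sq_integrable_vec_diff sq_integrable_grad(2) assms
    by simp
  then show ?thesis
    using enorm_commute[OF assms(2,3)] by simp
qed

lemma sq_integrable_data:
  "sq_integrable N (pf P)" "sq_integrable_vec N (pdim P) (pvf P)"
  using data unfolding problem_data_def L2_on_N by auto

lemma rhs_diff:
  assumes "v \<in> XX P" "w \<in> XX P"
  shows "rhs P (v - w) = rhs P v - rhs P w"
proof -
  note sq = sq_integrable_grad[OF assms(1)] sq_integrable_grad[OF assms(2)]
    sq_integrable_grad[OF H10_diff[OF assms]]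
  have "integral\<^sup>L N (\<lambda>x. pf P x * (v - w) x) =
      integral\<^sup>L N (\<lambda>x. pf P x * v x) - integral\<^sup>L N (\<lambda>x. pf P x * w x)"
    using Bochner_Integration.integral_diff[OF sq_integrable_mult sq_integrable_mult,
        OF sq_integrable_data(1) sq(1) sq_integrable_data(1) sq(3)]
    by (simp add: right_diff_distrib)
  moreover have "integral\<^sup>L N (\<lambda>x. dot (pdim P) (pvf P x) (pgrad P (v - w) x)) =
      integral\<^sup>L N (\<lambda>x. dot (pdim P) (pvf P x) (pgrad P v x) - dot (pdim P) (pvf P x) (pgrad P w x))"
  proof (rule integral_cong_AE)
    show "AE x in N. dot (pdim P) (pvf P x) (pgrad P (v - w) x) =
        dot (pdim P) (pvf P x) (pgrad P v x) - dot (pdim P) (pvf P x) (pgrad P w x)"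
      using grad_diff[OF assms]
      by eventually_elim (simp add: dot_def right_diff_distrib flip: sum_subtractf)
  qed (use integrable_dot[OF sq_integrable_data(2)] sq in \<open>auto intro!: borel_measurable_integrable\<close>)
  moreover have "\<dots> = integral\<^sup>L N (\<lambda>x. dot (pdim P) (pvf P x) (pgrad P v x))
      - integral\<^sup>L N (\<lambda>x. dot (pdim P) (pvf P x) (pgrad P w x))"
    by (rule Bochner_Integration.integral_diff) (rule integrable_dot[OF sq_integrable_data(2)], use sq in auto)+
  ultimately show ?thesis
    by (simp add: rhs_def LINT_N)
qed

lemma integrable_pot:
  assumes "v \<in> XX P"
  shows "integrable N (\<lambda>x. pot (vnorm (pdim P) (pgrad P v x)))"
proof (rule Bochner_Integration.integrable_bound)
  note sq = sq_integrable_grad(2)[OF assms]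
  show "integrable N (\<lambda>x. L / 3 / 2 * (vnorm (pdim P) (pgrad P v x))\<^sup>2)"
    by (intro integrable_mult_right integrable_vnorm_sq sq)
  show "(\<lambda>x. pot (vnorm (pdim P) (pgrad P v x))) \<in> borel_measurable N"
    unfolding pot_def using measurable_compose[OF measurable_vnorm_sq[OF sq] borel_measurable_integral_mu]
    by (intro borel_measurable_divide) auto
  show "AE x in N. norm (pot (vnorm (pdim P) (pgrad P v x)))
      \<le> norm (L / 3 / 2 * (vnorm (pdim P) (pgrad P v x))\<^sup>2)"
    using pot_bounds L_pos by (intro AE_I2) (simp add: abs_of_nonneg)
qed

lemma integrable_flux:
  assumes "sq_integrable_vec N (pdim P) g" "sq_integrable_vec N (pdim P) h"
  shows "integrable N (\<lambda>x. pmu P ((vnorm (pdim P) (g x))\<^sup>2) * dot (pdim P) (g x) (h x))"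
proof (rule Bochner_Integration.integrable_bound)
  show "integrable N (\<lambda>x. L / 3 * ((vnorm (pdim P) (g x))\<^sup>2 + (vnorm (pdim P) (h x))\<^sup>2))"
    by (intro integrable_mult_right Bochner_Integration.integrable_add integrable_vnorm_sq assms)
  \<comment> \<open>Continuity of \<open>pmu P\<close> is given on the nonnegative half-line.
    Precomposing with \<open>max 0\<close> extends it to all reals without changing it at squares,
    which is enough for measurability.\<close>
  have "continuous_on UNIV (\<lambda>t. pmu P (max 0 t))"
    by (intro continuous_on_compose2[OF cont] continuous_intros) auto
  then have "(\<lambda>x. pmu P (max 0 ((vnorm (pdim P) (g x))\<^sup>2))) \<in> borel_measurable N"
    by (intro measurable_compose[OF measurable_vnorm_sq[OF assms(1)]] borel_measurable_continuous_onI)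
  moreover have "max 0 ((vnorm (pdim P) (g x))\<^sup>2) = (vnorm (pdim P) (g x))\<^sup>2" for x
    by simp
  ultimately show "(\<lambda>x. pmu P ((vnorm (pdim P) (g x))\<^sup>2) * dot (pdim P) (g x) (h x)) \<in> borel_measurable N"
    using borel_measurable_integrable[OF integrable_dot[OF assms]] by (intro borel_measurable_times) simp_all
  have "a * b \<le> a\<^sup>2 + b\<^sup>2" if "0 \<le> a" "0 \<le> b" for a b :: real
    using sum_squares_bound[of a b] mult_nonneg_nonneg[OF that] by linarith
  then have "L / 3 * (vnorm (pdim P) x * vnorm (pdim P) y) \<le> L / 3 * ((vnorm (pdim P) x)\<^sup>2 + (vnorm (pdim P) y)\<^sup>2)"
    for x y using L_pos by (intro mult_left_mono) auto
  then have "\<bar>pmu P ((vnorm (pdim P) x)\<^sup>2) * dot (pdim P) x y\<bar>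
      \<le> L / 3 * ((vnorm (pdim P) x)\<^sup>2 + (vnorm (pdim P) y)\<^sup>2)" for x y
    using mu_dot_bound[of x "pdim P" y] by (rule order_trans[rotated])
  then show "AE x in N. norm (pmu P ((vnorm (pdim P) (g x))\<^sup>2) * dot (pdim P) (g x) (h x))
      \<le> norm (L / 3 * ((vnorm (pdim P) (g x))\<^sup>2 + (vnorm (pdim P) (h x))\<^sup>2))"
    using L_pos by (intro AE_I2) simp
qed

lemma opA_diff:
  assumes "u \<in> XX P" "v \<in> XX P"
  shows "opA P u (v - u) = integral\<^sup>L N (\<lambda>x. pmu P ((vnorm (pdim P) (pgrad P u x))\<^sup>2) *
    dot (pdim P) (pgrad P u x) (pgrad P v x - pgrad P u x))"
  unfolding opA_def LINT_N
proof (rule integral_cong_AE)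
  show "AE x in N. pmu P ((vnorm (pdim P) (pgrad P u x))\<^sup>2) * dot (pdim P) (pgrad P u x) (pgrad P (v - u) x) =
      pmu P ((vnorm (pdim P) (pgrad P u x))\<^sup>2) * dot (pdim P) (pgrad P u x) (pgrad P v x - pgrad P u x)"
    using grad_diff[OF assms(2,1)] by eventually_elim (simp add: dot_def)
qed (rule borel_measurable_integrable, rule integrable_flux;
     use sq_integrable_grad(2) assms H10_diff in \<open>auto intro: sq_integrable_diff\<close>)+

lemma energy_N:
  "energy P v = integral\<^sup>L N (\<lambda>x. pot (vnorm (pdim P) (pgrad P v x))) - rhs P v"
  by (simp add: energy_def LINT_N pot_def)

text \<open>Testing the Galerkin equation with \<open>v - u\<close> replaces the difference of the
  right-hand sides by the flux term. The energy difference thus becomes the integral of the Bregman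
  distance in \<open>pot_vector\<close>, and the pointwise bounds can be integrated; the factor
  \<open>L / 3\<close> is relaxed to \<open>L\<close>. A general \<open>V\<close> covers both the
  full space and the finite element spaces.\<close>

lemma dsq_galerkin:
  assumes "galerkin_solution P V u" "V \<subseteq> XX P" "v \<in> V" "v - u \<in> V"
  shows "\<alpha> / 2 * (enorm P (v - u))\<^sup>2 \<le> dsq P u v" "dsq P u v \<le> L / 2 * (enorm P (v - u))\<^sup>2"
proof -
  let ?vn = "\<lambda>v x. vnorm (pdim P) (pgrad P v x)"
  let ?e = "\<lambda>x. (vnorm (pdim P) (pgrad P v x - pgrad P u x))\<^sup>2"
  let ?fl = "\<lambda>x. pmu P ((?vn u x)\<^sup>2) * dot (pdim P) (pgrad P u x) (pgrad P v x - pgrad P u x)"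
  have uv: "u \<in> XX P" "v \<in> XX P"
    using assms by (auto simp: galerkin_solution_def)
  note sq = sq_integrable_grad(2)[OF uv(1)] sq_integrable_grad(2)[OF uv(2)]
  have "integrable N ?e" "integrable N ?fl"
    by (rule integrable_vnorm_sq integrable_flux sq_integrable_vec_diff sq)+
  note int = this integrable_pot[OF uv(1)] integrable_pot[OF uv(2)]
  have "rhs P v - rhs P u = integral\<^sup>L N ?fl"
    using assms uv by (simp add: galerkin_solution_def flip: rhs_diff opA_diff)
  then have dsq: "dsq P u v = integral\<^sup>L N (\<lambda>x. pot (?vn v x) - pot (?vn u x) - ?fl x)"
    using int by (simp add: dsq_def energy_N)
  have "integral\<^sup>L N (\<lambda>x. \<alpha> / 2 * ?e x) \<le> dsq P u v"
    unfolding dsq using int pot_vector(1) by (intro integral_mono) auto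
  then show "\<alpha> / 2 * (enorm P (v - u))\<^sup>2 \<le> dsq P u v"
    using int by (simp add: enorm_diff_sq[OF uv(2,1)])
  have "dsq P u v \<le> integral\<^sup>L N (\<lambda>x. L / 3 / 2 * ?e x)"
    unfolding dsq using int pot_vector(2) by (intro integral_mono) auto
  also have "\<dots> \<le> L / 2 * (enorm P (v - u))\<^sup>2"
    using int L_pos by (simp add: enorm_diff_sq[OF uv(2,1)] divide_right_mono)
  finally show "dsq P u v \<le> L / 2 * (enorm P (v - u))\<^sup>2" .
qed

end

section \<open>Meshes and finite element spaces\<close>

lemma hull_of_mono:
  assumes "finite S" "finite S'" "S' \<subseteq> hull_of S"
  shows "hull_of S' \<subseteq> hull_of S"
proof
  fix x assume "x \<in> hull_of S'"
  then obtain c where c: "\<And>z. z \<in> S' \<Longrightarrow> 0 \<le> c z" "(\<Sum>z\<in>S'. c z) = 1" "x = (\<lambda>i. \<Sum>z\<in>S'. c z * z i)"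
    by (auto simp: hull_of_def)
  \<comment> \<open>Coefficients of the points of \<open>S'\<close> with respect to
    \<open>S\<close>; the weights \<open>?a\<close> below are those of the composed
    combination.\<close>
  define b where "b z = (SOME b. (\<forall>y\<in>S. 0 \<le> b y) \<and> (\<Sum>y\<in>S. b y) = 1 \<and> z = (\<lambda>i. \<Sum>y\<in>S. b y * y i))" for z
  have b: "(\<forall>y\<in>S. 0 \<le> b z y) \<and> (\<Sum>y\<in>S. b z y) = 1 \<and> z = (\<lambda>i. \<Sum>y\<in>S. b z y * y i)"
    if "z \<in> S'" for z
  proof -
    have "z \<in> hull_of S"
      using assms(3) that by blast
    then show ?thesis
      unfolding b_def hull_of_def mem_Collect_eq by (rule someI_ex)
  qed
  have b_nonneg: "0 \<le> b z y" if "z \<in> S'" "y \<in> S" for z y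
    using b[OF that(1)] that(2) by blast
  have b_sum: "(\<Sum>y\<in>S. b z y) = 1" if "z \<in> S'" for z
    using b[OF that] by blast
  have b_eq: "z i = (\<Sum>y\<in>S. b z y * y i)" if "z \<in> S'" for z i
    using conjunct2[OF conjunct2[OF b[OF that]]] by (rule fun_cong)
  let ?a = "\<lambda>y. \<Sum>z\<in>S'. c z * b z y"
  have "\<forall>y\<in>S. 0 \<le> ?a y"
    using c(1) b_nonneg by (auto intro!: sum_nonneg)
  moreover have "(\<Sum>y\<in>S. ?a y) = 1"
  proof -
    have "(\<Sum>y\<in>S. ?a y) = (\<Sum>z\<in>S'. \<Sum>y\<in>S. c z * b z y)"
      by (rule sum.swap)
    also have "\<dots> = (\<Sum>z\<in>S'. c z)"
      by (intro sum.cong refl) (simp add: b_sum flip: sum_distrib_left)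
    finally show ?thesis
      using c(2) by simp
  qed
  moreover have "x = (\<lambda>i. \<Sum>y\<in>S. ?a y * y i)"
  proof
    fix i
    have "x i = (\<Sum>z\<in>S'. c z * (\<Sum>y\<in>S. b z y * y i))"
      unfolding c(3) by (rule sum.cong) (auto intro: arg_cong[OF b_eq])
    also have "\<dots> = (\<Sum>z\<in>S'. \<Sum>y\<in>S. c z * b z y * y i)"
      by (simp add: sum_distrib_left mult.assoc)
    also have "\<dots> = (\<Sum>y\<in>S. \<Sum>z\<in>S'. c z * b z y * y i)"
      by (rule sum.swap)
    finally show "x i = (\<Sum>y\<in>S. ?a y * y i)"
      by (simp add: sum_distrib_right)
  qed
  ultimately show "x \<in> hull_of S"
    unfolding hull_of_def by (intro CollectI exI[of _ ?a] conjI)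
qed

lemma midpoint_in_hull:
  assumes "finite S" "y \<in> S" "z \<in> S"
  shows "(\<lambda>i. (y i + z i) / 2) \<in> hull_of S"
proof -
  \<comment> \<open>A sum of two indicators, so that for \<open>y = z\<close> the weight is 1.
    \<open>subset_hull_of\<close> relies on this case.\<close>
  let ?c = "\<lambda>v. (if v = y then 1 / 2 else 0) + (if v = z then 1 / 2 else (0 :: real))"
  have "(\<Sum>v\<in>S. ?c v) = 1"
    using assms by (simp add: sum.distrib)
  moreover have "(\<Sum>v\<in>S. ?c v * v i) = (y i + z i) / 2" for i
  proof -
    have "(\<Sum>v\<in>S. ?c v * v i) = (\<Sum>v\<in>S. (if v = y then v i / 2 else 0) + (if v = z then v i / 2 else 0))"
      by (intro sum.cong refl) (simp add: distrib_right)
    then show ?thesis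
      using assms by (simp add: sum.distrib add_divide_distrib)
  qed
  ultimately show ?thesis
    unfolding hull_of_def by (intro CollectI exI[of _ ?c]) auto
qed

lemma subset_hull_of: "finite S \<Longrightarrow> S \<subseteq> hull_of S"
  using midpoint_in_hull[of S z z for z] by auto

text \<open>What bisection carries along: lengths and types guarantee that the vertices of a child
  are vertices of the parent or the midpoint, and finiteness lets estimator sums be split.\<close>

definition mesh_shape :: "nat \<Rightarrow> mesh \<Rightarrow> bool" where
  "mesh_shape d \<T> \<longleftrightarrow> 1 \<le> d \<and> finite \<T> \<and> (\<forall>T\<in>\<T>. length (fst T) = Suc d \<and> snd T < d)"

lemma children_shape:
  assumes "1 \<le> d" "length (fst T) = Suc d" "snd T < d" "T' \<in> children d T"
  shows "length (fst T') = Suc d" "snd T' < d" "region T' \<subseteq> region T"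
proof -
  show "length (fst T') = Suc d" "snd T' < d"
    using assms by (auto simp: children_def Let_def)
  define m where "m = (\<lambda>i. (hd (fst T) i + last (fst T) i) / 2)"
  have ne: "fst T \<noteq> []"
    using assms(2) by auto
  then have "verts T' \<subseteq> insert m (verts T)"
    using assms by (auto simp: children_def Let_def verts_def m_def)
  moreover have "m \<in> region T"
    unfolding m_def region_def verts_def using ne by (intro midpoint_in_hull) auto
  ultimately have "verts T' \<subseteq> region T"
    using subset_hull_of[of "verts T"] by (auto simp: region_def verts_def)
  then show "region T' \<subseteq> region T"
    unfolding region_def by (intro hull_of_mono) (auto simp: verts_def)
qed

lemma nvb_refinement_shape:
  assumes "nvb_refinement d \<T> \<T>'" "mesh_shape d \<T>"
  shows "mesh_shape d \<T>' \<and> (\<forall>T'\<in>\<T>'. \<exists>T\<in>\<T>. region T' \<subseteq> region T)"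
  using assms unfolding nvb_refinement_def
proof (induction rule: rtranclp_induct)
  case (step \<U> \<V>)
  then have \<U>: "mesh_shape d \<U>" "\<forall>T'\<in>\<U>. \<exists>T\<in>\<T>. region T' \<subseteq> region T"
    by auto
  obtain T where T: "T \<in> \<U>" "\<V> = (\<U> - {T}) \<union> children d T"
    using step.hyps(2) by (auto simp: bisect_step_def)
  have "finite (children d T)"
    by (simp add: children_def Let_def)
  then have "mesh_shape d \<V>"
    using \<U>(1) T children_shape[of d T] unfolding mesh_shape_def by blast
  moreover have "\<exists>T\<in>\<T>. region T' \<subseteq> region T" if "T' \<in> \<V>" for T'
  proof (cases "T' \<in> \<U>")
    case False
    then have "region T' \<subseteq> region T"
      using T that \<U>(1) by (intro children_shape(3)[of d]) (auto simp: mesh_shape_def)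
    with \<U>(2) T(1) show ?thesis
      by (meson order_trans)
  qed (use \<U>(2) in blast)
  ultimately show ?case
    by blast
qed auto

lemma is_refine_nvb: "is_refine d \<T> \<M> \<T>' \<Longrightarrow> nvb_refinement d \<T> \<T>'"
  by (simp add: is_refine_def conforming_refinement_def)

lemma mesh_shape_meshes:
  assumes "\<T> \<in> meshes d \<T>\<^sub>0" "mesh_shape d \<T>\<^sub>0"
  shows "mesh_shape d \<T>"
  using assms by induction (auto dest: is_refine_nvb nvb_refinement_shape)

lemma initial_mesh_shape: "1 \<le> d \<Longrightarrow> initial_mesh d \<Omega> \<T>\<^sub>0 \<Longrightarrow> mesh_shape d \<T>\<^sub>0"
  by (auto simp: initial_mesh_def mesh_shape_def tagged_simplex_def)

lemma fe_space_polynomial: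
  assumes "v \<in> fe_space P p \<T>" "T \<in> \<T>"
  shows "\<exists>q. polynomial_fn (pdim P) p q \<and>
    (AE x in leb (pdim P). x \<in> open_region (pdim P) T \<longrightarrow> v x = q x)"
  using assms unfolding fe_space_def mem_Collect_eq by (elim conjE) (rule bspec)

text \<open>Intermediate meshes of a refinement may be nonconforming. What counts is that every fine
  region lies in a coarse one, whose polynomial is reused.\<close>

lemma fe_space_nested:
  assumes "nvb_refinement (pdim P) \<T> \<T>'" "mesh_shape (pdim P) \<T>"
  shows "fe_space P p \<T> \<subseteq> fe_space P p \<T>'"
proof
  fix v assume v: "v \<in> fe_space P p \<T>"
  have "\<exists>q. polynomial_fn (pdim P) p q \<and>
      (AE x in leb (pdim P). x \<in> open_region (pdim P) T' \<longrightarrow> v x = q x)" if "T' \<in> \<T>'" for T'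
  proof -
    have "\<exists>T\<in>\<T>. region T' \<subseteq> region T"
      using conjunct2[OF nvb_refinement_shape[OF assms]] that by (rule bspec)
    then obtain T where "T \<in> \<T>" "region T' \<subseteq> region T"
      by (rule bexE)
    then have "open_region (pdim P) T' \<subseteq> open_region (pdim P) T"
      unfolding open_region_def by (intro interior_of_mono)
    moreover obtain q where q: "polynomial_fn (pdim P) p q"
        "AE x in leb (pdim P). x \<in> open_region (pdim P) T \<longrightarrow> v x = q x"
      using v \<open>T \<in> \<T>\<close> by (auto simp: fe_space_def)
    ultimately have "AE x in leb (pdim P). x \<in> open_region (pdim P) T' \<longrightarrow> v x = q x"
      by (auto elim: eventually_mono)
    with q(1) show ?thesis by blast
  qed
  with v show "v \<in> fe_space P p \<T>'"
    by (simp add: fe_space_def)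
qed

lemma polynomial_fn_diff:
  assumes "polynomial_fn d p q" "polynomial_fn d p r"
  shows "polynomial_fn d p (q - r)"
proof -
  let ?I = "{\<kappa>. (\<forall>i\<ge>d. \<kappa> i = 0) \<and> (\<Sum>i<d. \<kappa> i) \<le> p}"
  obtain b where "\<forall>x. q x = (\<Sum>\<kappa>\<in>?I. b \<kappa> * (\<Prod>i<d. x i ^ \<kappa> i))"
    using assms(1) unfolding polynomial_fn_def by (rule exE)
  moreover obtain c where "\<forall>x. r x = (\<Sum>\<kappa>\<in>?I. c \<kappa> * (\<Prod>i<d. x i ^ \<kappa> i))"
    using assms(2) unfolding polynomial_fn_def by (rule exE)
  ultimately have "(q - r) x = (\<Sum>\<kappa>\<in>?I. (b \<kappa> - c \<kappa>) * (\<Prod>i<d. x i ^ \<kappa> i))" for x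
    by (simp add: left_diff_distrib sum_subtractf)
  then show ?thesis
    unfolding polynomial_fn_def by (intro exI[of _ "\<lambda>\<kappa>. b \<kappa> - c \<kappa>"]) blast
qed

lemma fe_space_diff:
  assumes "v \<in> fe_space P p \<T>" "w \<in> fe_space P p \<T>" "v - w \<in> XX P"
  shows "v - w \<in> fe_space P p \<T>"
proof -
  have "\<exists>q. polynomial_fn (pdim P) p q \<and>
      (AE x in leb (pdim P). x \<in> open_region (pdim P) T \<longrightarrow> (v - w) x = q x)" if T: "T \<in> \<T>" for T
  proof -
    obtain q where q: "polynomial_fn (pdim P) p q"
      "AE x in leb (pdim P). x \<in> open_region (pdim P) T \<longrightarrow> v x = q x"
      using fe_space_polynomial[OF assms(1) T] by blast
    obtain r where r: "polynomial_fn (pdim P) p r"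
      "AE x in leb (pdim P). x \<in> open_region (pdim P) T \<longrightarrow> w x = r x"
      using fe_space_polynomial[OF assms(2) T] by blast
    have "AE x in leb (pdim P). x \<in> open_region (pdim P) T \<longrightarrow> (v - w) x = (q - r) x"
      using q(2) r(2) by eventually_elim simp
    with polynomial_fn_diff[OF q(1) r(1)] show ?thesis by blast
  qed
  with assms(3) show ?thesis
    by (simp add: fe_space_def)
qed

section \<open>Additivity and monotonicity of the squared estimator\<close>

lemma eta_elem_sq_nonneg: "0 \<le> eta_elem_sq P \<T> T v"
  unfolding eta_elem_sq_def Let_def set_lebesgue_integral_def
  by (intro add_nonneg_nonneg mult_nonneg_nonneg sum_nonneg integral_nonneg_AE) auto

lemma eta_on_nonneg [simp]: "0 \<le> eta_on P \<T> \<U> v"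
  by (simp add: eta_on_def sum_nonneg eta_elem_sq_nonneg)

lemma eta_on_sq: "(eta_on P \<T> \<U> v)\<^sup>2 = (\<Sum>T\<in>\<U>. eta_elem_sq P \<T> T v)"
  by (simp add: eta_on_def sum_nonneg eta_elem_sq_nonneg)

lemma eta_on_sq_Un:
  assumes "finite \<U>" "finite \<V>" "\<U> \<inter> \<V> = {}"
  shows "(eta_on P \<T> (\<U> \<union> \<V>) v)\<^sup>2 = (eta_on P \<T> \<U> v)\<^sup>2 + (eta_on P \<T> \<V> v)\<^sup>2"
  unfolding eta_on_sq using assms by (rule sum.union_disjoint)

lemma eta_on_mono:
  assumes "finite \<V>" "\<U> \<subseteq> \<V>"
  shows "(eta_on P \<T> \<U> v)\<^sup>2 \<le> (eta_on P \<T> \<V> v)\<^sup>2"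
  unfolding eta_on_sq using assms by (intro sum_mono2) (auto simp: eta_elem_sq_nonneg)

section \<open>Counting the steps of a run\<close>

lemma lex_order_trans: "(p, q) \<in> lex_order \<Longrightarrow> (q, r) \<in> lex_order \<Longrightarrow> (p, r) \<in> lex_order"
  by (cases p; cases q; cases r) auto

lemma lex_order_irrefl: "(p, p) \<notin> lex_order"
  by (cases p) auto

text \<open>\<open>steps\<close> counts predecessors in an order. On the orbit of a deterministic
  relation that increases the index, this count is the number of transitions, which is the form that
  an induction along the run can use.\<close>

locale deterministic_run =
  fixes R :: "'s \<Rightarrow> 's \<Rightarrow> bool" and idx :: "'s \<Rightarrow> nat \<times> nat \<times> nat" and s\<^sub>0 :: 's
  assumes det: "R s t \<Longrightarrow> R s t' \<Longrightarrow> t = t'"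
    and incr: "R s t \<Longrightarrow> (idx s, idx t) \<in> lex_order"
begin

definition Q :: "(nat \<times> nat \<times> nat) set" where
  "Q = idx ` {s. R\<^sup>*\<^sup>* s\<^sub>0 s}"

lemma rtranclp_idx: "R\<^sup>*\<^sup>* s t \<Longrightarrow> s = t \<or> (idx s, idx t) \<in> lex_order"
  by (induction rule: rtranclp_induct) (auto dest: incr intro: lex_order_trans)

lemma linear: "R\<^sup>*\<^sup>* s t \<Longrightarrow> R\<^sup>*\<^sup>* s t' \<Longrightarrow> R\<^sup>*\<^sup>* t t' \<or> R\<^sup>*\<^sup>* t' t"
proof (induction rule: rtranclp_induct)
  case (step t v)
  then consider "R\<^sup>*\<^sup>* t t'" | "R\<^sup>*\<^sup>* t' t"
    by blast
  then show ?case
  proof cases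
    case 1
    then show ?thesis
    proof (cases rule: converse_rtranclpE)
      case base
      with step.hyps(2) show ?thesis by blast
    next
      case (step w)
      with \<open>R t v\<close> show ?thesis
        using det by blast
    qed
  next
    case 2
    with step.hyps(2) show ?thesis
      by (meson rtranclp.rtrancl_into_rtrancl)
  qed
qed auto

lemma relpowp_det: "(R ^^ n) s t \<Longrightarrow> (R ^^ n) s t' \<Longrightarrow> t = t'"
proof (induction n arbitrary: t t')
  case (Suc n)
  then show ?case
    by (metis det relpowp_Suc_E)
qed auto

text \<open>If \<open>s\<close> follows \<open>r\<close>, the indices below that of \<open>s\<close>
  are those below that of \<open>r\<close> and the index of \<open>r\<close> itself: the orbit is a
  chain, so every other reachable state lies at or beyond \<open>s\<close>. Finiteness is carried
  along because \<open>card\<close> is 0 on infinite sets.\<close>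

lemma preceding_steps:
  "(R ^^ n) s\<^sub>0 s \<Longrightarrow> finite {q \<in> Q. (q, idx s) \<in> lex_order} \<and> card {q \<in> Q. (q, idx s) \<in> lex_order} = n"
proof (induction n arbitrary: s)
  case 0
  then have [simp]: "s = s\<^sub>0" by simp
  have "(idx t, idx s) \<notin> lex_order" if "R\<^sup>*\<^sup>* s\<^sub>0 t" for t
    using rtranclp_idx[OF that] lex_order_trans[of "idx s" "idx t" "idx s"] lex_order_irrefl[of "idx s"]
    by (auto simp del: in_lex_prod)
  then have "{q \<in> Q. (q, idx s) \<in> lex_order} = {}"
    unfolding Q_def by blast
  then show ?case
    by (simp only: \<open>s = s\<^sub>0\<close>) simp
next
  case (Suc n)
  then obtain r where r: "(R ^^ n) s\<^sub>0 r" "R r s"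
    by (auto elim: relpowp_Suc_E)
  have reach: "R\<^sup>*\<^sup>* s\<^sub>0 r"
    using r(1) by (rule relpowp_imp_rtranclp)
  have "{q \<in> Q. (q, idx s) \<in> lex_order} = insert (idx r) {q \<in> Q. (q, idx r) \<in> lex_order}"
  proof (intro equalityI subsetI)
    fix q assume q: "q \<in> {q \<in> Q. (q, idx s) \<in> lex_order}"
    then obtain t where t: "R\<^sup>*\<^sup>* s\<^sub>0 t" "q = idx t"
      by (auto simp: Q_def)
    have "R\<^sup>*\<^sup>* t r"
    proof (rule ccontr)
      assume not: "\<not> R\<^sup>*\<^sup>* t r"
      then have "R\<^sup>*\<^sup>* r t"
        using linear[OF reach t(1)] by blast
      then have "R\<^sup>*\<^sup>* s t"
        using not r(2) det by (cases rule: converse_rtranclpE) blast+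
      then show False
        using rtranclp_idx[of s t] q t(2) lex_order_trans lex_order_irrefl by blast
    qed
    then show "q \<in> insert (idx r) {q \<in> Q. (q, idx r) \<in> lex_order}"
      using rtranclp_idx[of t r] t by (auto simp: Q_def simp del: in_lex_prod)
  next
    fix q assume "q \<in> insert (idx r) {q \<in> Q. (q, idx r) \<in> lex_order}"
    then show "q \<in> {q \<in> Q. (q, idx s) \<in> lex_order}"
      using incr[OF r(2)] reach lex_order_trans unfolding Q_def by blast
  qed
  moreover have "idx r \<notin> {q \<in> Q. (q, idx r) \<in> lex_order}"
    using lex_order_irrefl by blast
  ultimately show ?case
    using Suc.IH[OF r(1)] by (simp only: finite_insert card_insert_disjoint simp_thms)
qed

lemma steps_idx: "(R ^^ n) s\<^sub>0 s \<Longrightarrow> steps Q (idx s) = n"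
  using preceding_steps unfolding steps_def by blast

lemma steps_less:
  assumes "p \<in> Q" "q \<in> Q" "steps Q p < steps Q q"
  obtains s t where "R\<^sup>*\<^sup>* s\<^sub>0 s" "p = idx s" "q = idx t" "(R ^^ (steps Q q - steps Q p)) s t"
proof -
  obtain s where s: "R\<^sup>*\<^sup>* s\<^sub>0 s" "p = idx s"
    using assms(1) by (auto simp: Q_def)
  obtain t where t: "R\<^sup>*\<^sup>* s\<^sub>0 t" "q = idx t"
    using assms(2) by (auto simp: Q_def)
  obtain m n where mn: "(R ^^ m) s\<^sub>0 s" "(R ^^ n) s\<^sub>0 t"
    using s t by (meson rtranclp_imp_relpowp)
  then have eq: "steps Q p = m" "steps Q q = n"
    using s(2) t(2) steps_idx by auto
  then have "(R ^^ (m + (n - m))) s\<^sub>0 t"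
    using mn(2) assms(3) by simp
  then obtain r where "(R ^^ m) s\<^sub>0 r" "(R ^^ (n - m)) r t"
    unfolding relpowp_add by blast
  then have "(R ^^ (n - m)) s t"
    using relpowp_det mn(1) by blast
  then show thesis
    using that s t eq by blast
qed

end

section \<open>The algorithm as a deterministic run\<close>

text \<open>The current values of \<open>\<alpha>\<^sub>m\<^sub>i\<^sub>n\<close> and \<open>J\<^sub>m\<^sub>a\<^sub>x\<close> belong to the state, which makes the successor unique.\<close>

type_synonym state = "nat \<times> nat \<times> nat \<times> real \<times> nat"

fun state_idx :: "state \<Rightarrow> nat \<times> nat \<times> nat" where
  "state_idx (l, k, j, am, Jm) = (l, k, j)"

inductive advances :: "problem \<Rightarrow> params \<Rightarrow> (nat \<Rightarrow> mesh) \<Rightarrow> (nat \<Rightarrow> nat \<Rightarrow> nat \<Rightarrow> fn) \<Rightarrow>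
    state \<Rightarrow> state \<Rightarrow> bool" for P A \<T> u where
  first_k: "advances P A \<T> u (l, 0, 0, am, Jm) (l, 1, 0, am, Jm)"
| first_j: "1 \<le> k \<Longrightarrow> advances P A \<T> u (l, k, 0, am, Jm) (l, k, 1, am, Jm)"
| next_j: "1 \<le> k \<Longrightarrow> 1 \<le> j \<Longrightarrow> \<not> tau_stop P A \<T> u l k j \<Longrightarrow> \<not> leave_j P u l k j am Jm \<Longrightarrow>
    advances P A \<T> u (l, k, j, am, Jm) (l, k, Suc j, am, Jm)"
| next_k: "1 \<le> k \<Longrightarrow> 1 \<le> j \<Longrightarrow> \<not> tau_stop P A \<T> u l k j \<Longrightarrow> leave_j P u l k j am Jm \<Longrightarrow>
    \<not> leave_k P A \<T> u l k j \<Longrightarrow> advances P A \<T> u (l, k, j, am, Jm)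
      (l, Suc k, 0, (if Jm < j then rho A * am else am), (if Jm < j then j else Jm))"
| next_l: "1 \<le> k \<Longrightarrow> 1 \<le> j \<Longrightarrow> \<not> tau_stop P A \<T> u l k j \<Longrightarrow> leave_j P u l k j am Jm \<Longrightarrow>
    leave_k P A \<T> u l k j \<Longrightarrow> advances P A \<T> u (l, k, j, am, Jm)
      (Suc l, 0, 0, (if Jm < j then rho A * am else am), (if Jm < j then j else Jm))"

lemma reached_advances:
  "reached P A \<T> u l k j am Jm \<longleftrightarrow>
    (advances P A \<T> u)\<^sup>*\<^sup>* (0, 0, 0, amin A, jmax A) (l, k, j, am, Jm)"
proof
  assume "reached P A \<T> u l k j am Jm"
  then show "(advances P A \<T> u)\<^sup>*\<^sup>* (0, 0, 0, amin A, jmax A) (l, k, j, am, Jm)"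
    by induction (blast intro: advances.intros rtranclp.rtrancl_into_rtrancl)+
next
  have "(advances P A \<T> u)\<^sup>*\<^sup>* s t \<Longrightarrow> s = (0, 0, 0, amin A, jmax A) \<Longrightarrow>
      (case t of (l, k, j, am, Jm) \<Rightarrow> reached P A \<T> u l k j am Jm)" for s t
  proof (induction rule: rtranclp_induct)
    case base
    then show ?case by (simp add: reached.start)
  next
    case (step t v)
    note IH = step.IH[OF step.prems]
    from step.hyps(2) show ?case
    proof cases
      case (first_k l am Jm)
      then show ?thesis
        using IH reached.first_k[of P A \<T> u l am Jm] by (simp del: One_nat_def)
    next
      case (first_j k l am Jm)
      then show ?thesis
        using IH reached.first_j[of P A \<T> u l k am Jm] by (simp del: One_nat_def)
    next
      case (next_j k j l am Jm)
      then show ?thesis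
        using IH reached.next_j[of P A \<T> u l k j am Jm] by (simp del: One_nat_def)
    next
      case (next_k k j l am Jm)
      then show ?thesis
        using IH reached.next_k[of P A \<T> u l k j am Jm] by (simp del: One_nat_def)
    next
      case (next_l k j l am Jm)
      then show ?thesis
        using IH reached.next_l[of P A \<T> u l k j am Jm] by (simp del: One_nat_def)
    qed
  qed
  then show "reached P A \<T> u l k j am Jm"
    if "(advances P A \<T> u)\<^sup>*\<^sup>* (0, 0, 0, amin A, jmax A) (l, k, j, am, Jm)"
    using that by fastforce
qed

interpretation run: deterministic_run "advances P A \<T> u" state_idx "(0, 0, 0, amin A, jmax A)"
  for P A \<T> u
proof
  \<comment> \<open>The guards of the rules exclude each other, and the successor is a function of
    the state.\<close>
  show "t = t'" if "advances P A \<T> u s t" "advances P A \<T> u s t'" for s t t'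
    using that by (auto elim!: advances.cases)
  show "(state_idx s, state_idx t) \<in> lex_order" if "advances P A \<T> u s t" for s t
    using that by cases auto
qed

lemma run_Q: "run.Q P A \<T> u = QQ P A \<T> u"
  unfolding run.Q_def QQ_def reached_advances by force

section \<open>Contraction of the Lyapunov function\<close>

lemma young_sq:
  fixes a b \<delta> :: real
  assumes "0 < \<delta>"
  shows "(a + b)\<^sup>2 \<le> (1 + \<delta>) * a\<^sup>2 + (1 + 1 / \<delta>) * b\<^sup>2"
proof -
  have "0 \<le> (\<delta> * a - b)\<^sup>2 / \<delta>"
    using assms by simp
  also have "\<dots> = \<delta> * a\<^sup>2 - 2 * a * b + b\<^sup>2 / \<delta>"
    using assms by (simp add: power2_eq_square field_simps)
  finally show ?thesis
    by (simp add: power2_sum algebra_simps)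
qed

lemma sum3_sq_le: "(a + b + c)\<^sup>2 \<le> 3 * (a\<^sup>2 + b\<^sup>2 + c\<^sup>2)" for a b c :: real
proof -
  have "0 \<le> (a - b)\<^sup>2 + (b - c)\<^sup>2 + (a - c)\<^sup>2"
    by simp
  then show ?thesis
    by (simp add: power2_eq_square algebra_simps)
qed

text \<open>Only numbers occur here, so that \<open>q_lin\<close> and \<open>C_lin\<close> exist
  before any problem, mesh or run is fixed.\<close>

locale constants =
  fixes L \<alpha> q_red q_nrg C_stab C_rel \<theta> lam :: real and j\<^sub>0 :: nat
  assumes pos: "0 < \<alpha>" "0 < L" "0 < C_stab" "0 < C_rel" "0 < lam"
    and q_red: "0 < q_red" "q_red < 1"
    and q_nrg: "0 < q_nrg" "q_nrg < 1"
    and \<theta>: "0 < \<theta>" "\<theta> \<le> 1"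
begin

text \<open>Refined elements carry at least the share \<theta> of the squared estimator and are
  reduced by the factor \<open>q_red\<^sup>2\<close>; the rest is unchanged.\<close>

definition "r = 1 - (1 - q_red\<^sup>2) * \<theta>"

text \<open>The first factor is \<open>1 + 1 / \<delta>\<close> from Young's inequality with
  \<open>\<delta> = (1 - r) / 2\<close>. The second converts the distance of two consecutive final
  iterates into energy, with \<open>8 / \<alpha>\<close> from \<open>dsq_consecutive\<close>. The K
  of the overview is \<open>K2\<close>.\<close>

definition "K = (1 + 2 / (1 - r)) * (C_stab\<^sup>2 * (8 / \<alpha>))"

text \<open>The weight \<open>\<gamma>\<close> of the estimator is so small that the perturbation terms of both the
  estimator reduction and the stopping criterion are absorbed by the contraction of the energy.\<close>

definition "\<gamma> = min ((1 - q_nrg) / (2 * K)) (lam * (1 - q_nrg) / 2)"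

text \<open>Each factor lies half way between a pure contraction factor and 1; the other half
  absorbs the perturbations.\<close>

definition "s = max ((1 + q_nrg) / 2) ((1 + r) / 2)"

text \<open>\<open>L / 2 * C_rel\<^sup>2\<close> comes from reliability and the upper energy bound.
  The bracket collects the coefficients of \<open>eta_ush\<close>, that of the estimator divided by
  the weight \<gamma> with which it enters Z.\<close>

definition "K2 = L / 2 * C_rel\<^sup>2 * (2 / \<gamma> + 4 * C_stab\<^sup>2 / \<alpha>)"

definition "\<kappa> = 1 - (1 - s) / (1 + K2)"

text \<open>Chosen for Bernoulli's inequality to give
  \<open>\<kappa> \<le> \<omega> ^ (j\<^sub>0 + 2)\<close>. The weight of a state holds at most
  \<open>Suc j\<^sub>0\<close> factors \<omega>, and leaving the loop asks for one more.\<close>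

definition "\<omega> = 1 - (1 - \<kappa>) / (j\<^sub>0 + 2)"

text \<open>The factor 3 stems from squaring a sum of three terms. The first two summands come from
  \<open>eta_ush\<close>; \<open>10 / \<alpha>\<close> is \<open>2 / \<alpha>\<close> for the
  linearization error plus \<open>8 / \<alpha>\<close> for the solver error.\<close>

definition "C_up = 3 * (2 / \<gamma> + 4 * C_stab\<^sup>2 / \<alpha> + 10 / \<alpha>)"

definition "C_low = L / 2 * C_rel\<^sup>2 + L + \<gamma> * (2 + 4 * C_stab\<^sup>2)"

definition "q_lin = sqrt \<omega>"

text \<open>The summand 1 serves pairs of indices within one solver loop, the root all other pairs.
  The denominator makes up for the bounded number of solver steps without guaranteed decay.\<close>

definition "C_lin = (1 + sqrt (C_up * C_low)) / \<omega> ^ (j\<^sub>0 + 1)"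

lemma r_bounds: "0 \<le> r" "r < 1"
proof -
  have q: "0 < 1 - q_red\<^sup>2" "1 - q_red\<^sup>2 \<le> 1"
    using q_red power_strict_mono[of q_red 1 2] by simp_all
  then show "r < 1"
    using \<theta> by (simp add: r_def)
  show "0 \<le> r"
    using mult_le_one[of "1 - q_red\<^sup>2" \<theta>] q \<theta> by (simp add: r_def)
qed

lemma K_pos: "0 < K"
  unfolding K_def using r_bounds pos by (intro mult_pos_pos add_pos_pos divide_pos_pos) auto

lemma \<gamma>_pos: "0 < \<gamma>"
  using K_pos q_nrg pos by (simp add: \<gamma>_def)

lemma \<gamma>_K: "q_nrg + \<gamma> * K \<le> s"
proof -
  have "\<gamma> * K \<le> (1 - q_nrg) / (2 * K) * K"
    using K_pos by (intro mult_right_mono) (auto simp: \<gamma>_def)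
  also have "\<dots> = (1 - q_nrg) / 2"
    using K_pos by simp
  finally show ?thesis
    by (simp add: s_def max_def field_simps)
qed

lemma \<gamma>_lam: "q_nrg + \<gamma> / lam \<le> s"
proof -
  have "\<gamma> / lam \<le> (lam * (1 - q_nrg) / 2) / lam"
    using pos by (intro divide_right_mono) (auto simp: \<gamma>_def)
  also have "\<dots> = (1 - q_nrg) / 2"
    using pos by simp
  finally show ?thesis
    by (simp add: s_def max_def field_simps)
qed

lemma s_bounds: "0 < s" "s < 1" "(1 + r) / 2 \<le> s"
  using r_bounds q_nrg by (auto simp: s_def less_max_iff_disj)

lemma K2_nonneg: "0 \<le> K2"
  using \<gamma>_pos pos by (simp add: K2_def)

lemma \<kappa>_bounds: "0 < \<kappa>" "\<kappa> < 1"
proof -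
  have "(1 - s) / (1 + K2) \<le> 1 - s"
    using K2_nonneg s_bounds by (simp add: divide_le_eq mult_le_cancel_left1)
  then show "0 < \<kappa>"
    using s_bounds by (simp add: \<kappa>_def)
  show "\<kappa> < 1"
    using K2_nonneg s_bounds by (simp add: \<kappa>_def)
qed

text \<open>At least the share \<open>1 / (1 + K2)\<close> of \<open>D + Z\<close> sits in
  \<open>Z\<close>, and of \<open>Z\<close> the share \<open>1 - s\<close> is lost.\<close>

lemma \<kappa>_contraction:
  assumes "D \<le> K2 * Z" "W \<le> D + s * Z"
  shows "W \<le> \<kappa> * (D + Z)"
proof -
  have "(D + Z) / (1 + K2) \<le> Z"
    using assms(1) K2_nonneg by (simp add: divide_le_eq algebra_simps)
  then have "(1 - s) * ((D + Z) / (1 + K2)) \<le> (1 - s) * Z"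
    using s_bounds by (intro mult_left_mono) auto
  then show ?thesis
    using assms(2) by (simp add: \<kappa>_def algebra_simps)
qed

lemma \<omega>_bounds: "0 < \<omega>" "\<omega> < 1"
proof -
  have "(1 - \<kappa>) / (real j\<^sub>0 + 2) \<le> 1 - \<kappa>"
    using \<kappa>_bounds by (simp add: divide_le_eq mult_le_cancel_left1)
  then show "0 < \<omega>"
    using \<kappa>_bounds by (simp add: \<omega>_def add.commute)
  show "\<omega> < 1"
    using \<kappa>_bounds by (simp add: \<omega>_def)
qed

lemma \<kappa>_le_\<omega>: "\<kappa> \<le> \<omega> ^ (j\<^sub>0 + 2)"
proof -
  have "1 + real (j\<^sub>0 + 2) * (\<omega> - 1) \<le> (1 + (\<omega> - 1)) ^ (j\<^sub>0 + 2)"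
    using \<omega>_bounds by (intro Bernoulli_inequality) simp
  moreover have "real (j\<^sub>0 + 2) * (\<omega> - 1) = \<kappa> - 1"
    by (simp add: \<omega>_def field_simps)
  ultimately show ?thesis by simp
qed

lemma C_pos: "0 < C_up" "0 < C_low"
  using \<gamma>_pos pos by (auto simp: C_up_def C_low_def intro!: add_pos_pos mult_pos_pos)

lemma lin_constants: "0 < q_lin" "q_lin < 1" "0 < C_lin"
  using \<omega>_bounds C_pos by (auto simp: q_lin_def C_lin_def intro!: divide_pos_pos add_pos_nonneg)

end

section \<open>Energy and estimator on a mesh and its refinement\<close>

locale ailfem = constants L \<alpha> q_red q_nrg C_stab C_rel \<theta> lam j\<^sub>0 + pde P \<alpha> L
  for L \<alpha> q_red q_nrg C_stab C_rel \<theta> lam :: real and j\<^sub>0 :: nat and P :: problem +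
  fixes p :: nat and \<T>\<^sub>0 :: mesh and A :: params
    and \<Phi> :: "mesh \<Rightarrow> fn \<Rightarrow> fn" and \<Psi> :: "mesh \<Rightarrow> fn \<Rightarrow> fn \<Rightarrow> fn"
    and us :: fn and ush :: "mesh \<Rightarrow> fn" and q_alg :: real
  assumes initial: "initial_mesh (pdim P) (pdom P) \<T>\<^sub>0"
    and us: "galerkin_solution P (XX P) us"
    and ush: "H \<in> meshes (pdim P) \<T>\<^sub>0 \<Longrightarrow> galerkin_solution P (fe_space P p H) (ush H)"
    and \<Phi>_fe: "H \<in> meshes (pdim P) \<T>\<^sub>0 \<Longrightarrow> v \<in> fe_space P p H \<Longrightarrow> \<Phi> H v \<in> fe_space P p H"
    and \<Phi>_energy: "H \<in> meshes (pdim P) \<T>\<^sub>0 \<Longrightarrow> v \<in> fe_space P p H \<Longrightarrow>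
      dsq P (ush H) (\<Phi> H v) \<le> dsq P (ush H) v"
    and solver: "contractive_solver P p \<T>\<^sub>0 \<Phi> \<Psi> q_alg"
    and stab: "stability P p \<T>\<^sub>0 C_stab"
    and red: "reduction P p \<T>\<^sub>0 q_red"
    and rel: "reliability P \<T>\<^sub>0 us ush C_rel"
    and params: "theta A = \<theta>" "lam_lin A = lam"
begin

abbreviation "\<TT> \<equiv> meshes (pdim P) \<T>\<^sub>0"
abbreviation "fe \<equiv> fe_space P p"

lemma pdim_pos: "1 \<le> pdim P"
  using data by (simp add: problem_data_def)

lemma fe_XX: "v \<in> fe H \<Longrightarrow> v \<in> XX P"
  by (simp add: fe_space_def)

lemma fe_diff: "v \<in> fe H \<Longrightarrow> w \<in> fe H \<Longrightarrow> v - w \<in> fe H"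
  by (intro fe_space_diff H10_diff fe_XX)

lemma mesh_shape_T: "H \<in> \<TT> \<Longrightarrow> mesh_shape (pdim P) H"
  using mesh_shape_meshes initial_mesh_shape[OF pdim_pos initial] by blast

lemma fe_refine: "H \<in> \<TT> \<Longrightarrow> is_refine (pdim P) H M h \<Longrightarrow> fe H \<subseteq> fe h"
  by (rule fe_space_nested[OF is_refine_nvb mesh_shape_T])

lemma ush_fe: "H \<in> \<TT> \<Longrightarrow> ush H \<in> fe H"
  using ush by (simp add: galerkin_solution_def)

lemma ush_XX: "H \<in> \<TT> \<Longrightarrow> ush H \<in> XX P"
  using ush_fe fe_XX by blast

lemma us_XX: "us \<in> XX P"
  using us by (simp add: galerkin_solution_def)

lemma dsq_ush:
  assumes "H \<in> \<TT>" "v \<in> fe H"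
  shows "\<alpha> / 2 * (enorm P (v - ush H))\<^sup>2 \<le> dsq P (ush H) v"
    "dsq P (ush H) v \<le> L / 2 * (enorm P (v - ush H))\<^sup>2"
  using dsq_galerkin[OF ush[OF assms(1)] _ assms(2)] fe_diff[OF assms(2) ush_fe[OF assms(1)]] fe_XX
  by auto

lemma enorm_ush:
  assumes "H \<in> \<TT>" "v \<in> fe H"
  shows "(enorm P (v - ush H))\<^sup>2 \<le> 2 / \<alpha> * dsq P (ush H) v"
  using dsq_ush(1)[OF assms] pos(1) by (simp add: field_simps)

lemma dsq_ush_nonneg:
  assumes "H \<in> \<TT>" "v \<in> fe H"
  shows "0 \<le> dsq P (ush H) v"
  using dsq_ush(1)[OF assms] pos(1) by (meson mult_nonneg_nonneg order_trans zero_le_power2 half_gt_zero less_imp_le)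

lemma dsq_us_ush:
  assumes "H \<in> \<TT>"
  shows "dsq P us (ush H) \<le> L / 2 * (C_rel * eta P H (ush H))\<^sup>2"
proof -
  note XX = ush_XX[OF assms]
  have "enorm P (ush H - us) \<le> C_rel * eta P H (ush H)"
    using rel assms unfolding reliability_def enorm_commute[OF XX us_XX] by blast
  then have "L / 2 * (enorm P (ush H - us))\<^sup>2 \<le> L / 2 * (C_rel * eta P H (ush H))\<^sup>2"
    using pos(2) by (intro mult_left_mono power_mono) auto
  then show ?thesis
    using dsq_galerkin(2)[OF us subset_refl XX H10_diff[OF XX us_XX]] by simp
qed

text \<open>Both functions are compared with the discrete solution; each of the two errors
  contributes \<open>2 * (2 / \<alpha>)\<close>.\<close>

lemma dsq_consecutive:
  assumes "H \<in> \<TT>" "v \<in> fe H" "w \<in> fe H" "dsq P (ush H) v \<le> dsq P (ush H) w"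
  shows "(enorm P (v - w))\<^sup>2 \<le> 8 / \<alpha> * dsq P (ush H) w"
proof -
  have "(enorm P (v - w))\<^sup>2 \<le> 2 * (enorm P (v - ush H))\<^sup>2 + 2 * (enorm P (w - ush H))\<^sup>2"
    using enorm_diff_le[OF fe_XX[OF assms(2)] ush_XX[OF assms(1)] fe_XX[OF assms(3)]]
    unfolding enorm_commute[OF ush_XX[OF assms(1)] fe_XX[OF assms(3)]] .
  also have "\<dots> \<le> 2 * (2 / \<alpha> * dsq P (ush H) v) + 2 * (2 / \<alpha> * dsq P (ush H) w)"
    by (intro add_mono mult_left_mono enorm_ush assms) auto
  also have "\<dots> \<le> 2 * (2 / \<alpha> * dsq P (ush H) w) + 2 * (2 / \<alpha> * dsq P (ush H) w)"
    using assms(4) pos(1) by (intro add_mono mult_left_mono) auto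
  finally show ?thesis by simp
qed

lemma eta_diff:
  assumes "H \<in> \<TT>" "v \<in> fe H" "w \<in> fe H"
  shows "eta P H v \<le> eta P H w + C_stab * enorm P (v - w)"
proof -
  \<comment> \<open>A mesh counts among its own refinements, so stability also compares two
    functions on one mesh.\<close>
  have "\<bar>eta_on P H (H \<inter> H) v - eta_on P H (H \<inter> H) w\<bar> \<le> C_stab * enorm P (v - w)"
    using stab assms meshes.base unfolding stability_def by blast
  then show ?thesis by simp
qed

lemma eta_diff_sq:
  assumes "H \<in> \<TT>" "v \<in> fe H" "w \<in> fe H" "0 < \<delta>"
  shows "(eta P H v)\<^sup>2 \<le> (1 + \<delta>) * (eta P H w)\<^sup>2 + (1 + 1 / \<delta>) * (C_stab\<^sup>2 * (enorm P (v - w))\<^sup>2)"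
proof -
  have "(eta P H v)\<^sup>2 \<le> (eta P H w + C_stab * enorm P (v - w))\<^sup>2"
    using eta_diff[OF assms(1-3)] by (intro power_mono) auto
  also have "\<dots> \<le> (1 + \<delta>) * (eta P H w)\<^sup>2 + (1 + 1 / \<delta>) * (C_stab * enorm P (v - w))\<^sup>2"
    by (rule young_sq[OF assms(4)])
  finally show ?thesis
    by (simp add: power_mult_distrib)
qed

lemma eta_ush:
  assumes "H \<in> \<TT>" "w \<in> fe H"
  shows "(eta P H (ush H))\<^sup>2 \<le> 2 * (eta P H w)\<^sup>2 + 4 * C_stab\<^sup>2 / \<alpha> * dsq P (ush H) w"
proof -
  have "(eta P H (ush H))\<^sup>2 \<le> 2 * (eta P H w)\<^sup>2 + 2 * (C_stab\<^sup>2 * (enorm P (w - ush H))\<^sup>2)"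
    using eta_diff_sq[OF assms(1) ush_fe[OF assms(1)] assms(2), of 1]
    unfolding enorm_commute[OF ush_XX[OF assms(1)] fe_XX[OF assms(2)]] by simp
  also have "\<dots> \<le> 2 * (eta P H w)\<^sup>2 + 2 * (C_stab\<^sup>2 * (2 / \<alpha> * dsq P (ush H) w))"
    by (intro add_left_mono mult_left_mono enorm_ush assms) auto
  finally show ?thesis by (simp add: mult.assoc)
qed

text \<open>The mesh enters through the estimator only, so refinement leaves the energy part of an
  unchanged function as it is.\<close>

definition lyap :: "mesh \<Rightarrow> fn \<Rightarrow> real" where
  "lyap H w = dsq P us w + \<gamma> * (eta P H w)\<^sup>2"

lemma dsq_us_ush_le:
  assumes "H \<in> \<TT>" "w \<in> fe H"
  shows "dsq P us (ush H) \<le> K2 * (dsq P (ush H) w + \<gamma> * (eta P H w)\<^sup>2)"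
proof -
  let ?x = "dsq P (ush H) w" and ?y = "(eta P H w)\<^sup>2"
  have x: "0 \<le> ?x"
    by (rule dsq_ush_nonneg[OF assms])
  have "dsq P us (ush H) \<le> L / 2 * C_rel\<^sup>2 * (eta P H (ush H))\<^sup>2"
    using dsq_us_ush[OF assms(1)] by (simp add: power_mult_distrib)
  also have "\<dots> \<le> L / 2 * C_rel\<^sup>2 * (2 * ?y + 4 * C_stab\<^sup>2 / \<alpha> * ?x)"
    using pos(2) by (intro mult_left_mono eta_ush assms) auto
  also have "\<dots> \<le> L / 2 * C_rel\<^sup>2 * ((2 / \<gamma> + 4 * C_stab\<^sup>2 / \<alpha>) * (?x + \<gamma> * ?y))"
  proof (rule mult_left_mono)
    have "(2 / \<gamma> + 4 * C_stab\<^sup>2 / \<alpha>) * (?x + \<gamma> * ?y)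
        = 2 * ?y + 4 * C_stab\<^sup>2 / \<alpha> * ?x + (2 / \<gamma> * ?x + 4 * C_stab\<^sup>2 / \<alpha> * (\<gamma> * ?y))"
      using \<gamma>_pos by (simp add: algebra_simps)
    moreover have "0 \<le> 2 / \<gamma> * ?x + 4 * C_stab\<^sup>2 / \<alpha> * (\<gamma> * ?y)"
      using \<gamma>_pos pos x by simp
    ultimately show "2 * ?y + 4 * C_stab\<^sup>2 / \<alpha> * ?x \<le> (2 / \<gamma> + 4 * C_stab\<^sup>2 / \<alpha>) * (?x + \<gamma> * ?y)"
      by linarith
  qed (use pos in auto)
  finally show ?thesis
    by (simp add: K2_def mult.assoc)
qed

lemma lyap_split: "lyap H w = dsq P us (ush H) + (dsq P (ush H) w + \<gamma> * (eta P H w)\<^sup>2)"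
  by (simp add: lyap_def dsq_def)

text \<open>\<open>dsq P v w\<close> is the drop of the energy error and hence at most the old
  error. The estimator of \<open>v\<close> is thus paid for entirely by the energy part, whose
  factor becomes \<open>q_nrg + \<gamma> / lam\<close>.\<close>

lemma lyap_k_step:
  assumes H: "H \<in> \<TT>" and v: "v \<in> fe H" and w: "w \<in> fe H"
    and contr: "dsq P (ush H) v \<le> q_nrg * dsq P (ush H) w"
    and not_left: "\<not> dsq P v w \<le> lam * (eta P H v)\<^sup>2"
  shows "lyap H v \<le> \<kappa> * lyap H w"
proof -
  let ?x = "dsq P (ush H) w"
  have nonneg: "0 \<le> ?x" "0 \<le> dsq P (ush H) v"
    using dsq_ush_nonneg H v w by auto
  have "lam * (eta P H v)\<^sup>2 \<le> ?x"
    using not_left nonneg by (simp add: dsq_def)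
  then have "(eta P H v)\<^sup>2 \<le> ?x / lam"
    using pos(5) by (simp add: le_divide_eq mult.commute)
  then have "\<gamma> * (eta P H v)\<^sup>2 \<le> \<gamma> * (?x / lam)"
    using \<gamma>_pos by (intro mult_left_mono) auto
  then have "dsq P (ush H) v + \<gamma> * (eta P H v)\<^sup>2 \<le> (q_nrg + \<gamma> / lam) * ?x"
    using contr by (simp add: algebra_simps)
  also have "\<dots> \<le> s * ?x"
    using \<gamma>_lam nonneg by (intro mult_right_mono)
  also have "\<dots> \<le> s * (?x + \<gamma> * (eta P H w)\<^sup>2)"
    using s_bounds \<gamma>_pos by (intro mult_left_mono) auto
  finally show ?thesis
    unfolding lyap_split by (intro \<kappa>_contraction dsq_us_ush_le[OF H w]) simp
qed

text \<open>On common elements stability with equal arguments forces equality; the others are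
  reduced by \<open>q_red\<close>. Marked elements do not survive in \<open>h\<close>, so
  \<open>H - h\<close> contains \<open>M\<close> and with it the share \<theta>.\<close>

lemma eta_refine:
  assumes H: "H \<in> \<TT>" and v: "v \<in> fe H" and "marking P A H v M" and ref: "is_refine (pdim P) H M h"
  shows "h \<in> \<TT>" "(eta P h v)\<^sup>2 \<le> r * (eta P H v)\<^sup>2"
proof -
  have M: "M \<subseteq> H" "\<theta> * (eta P H v)\<^sup>2 \<le> (eta_on P H M v)\<^sup>2"
    using assms(3) params by (auto simp: marking_def)
  show h: "h \<in> \<TT>"
    by (rule meshes.step[OF H M(1) ref])
  have hH: "h \<in> meshes (pdim P) H"
    by (rule meshes.step[OF meshes.base M(1) ref])
  have fin: "finite H" "finite h"
    using mesh_shape_T H h by (auto simp: mesh_shape_def)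
  have vh: "v \<in> fe h"
    using fe_refine[OF H ref] v by blast
  have "\<bar>eta_on P h (h \<inter> H) v - eta_on P H (h \<inter> H) v\<bar> \<le> C_stab * enorm P (v - v)"
    using stab H hH v vh unfolding stability_def by blast
  then have same: "eta_on P h (h \<inter> H) v = eta_on P H (h \<inter> H) v"
    using enorm_self[OF fe_XX[OF v]] by simp
  have "eta_on P h (h - H) v \<le> q_red * eta_on P H (H - h) v"
    using red H hH v unfolding reduction_def by blast
  then have "(eta_on P h (h - H) v)\<^sup>2 \<le> (q_red * eta_on P H (H - h) v)\<^sup>2"
    by (intro power_mono) auto
  then have new: "(eta_on P h (h - H) v)\<^sup>2 \<le> q_red\<^sup>2 * (eta_on P H (H - h) v)\<^sup>2"
    by (simp add: power_mult_distrib)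
  have "M \<inter> h = {}"
    using ref by (simp add: is_refine_def conforming_refinement_def)
  then have "(eta_on P H M v)\<^sup>2 \<le> (eta_on P H (H - h) v)\<^sup>2"
    using M(1) fin by (intro eta_on_mono) auto
  then have "\<theta> * (eta P H v)\<^sup>2 \<le> (eta_on P H (H - h) v)\<^sup>2"
    by (rule order_trans[OF M(2)])
  moreover have "0 \<le> 1 - q_red\<^sup>2"
    using q_red power_mono[of q_red 1 2] by simp
  ultimately have marked: "(1 - q_red\<^sup>2) * (\<theta> * (eta P H v)\<^sup>2) \<le> (1 - q_red\<^sup>2) * (eta_on P H (H - h) v)\<^sup>2"
    by (rule mult_left_mono)
  have parts: "h \<inter> H \<union> (h - H) = h" "h \<inter> H \<union> (H - h) = H"
    by blast+
  have "(eta P h v)\<^sup>2 = (eta_on P h (h \<inter> H) v)\<^sup>2 + (eta_on P h (h - H) v)\<^sup>2"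
    using fin by (intro eta_on_sq_Un[of "h \<inter> H" "h - H" P h v, unfolded parts]) auto
  moreover have "(eta P H v)\<^sup>2 = (eta_on P H (h \<inter> H) v)\<^sup>2 + (eta_on P H (H - h) v)\<^sup>2"
    using fin by (intro eta_on_sq_Un[of "h \<inter> H" "H - h" P H v, unfolded parts]) auto
  ultimately show "(eta P h v)\<^sup>2 \<le> r * (eta P H v)\<^sup>2"
    using new marked same by (simp add: r_def algebra_simps)
qed

lemma lyap_refine:
  assumes "H \<in> \<TT>" "v \<in> fe H" "marking P A H v M" "is_refine (pdim P) H M h"
  shows "lyap h v \<le> lyap H v"
proof -
  have "(eta P h v)\<^sup>2 \<le> 1 * (eta P H v)\<^sup>2"
    using eta_refine(2)[OF assms] r_bounds by (meson mult_right_mono order_trans less_imp_le zero_le_power2)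
  then show ?thesis
    using \<gamma>_pos by (simp add: lyap_def)
qed

lemma lyap_l_step:
  assumes H: "H \<in> \<TT>" and v: "v \<in> fe H" and w: "w \<in> fe H"
    and contr: "dsq P (ush H) v \<le> q_nrg * dsq P (ush H) w"
    and ref: "marking P A H v M" "is_refine (pdim P) H M h"
  shows "lyap h v \<le> \<kappa> * lyap H w"
proof -
  \<comment> \<open>This \<open>?\<delta>\<close> keeps \<open>r * (1 + ?\<delta>)\<close> below
    \<open>(1 + r) / 2\<close>, and \<open>1 + 1 / ?\<delta>\<close> is the first factor of
    \<open>K\<close>.\<close>
  let ?x = "dsq P (ush H) w" and ?y = "(eta P H w)\<^sup>2" and ?\<delta> = "(1 - r) / 2"
  have x: "0 \<le> ?x"
    using dsq_ush_nonneg H w by auto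
  have \<delta>: "0 < ?\<delta>"
    using r_bounds by simp
  have "dsq P (ush H) v \<le> ?x"
    using contr mult_right_mono[of q_nrg 1 ?x] q_nrg x by simp
  then have vw: "(enorm P (v - w))\<^sup>2 \<le> 8 / \<alpha> * ?x"
    by (rule dsq_consecutive[OF H v w])
  have "(eta P h v)\<^sup>2 \<le> r * (eta P H v)\<^sup>2"
    by (rule eta_refine(2)[OF H v ref])
  also have "\<dots> \<le> r * ((1 + ?\<delta>) * ?y + (1 + 1 / ?\<delta>) * (C_stab\<^sup>2 * (enorm P (v - w))\<^sup>2))"
    using r_bounds by (intro mult_left_mono eta_diff_sq H v w \<delta>) auto
  also have "\<dots> \<le> r * ((1 + ?\<delta>) * ?y + (1 + 1 / ?\<delta>) * (C_stab\<^sup>2 * (8 / \<alpha> * ?x)))"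
    using r_bounds \<delta> vw by (intro mult_left_mono add_left_mono) auto
  also have "\<dots> = r * (1 + ?\<delta>) * ?y + r * (K * ?x)"
    by (simp add: K_def algebra_simps)
  also have "\<dots> \<le> (1 + r) / 2 * ?y + 1 * (K * ?x)"
  proof (intro add_mono mult_right_mono)
    have "r * ((1 - r) / 2) \<le> 1 * ((1 - r) / 2)"
      using r_bounds by (intro mult_right_mono) auto
    then show "r * (1 + ?\<delta>) \<le> (1 + r) / 2"
      by (simp add: field_simps)
  qed (use r_bounds K_pos x in auto)
  also have "\<dots> \<le> s * ?y + K * ?x"
    unfolding mult_1 using s_bounds(3) by (intro add_right_mono mult_right_mono) auto
  finally have "\<gamma> * (eta P h v)\<^sup>2 \<le> \<gamma> * (s * ?y + K * ?x)"
    using \<gamma>_pos by (intro mult_left_mono) auto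
  moreover have "(q_nrg + \<gamma> * K) * ?x \<le> s * ?x"
    using \<gamma>_K x by (rule mult_right_mono)
  ultimately have "dsq P (ush H) v + \<gamma> * (eta P h v)\<^sup>2 \<le> s * (?x + \<gamma> * ?y)"
    using contr by (simp add: algebra_simps)
  \<comment> \<open>The split uses the discrete solution of \<open>H\<close> although
    \<open>lyap\<close> is taken on \<open>h\<close>, so the same D stands on both sides of the
    contraction.\<close>
  moreover have "lyap h v = dsq P us (ush H) + (dsq P (ush H) v + \<gamma> * (eta P h v)\<^sup>2)"
    by (simp add: lyap_def dsq_def)
  ultimately show ?thesis
    unfolding lyap_split[of H w] by (intro \<kappa>_contraction dsq_us_ush_le[OF H w]) simp
qed

text \<open>In the application \<open>w\<close> is the final iterate of the previous linearization
  step, \<open>z\<close> its exact linearization and \<open>v\<close> a solver iterate started from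
  \<open>w\<close>. Everything is bounded by quantities at \<open>w\<close>, uniformly in the number
  of solver steps.\<close>

lemma lyap_upper:
  assumes H: "H \<in> \<TT>" and w: "w \<in> fe H" and z: "z \<in> fe H"
    and zw: "dsq P (ush H) z \<le> dsq P (ush H) w" and "enorm P (z - v) \<le> enorm P (z - w)"
  shows "(eta P H (ush H) + enorm P (ush H - z) + enorm P (z - v))\<^sup>2 \<le> C_up * lyap H w"
proof -
  let ?x = "dsq P (ush H) w" and ?y = "(eta P H w)\<^sup>2"
  have x: "0 \<le> ?x"
    by (rule dsq_ush_nonneg[OF H w])
  have us_ush: "0 \<le> dsq P us (ush H)"
  proof -
    note XX = ush_XX[OF H]
    have "0 \<le> \<alpha> / 2 * (enorm P (ush H - us))\<^sup>2"
      using pos by simp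
    also have "\<dots> \<le> dsq P us (ush H)"
      by (rule dsq_galerkin(1)[OF us subset_refl XX H10_diff[OF XX us_XX]])
    finally show ?thesis .
  qed
  have "(enorm P (ush H - z))\<^sup>2 \<le> 2 / \<alpha> * dsq P (ush H) z"
    using enorm_ush[OF H z] unfolding enorm_commute[OF fe_XX[OF z] ush_XX[OF H]] .
  also have "\<dots> \<le> 2 / \<alpha> * ?x"
    using zw pos by (intro mult_left_mono) auto
  finally have 1: "(enorm P (ush H - z))\<^sup>2 \<le> 2 / \<alpha> * ?x" .
  have "(enorm P (z - v))\<^sup>2 \<le> (enorm P (z - w))\<^sup>2"
    using assms(5) by (intro power_mono) auto
  then have 2: "(enorm P (z - v))\<^sup>2 \<le> 8 / \<alpha> * ?x"
    using dsq_consecutive[OF H z w zw] by (rule order_trans)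
  have "(eta P H (ush H) + enorm P (ush H - z) + enorm P (z - v))\<^sup>2
      \<le> 3 * ((eta P H (ush H))\<^sup>2 + (enorm P (ush H - z))\<^sup>2 + (enorm P (z - v))\<^sup>2)"
    by (rule sum3_sq_le)
  also have "\<dots> \<le> 3 * ((2 * ?y + 4 * C_stab\<^sup>2 / \<alpha> * ?x) + 2 / \<alpha> * ?x + 8 / \<alpha> * ?x)"
    using 1 2 eta_ush[OF H w] by simp
  also have "\<dots> \<le> C_up * (?x + \<gamma> * ?y)"
  proof -
    have "C_up * (?x + \<gamma> * ?y) = 3 * ((2 * ?y + 4 * C_stab\<^sup>2 / \<alpha> * ?x) + 2 / \<alpha> * ?x + 8 / \<alpha> * ?x)
        + (6 / \<gamma> * ?x + (12 * C_stab\<^sup>2 / \<alpha> + 30 / \<alpha>) * (\<gamma> * ?y))"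
      using \<gamma>_pos by (simp add: C_up_def algebra_simps)
    moreover have "0 \<le> 6 / \<gamma> * ?x + (12 * C_stab\<^sup>2 / \<alpha> + 30 / \<alpha>) * (\<gamma> * ?y)"
      using \<gamma>_pos pos x by simp
    ultimately show ?thesis by linarith
  qed
  also have "\<dots> \<le> C_up * lyap H w"
    unfolding lyap_split using C_pos us_ush by (intro mult_left_mono) auto
  finally show ?thesis .
qed

text \<open>The counterpart is at \<open>v\<close> instead of \<open>w\<close>: the error of
  \<open>v\<close> is reached by way of \<open>z\<close>, and its energy and estimator follow from
  that error.\<close>

lemma lyap_lower:
  assumes H: "H \<in> \<TT>" and v: "v \<in> fe H" and z: "z \<in> fe H"
  shows "lyap H v \<le> C_low * (eta P H (ush H) + enorm P (ush H - z) + enorm P (z - v))\<^sup>2"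
proof -
  let ?e = "eta P H (ush H)" and ?a = "enorm P (ush H - z)" and ?b = "enorm P (z - v)"
  let ?h = "(?e + ?a + ?b)\<^sup>2"
  have e: "?e\<^sup>2 \<le> ?h"
    by (intro power_mono) auto
  have "?a\<^sup>2 + ?b\<^sup>2 \<le> (?a + ?b)\<^sup>2"
    by (simp add: power2_sum)
  also have "\<dots> \<le> ?h"
    by (intro power_mono) auto
  finally have "2 * ?a\<^sup>2 + 2 * ?b\<^sup>2 \<le> 2 * ?h"
    by simp
  moreover have "(enorm P (v - ush H))\<^sup>2 \<le> 2 * ?a\<^sup>2 + 2 * ?b\<^sup>2"
    using enorm_diff_le[OF ush_XX[OF H] fe_XX[OF z] fe_XX[OF v]]
    unfolding enorm_commute[OF ush_XX[OF H] fe_XX[OF v]] .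
  ultimately have vu: "(enorm P (v - ush H))\<^sup>2 \<le> 2 * ?h"
    by linarith
  have "dsq P us (ush H) \<le> L / 2 * C_rel\<^sup>2 * ?e\<^sup>2"
    using dsq_us_ush[OF H] by (simp add: power_mult_distrib)
  also have "\<dots> \<le> L / 2 * C_rel\<^sup>2 * ?h"
    using e pos by (intro mult_left_mono) auto
  finally have 1: "dsq P us (ush H) \<le> L / 2 * C_rel\<^sup>2 * ?h" .
  have "dsq P (ush H) v \<le> L / 2 * (enorm P (v - ush H))\<^sup>2"
    by (rule dsq_ush(2)[OF H v])
  also have "\<dots> \<le> L / 2 * (2 * ?h)"
    using vu pos by (intro mult_left_mono) auto
  finally have 2: "dsq P (ush H) v \<le> L * ?h"
    by simp
  have "(eta P H v)\<^sup>2 \<le> 2 * ?e\<^sup>2 + 2 * (C_stab\<^sup>2 * (enorm P (v - ush H))\<^sup>2)"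
    using eta_diff_sq[OF H v ush_fe[OF H], of 1] by simp
  also have "\<dots> \<le> 2 * ?h + 2 * (C_stab\<^sup>2 * (2 * ?h))"
    using e vu by (intro add_mono mult_left_mono) auto
  finally have "\<gamma> * (eta P H v)\<^sup>2 \<le> \<gamma> * (2 * ?h + 2 * (C_stab\<^sup>2 * (2 * ?h)))"
    using \<gamma>_pos by (intro mult_left_mono) auto
  then show ?thesis
    using 1 2 unfolding lyap_split C_low_def by (simp add: algebra_simps)
qed

section \<open>Monotonicity of the algebraic solver\<close>

lemma solver_mono:
  assumes "H \<in> \<TT>" "w \<in> fe H"
  shows "enorm P (\<Phi> H w - (\<Psi> H (\<Phi> H w) ^^ Suc j) w) \<le> enorm P (\<Phi> H w - (\<Psi> H (\<Phi> H w) ^^ j) w)"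
proof -
  have "\<forall>j\<ge>1. enorm P (\<Phi> H w - (\<Psi> H (\<Phi> H w) ^^ j) w)
      \<le> q_alg * enorm P (\<Phi> H w - (\<Psi> H (\<Phi> H w) ^^ (j - 1)) w)"
    using solver assms unfolding contractive_solver_def by blast
  then have "enorm P (\<Phi> H w - (\<Psi> H (\<Phi> H w) ^^ Suc j) w)
      \<le> q_alg * enorm P (\<Phi> H w - (\<Psi> H (\<Phi> H w) ^^ (Suc j - 1)) w)"
    by (metis One_nat_def le_add1 plus_1_eq_Suc)
  also have "\<dots> \<le> 1 * enorm P (\<Phi> H w - (\<Psi> H (\<Phi> H w) ^^ (Suc j - 1)) w)"
    using solver by (intro mult_right_mono) (auto simp: contractive_solver_def)
  finally show ?thesis by simp
qed

lemma solver_le_initial: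
  assumes "H \<in> \<TT>" "w \<in> fe H"
  shows "enorm P (\<Phi> H w - (\<Psi> H (\<Phi> H w) ^^ j) w) \<le> enorm P (\<Phi> H w - w)"
proof (induction j)
  case (Suc j)
  with solver_mono[OF assms, of j] show ?case
    by (rule order_trans)
qed simp

lemma solver_fe:
  assumes "H \<in> \<TT>" "w \<in> fe H"
  shows "(\<Psi> H (\<Phi> H w) ^^ j) w \<in> fe H"
  using assms solver by (induction j) (auto simp: contractive_solver_def)

end

section \<open>Convergence of the run\<close>

locale ailfem_iteration = ailfem +
  fixes \<T> :: "nat \<Rightarrow> mesh" and \<M> :: "nat \<Rightarrow> mesh" and u :: "nat \<Rightarrow> nat \<Rightarrow> nat \<Rightarrow> fn"
  assumes run: "ailfem_run P p \<T>\<^sub>0 A \<Phi> \<Psi> \<T> \<M> u"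
    and j_last_le: "(l, k, 0) \<in> QQ P A \<T> u \<Longrightarrow> j_last (QQ P A \<T> u) l k \<le> enat j\<^sub>0"
    and inexact_contr: "(l, k, 0) \<in> QQ P A \<T> u \<Longrightarrow> 1 \<le> k \<Longrightarrow>
      dsq P (ush (\<T> l)) (u_last (QQ P A \<T> u) u l k)
        \<le> q_nrg * dsq P (ush (\<T> l)) (u_last (QQ P A \<T> u) u l (k - 1))"
begin

abbreviation "Q \<equiv> QQ P A \<T> u"
abbreviation "reach \<equiv> reached P A \<T> u"
abbreviation "adv \<equiv> advances P A \<T> u"
abbreviation "qe \<equiv> quasi_error P ush \<Phi> \<T> u"

lemma run_start: "\<T> 0 = \<T>\<^sub>0" "u 0 0 0 \<in> fe \<T>\<^sub>0"
  using run by (simp_all add: ailfem_run_def)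

lemma run_first_k: "reach l 0 0 am Jm \<Longrightarrow> u l 1 0 = u l 0 0"
  using run unfolding ailfem_run_def by blast

lemma run_j:
  "reach l k j am Jm \<Longrightarrow> 1 \<le> k \<Longrightarrow> 1 \<le> j \<Longrightarrow>
    u l k j = \<Psi> (\<T> l) (\<Phi> (\<T> l) (u l k 0)) (u l k (j - 1))"
  using run unfolding ailfem_run_def by blast

lemma run_leave:
  assumes "reach l k j am Jm" "1 \<le> k" "1 \<le> j" "\<not> tau_stop P A \<T> u l k j" "leave_j P u l k j am Jm"
  shows "if leave_k P A \<T> u l k j
    then marking P A (\<T> l) (u l k j) (\<M> l) \<and> is_refine (pdim P) (\<T> l) (\<M> l) (\<T> (Suc l)) \<and>
      u (Suc l) 0 0 = u l k j
    else u l (Suc k) 0 = u l k j"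
  using run assms unfolding ailfem_run_def by blast

lemma run_next_k:
  assumes "reach l k j am Jm" "1 \<le> k" "1 \<le> j" "\<not> tau_stop P A \<T> u l k j" "leave_j P u l k j am Jm"
    "\<not> leave_k P A \<T> u l k j"
  shows "u l (Suc k) 0 = u l k j"
  using run_leave[OF assms(1-5)] assms(6) by simp

lemma run_next_l:
  assumes "reach l k j am Jm" "1 \<le> k" "1 \<le> j" "\<not> tau_stop P A \<T> u l k j" "leave_j P u l k j am Jm"
    "leave_k P A \<T> u l k j"
  shows "marking P A (\<T> l) (u l k j) (\<M> l)" "is_refine (pdim P) (\<T> l) (\<M> l) (\<T> (Suc l))"
    "u (Suc l) 0 0 = u l k j"
  using run_leave[OF assms(1-5)] assms(6) by simp_all

text \<open>Powers of the solver map are the form in which the contraction of the solver is assumed.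
  For \<open>k = 0\<close> no solver step is made, and \<open>j = 0\<close> keeps the formula true.
  The invariants go together because a new loop starts from a solver iterate of the previous
  one.\<close>

lemma reach_iterate:
  assumes "reach l k j am Jm"
  shows "\<T> l \<in> \<TT>" "u l k 0 \<in> fe (\<T> l)" "k = 0 \<longrightarrow> j = 0"
    "u l k j = (\<Psi> (\<T> l) (\<Phi> (\<T> l) (u l k 0)) ^^ j) (u l k 0)"
proof -
  from assms have "\<T> l \<in> \<TT> \<and> u l k 0 \<in> fe (\<T> l) \<and> (k = 0 \<longrightarrow> j = 0) \<and>
    u l k j = (\<Psi> (\<T> l) (\<Phi> (\<T> l) (u l k 0)) ^^ j) (u l k 0)"
  proof induction
    case start
    show ?case
      using run_start meshes.base by simp
  next
    case (first_k l am Jm)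
    then show ?case
      using run_first_k[OF first_k.hyps] by simp
  next
    case (first_j l k am Jm)
    then show ?case
      using run_j[OF reached.first_j[OF first_j.hyps]] by simp
  next
    case (next_j l k j am Jm)
    then show ?case
      using run_j[OF reached.next_j[OF next_j.hyps]] by simp
  next
    case (next_k l k j am Jm)
    then show ?case
      using run_next_k[OF next_k.hyps] solver_fe[of "\<T> l" "u l k 0" j] by simp
  next
    case (next_l l k j am Jm)
    then have H: "\<T> l \<in> \<TT>" "u l k j \<in> fe (\<T> l)"
      using solver_fe[of "\<T> l" "u l k 0" j] by simp_all
    note nl = run_next_l[OF next_l.hyps]
    have "\<T> (Suc l) \<in> \<TT>"
      by (rule eta_refine(1)[OF H nl(1,2)])
    moreover have "u l k j \<in> fe (\<T> (Suc l))"
      using fe_refine[OF H(1) nl(2)] H(2) by blast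
    ultimately show ?case
      using nl(3) by simp
  qed
  then show "\<T> l \<in> \<TT>" "u l k 0 \<in> fe (\<T> l)" "k = 0 \<longrightarrow> j = 0"
    "u l k j = (\<Psi> (\<T> l) (\<Phi> (\<T> l) (u l k 0)) ^^ j) (u l k 0)"
    by blast+
qed

lemma reach_fe: "reach l k j am Jm \<Longrightarrow> u l k j \<in> fe (\<T> l)"
  using reach_iterate[of l k j am Jm] solver_fe[of "\<T> l" "u l k 0" j] by simp

section \<open>Final iterates of the solver loops\<close>

lemma reach_j0: "reach l k j am Jm \<Longrightarrow> (l, k, 0) \<in> Q"
  by (induction rule: reached.induct) (auto simp: QQ_def intro: reached.intros simp del: One_nat_def)

lemma j_le: "reach l k j am Jm \<Longrightarrow> j \<le> j\<^sub>0"
proof -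
  assume reach: "reach l k j am Jm"
  then have "(l, k, j) \<in> Q"
    by (auto simp: QQ_def)
  then have "enat j \<le> j_last Q l k"
    unfolding j_last_def by (intro SUP_upper) simp
  also have "\<dots> \<le> enat j\<^sub>0"
    by (rule j_last_le[OF reach_j0[OF reach]])
  finally show "j \<le> j\<^sub>0" by simp
qed

text \<open>\<open>later\<close> expresses that the transition abandons the pair
  \<open>(l, k)\<close>. As the orbit is a chain, a reached \<open>(l, k, j')\<close> with larger
  \<open>j'\<close> would lie at or beyond \<open>t\<close>, whose index exceeds it.\<close>

lemma j_last_leave:
  assumes reach: "reach l k j am Jm" and adv: "adv (l, k, j, am, Jm) t"
    and later: "\<And>j'. ((l, k, j'), state_idx t) \<in> lex_order"
  shows "j_last Q l k = enat j"
proof (rule antisym)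
  have "(l, k, j) \<in> Q"
    using reach by (auto simp: QQ_def)
  then show "enat j \<le> j_last Q l k"
    unfolding j_last_def by (intro SUP_upper) simp
  show "j_last Q l k \<le> enat j"
    unfolding j_last_def
  proof (rule SUP_least)
    fix j' assume "j' \<in> {j. (l, k, j) \<in> Q}"
    then obtain am' Jm' where reach': "reach l k j' am' Jm'"
      by (auto simp: QQ_def)
    let ?s = "(l, k, j, am, Jm)" and ?s' = "(l, k, j', am', Jm')"
    consider "adv\<^sup>*\<^sup>* ?s' ?s" | "adv\<^sup>*\<^sup>* ?s ?s'"
      using run.linear reach reach' unfolding reached_advances by blast
    then have "j' \<le> j"
    proof cases
      case 1
      then show ?thesis
        using run.rtranclp_idx by force
    next
      case 2
      then show ?thesis
      proof (cases rule: converse_rtranclpE)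
        case (step v)
        then have "adv\<^sup>*\<^sup>* t ?s'"
          using run.det adv by blast
        then have "t = ?s' \<or> (state_idx t, (l, k, j')) \<in> lex_order"
          using run.rtranclp_idx[of P A \<T> u t ?s'] by simp
        then show ?thesis
          using later[of j'] lex_order_trans lex_order_irrefl by fastforce
      qed simp
    qed
    then show "enat j' \<le> enat j" by simp
  qed
qed

lemma u_last_leave:
  assumes "reach l k j am Jm" "adv (l, k, j, am, Jm) t" "\<And>j'. ((l, k, j'), state_idx t) \<in> lex_order"
  shows "u_last Q u l k = u l k j"
  by (simp add: u_last_def j_last_leave[OF assms])

text \<open>The inexact contraction is assumed in terms of \<open>u_last\<close>, while the run
  copies the final iterate into \<open>u l k 0\<close>. For \<open>k = 1\<close> this is the initial
  function of the level, the only iterate with \<open>k = 0\<close>.\<close>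

lemma u_last_prev: "reach l k j am Jm \<Longrightarrow> 1 \<le> k \<Longrightarrow> u_last Q u l (k - 1) = u l k 0"
proof (induction rule: reached.induct)
  case (first_k l am Jm)
  then show ?case
    using u_last_leave[OF first_k.hyps advances.first_k] run_first_k by simp
next
  case (next_k l k j am Jm)
  then show ?case
    using u_last_leave[OF next_k.hyps(1) advances.next_k[OF next_k.hyps(2-)]] run_next_k[OF next_k.hyps]
    by simp
qed auto

lemma contraction:
  assumes "reach l k j am Jm" "1 \<le> k" "adv (l, k, j, am, Jm) t"
    "\<And>j'. ((l, k, j'), state_idx t) \<in> lex_order"
  shows "dsq P (ush (\<T> l)) (u l k j) \<le> q_nrg * dsq P (ush (\<T> l)) (u l k 0)"
  using inexact_contr[OF reach_j0[OF assms(1)] assms(2)] u_last_leave[OF assms(1,3,4)]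
    u_last_prev[OF assms(1,2)] by simp

text \<open>The power of \<omega> gained with each solver step anticipates the contraction that is
  realized when the loop is left. The exponent is 0 for \<open>k = 0\<close> and starts at 1 for
  \<open>k \<ge> 1\<close>, so that the passage from \<open>k = 0\<close> to \<open>k = 1\<close>
  contracts too.\<close>

definition weighted_lyap :: "state \<Rightarrow> real" where
  "weighted_lyap = (\<lambda>(l, k, j, am, Jm). \<omega> ^ (if k = 0 then 0 else Suc j) * lyap (\<T> l) (u l k 0))"

text \<open>\<open>lyap_upper\<close> with all three functions equal bounds a square by a positive
  multiple of the Lyapunov function.\<close>

lemma lyap_nonneg:
  assumes "H \<in> \<TT>" "w \<in> fe H"
  shows "0 \<le> lyap H w"
proof -
  have "0 \<le> C_up * lyap H w"
    using lyap_upper[OF assms assms(2), of w] by (meson order_refl order_trans zero_le_power2)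
  then show ?thesis
    using C_pos by (simp add: zero_le_mult_iff)
qed

text \<open>The credit falls due here: \<kappa> has to cover the \<open>Suc j\<close> factors in the
  weight and the factor of the leaving transition itself.\<close>

lemma leave_weighted_lyap:
  assumes reach: "reach l k j am Jm" and W: "W \<le> \<kappa> * lyap (\<T> l) (u l k 0)" and "1 \<le> k"
  shows "W \<le> \<omega> * weighted_lyap (l, k, j, am, Jm)"
proof -
  note it = reach_iterate[OF reach]
  have "\<omega> ^ (j\<^sub>0 + 2) \<le> \<omega> ^ (j + 2)"
    using j_le[OF reach] \<omega>_bounds by (intro power_decreasing) auto
  then have "\<kappa> \<le> \<omega> ^ (j + 2)"
    using \<kappa>_le_\<omega> by linarith
  then have "\<kappa> * lyap (\<T> l) (u l k 0) \<le> \<omega> ^ (j + 2) * lyap (\<T> l) (u l k 0)"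
    using lyap_nonneg[OF it(1,2)] by (rule mult_right_mono)
  then show ?thesis
    using W \<open>1 \<le> k\<close> by (simp add: weighted_lyap_def mult.assoc)
qed

lemma weighted_lyap_le:
  assumes "reach l k j am Jm"
  shows "weighted_lyap (l, k, j, am, Jm) \<le> lyap (\<T> l) (u l k 0)"
proof -
  have "\<omega> ^ n \<le> 1" for n
    using \<omega>_bounds by (intro power_le_one) auto
  then show ?thesis
    using lyap_nonneg reach_iterate(1,2)[OF assms] unfolding weighted_lyap_def prod.case
    by (metis mult_right_mono mult_1)
qed

lemma weighted_lyap_ge:
  assumes "reach l k j am Jm"
  shows "\<omega> ^ (j\<^sub>0 + 1) * lyap (\<T> l) (u l k 0) \<le> weighted_lyap (l, k, j, am, Jm)"
proof -
  have "\<omega> ^ (j\<^sub>0 + 1) \<le> \<omega> ^ (if k = 0 then 0 else Suc j)"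
    using \<omega>_bounds j_le[OF assms] by (intro power_decreasing) auto
  then show ?thesis
    using lyap_nonneg reach_iterate(1,2)[OF assms] unfolding weighted_lyap_def prod.case
    by (intro mult_right_mono)
qed

lemma adv_reach:
  "adv (l, k, j, am, Jm) (l', k', j', am', Jm') \<Longrightarrow> reach l k j am Jm \<Longrightarrow> reach l' k' j' am' Jm'"
  unfolding reached_advances by (rule rtranclp.rtrancl_into_rtrancl)

lemma adv_weighted_lyap:
  assumes "adv (l, k, j, am, Jm) t" "reach l k j am Jm"
  shows "weighted_lyap t \<le> \<omega> * weighted_lyap (l, k, j, am, Jm)"
  using assms(1)
proof cases
  case first_k
  then show ?thesis
    using run_first_k assms(2) by (simp add: weighted_lyap_def)
next
  case first_j
  then show ?thesis
    by (simp add: weighted_lyap_def)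
next
  case next_j
  then show ?thesis
    by (simp add: weighted_lyap_def)
next
  case next_k
  note it = reach_iterate[OF assms(2)] and v = reach_fe[OF assms(2)]
  have eq: "u l (Suc k) 0 = u l k j"
    by (rule run_next_k[OF assms(2) next_k(2-)])
  have "dsq P (ush (\<T> l)) (u l k j) \<le> q_nrg * dsq P (ush (\<T> l)) (u l k 0)"
    by (rule contraction[OF assms(2) next_k(2) assms(1)]) (simp add: next_k(1))
  then have "lyap (\<T> l) (u l k j) \<le> \<kappa> * lyap (\<T> l) (u l k 0)"
    using next_k(6) params by (intro lyap_k_step it v) (auto simp: leave_k_def)
  then show ?thesis
    using weighted_lyap_le[OF adv_reach[OF assms[unfolded next_k(1)]]] eq next_k
    by (intro leave_weighted_lyap[OF assms(2)]) auto
next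
  case next_l
  note it = reach_iterate[OF assms(2)] and v = reach_fe[OF assms(2)]
  note nl = run_next_l[OF assms(2) next_l(2-)]
  have "dsq P (ush (\<T> l)) (u l k j) \<le> q_nrg * dsq P (ush (\<T> l)) (u l k 0)"
    by (rule contraction[OF assms(2) next_l(2) assms(1)]) (simp add: next_l(1))
  then have "lyap (\<T> (Suc l)) (u l k j) \<le> \<kappa> * lyap (\<T> l) (u l k 0)"
    by (rule lyap_l_step[OF it(1) v it(2) _ nl(1,2)])
  then show ?thesis
    using weighted_lyap_le[OF adv_reach[OF assms[unfolded next_l(1)]]] nl(3) next_l
    by (intro leave_weighted_lyap[OF assms(2)]) auto
qed

section \<open>Quasi-error and Lyapunov function along the run\<close>

lemma qe_unfold:
  "qe (l, k, j) = eta P (\<T> l) (ush (\<T> l)) + enorm P (ush (\<T> l) - u_lin \<Phi> \<T> u l k) +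
    enorm P (u_lin \<Phi> \<T> u l k - u l k j)"
  by (simp add: quasi_error_def)

lemma qe_nonneg [simp]: "0 \<le> qe (l, k, j)"
  by (simp add: qe_unfold)

lemma u_lin_props:
  assumes "reach l k j am Jm"
  shows "u_lin \<Phi> \<T> u l k \<in> fe (\<T> l)"
    "dsq P (ush (\<T> l)) (u_lin \<Phi> \<T> u l k) \<le> dsq P (ush (\<T> l)) (u l k 0)"
    "enorm P (u_lin \<Phi> \<T> u l k - u l k j) \<le> enorm P (u_lin \<Phi> \<T> u l k - u l k 0)"
proof -
  note it = reach_iterate[OF assms]
  show "u_lin \<Phi> \<T> u l k \<in> fe (\<T> l)"
    "dsq P (ush (\<T> l)) (u_lin \<Phi> \<T> u l k) \<le> dsq P (ush (\<T> l)) (u l k 0)"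
    using it(2) \<Phi>_fe[OF it(1,2)] \<Phi>_energy[OF it(1,2)] by (auto simp: u_lin_def)
  show "enorm P (u_lin \<Phi> \<T> u l k - u l k j) \<le> enorm P (u_lin \<Phi> \<T> u l k - u l k 0)"
    using solver_le_initial[OF it(1,2), of j] it(3,4) by (cases "k = 0") (simp_all add: u_lin_def)
qed

lemma qe_upper:
  assumes "reach l k j am Jm"
  shows "(qe (l, k, j))\<^sup>2 \<le> C_up * lyap (\<T> l) (u l k 0)"
  unfolding qe_unfold by (rule lyap_upper[OF reach_iterate(1,2)[OF assms] u_lin_props[OF assms]])

lemma qe_lower:
  assumes "reach l k j am Jm"
  shows "lyap (\<T> l) (u l k j) \<le> C_low * (qe (l, k, j))\<^sup>2"
  unfolding qe_unfold
  by (rule lyap_lower[OF reach_iterate(1)[OF assms] reach_fe[OF assms] u_lin_props(1)[OF assms]])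

lemma qe_solver_step:
  assumes "reach l k j am Jm" "reach l k (Suc j) am' Jm'"
  shows "qe (l, k, Suc j) \<le> qe (l, k, j)"
proof -
  note it = reach_iterate[OF assms(1)]
  have "k \<noteq> 0"
    using reach_iterate(3)[OF assms(2)] by simp
  then show ?thesis
    unfolding qe_unfold it(4) reach_iterate(4)[OF assms(2)] u_lin_def
    using solver_mono[OF it(1,2), of j] by simp
qed

text \<open>Every transition other than a solver step makes the current iterate the reference
  function of the next state, and there \<open>qe_lower\<close> applies; on a new mesh
  \<open>lyap_refine\<close> is put in between.\<close>

lemma adv_qe:
  assumes adv: "adv (l, k, j, am, Jm) t" and reach: "reach l k j am Jm"
  shows "(\<exists>am' Jm'. t = (l, k, Suc j, am', Jm')) \<or> weighted_lyap t \<le> C_low * (qe (l, k, j))\<^sup>2"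
  using adv
proof cases
  case first_k
  then have "u l k 0 = u l k j" "weighted_lyap t \<le> lyap (\<T> l) (u l k 0)"
    using weighted_lyap_le[OF adv_reach[OF adv[unfolded first_k(3)] reach]] run_first_k reach by auto
  then show ?thesis
    using qe_lower[OF reach] by auto
next
  case next_k
  have "weighted_lyap t \<le> lyap (\<T> l) (u l k j)"
    using weighted_lyap_le[OF adv_reach[OF adv[unfolded next_k(1)] reach]]
      run_next_k[OF reach next_k(2-)] next_k(1) by simp
  then show ?thesis
    using qe_lower[OF reach] by auto
next
  case next_l
  note nl = run_next_l[OF reach next_l(2-)]
  have "weighted_lyap t \<le> lyap (\<T> (Suc l)) (u l k j)"
    using weighted_lyap_le[OF adv_reach[OF adv[unfolded next_l(1)] reach]] nl(3) next_l(1) by simp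
  also have "\<dots> \<le> lyap (\<T> l) (u l k j)"
    by (rule lyap_refine[OF reach_iterate(1)[OF reach] reach_fe[OF reach] nl(1,2)])
  finally show ?thesis
    using qe_lower[OF reach] by auto
qed auto

text \<open>The Lyapunov function of a state refers to the final iterate of the previous linearization step,
  so the quasi-error controls it only once the current solver loop has been left.\<close>

lemma adv_power:
  assumes "(adv ^^ n) (l, k, j, am, Jm) (l', k', j', am', Jm')" "reach l k j am Jm"
  shows "reach l' k' j' am' Jm' \<and> ((l' = l \<and> k' = k \<and> j' = j + n \<and> qe (l', k', j') \<le> qe (l, k, j)) \<or>
    weighted_lyap (l', k', j', am', Jm') \<le> C_low / \<omega> ^ (j\<^sub>0 + 1) * \<omega> ^ n * (qe (l, k, j))\<^sup>2)"
  using assms(1)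
proof (induction n arbitrary: l' k' j' am' Jm')
  case 0
  then show ?case
    using assms(2) by simp
next
  case (Suc n)
  then obtain l1 k1 j1 am1 Jm1 where s1: "(adv ^^ n) (l, k, j, am, Jm) (l1, k1, j1, am1, Jm1)"
    and adv: "adv (l1, k1, j1, am1, Jm1) (l', k', j', am', Jm')"
    by (metis relpowp_Suc_E prod_cases5)
  let ?B = "\<lambda>n. C_low / \<omega> ^ (j\<^sub>0 + 1) * \<omega> ^ n * (qe (l, k, j))\<^sup>2"
  have reach1: "reach l1 k1 j1 am1 Jm1"
    using Suc.IH[OF s1] by simp
  have reach': "reach l' k' j' am' Jm'"
    by (rule adv_reach[OF adv reach1])
  from Suc.IH[OF s1] consider
    (same) "l1 = l" "k1 = k" "j1 = j + n" "qe (l1, k1, j1) \<le> qe (l, k, j)"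
    | (later) "weighted_lyap (l1, k1, j1, am1, Jm1) \<le> ?B n"
    by blast
  then show ?case
  proof cases
    case same
    from adv_qe[OF adv reach1] consider
      "l' = l1" "k' = k1" "j' = Suc j1"
      | "weighted_lyap (l', k', j', am', Jm') \<le> C_low * (qe (l1, k1, j1))\<^sup>2"
      by blast
    then show ?thesis
    proof cases
      case 1
      then show ?thesis
        using same qe_solver_step[of l k j1 am1 Jm1 am' Jm'] reach1 reach' by simp
    next
      \<comment> \<open>The loop is left after \<open>n \<le> j\<^sub>0\<close> steps without decay;
        dividing by \<open>\<omega> ^ (j\<^sub>0 + 1)\<close> supplies the \<open>Suc n\<close>
        factors that the bound claims.\<close>
      case 2
      have "\<omega> ^ (j\<^sub>0 + 1) \<le> \<omega> ^ Suc n"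
        using j_le[OF reach1] same(3) \<omega>_bounds by (intro power_decreasing) auto
      then have "1 \<le> \<omega> ^ Suc n / \<omega> ^ (j\<^sub>0 + 1)"
        using \<omega>_bounds by (simp add: le_divide_eq)
      then have "C_low * (qe (l1, k1, j1))\<^sup>2 * 1 \<le> C_low * (qe (l, k, j))\<^sup>2 * (\<omega> ^ Suc n / \<omega> ^ (j\<^sub>0 + 1))"
        using same(4) C_pos by (intro mult_mono mult_left_mono power_mono) auto
      with 2 have "weighted_lyap (l', k', j', am', Jm') \<le> ?B (Suc n)"
        using \<omega>_bounds(1) by (simp add: mult_ac less_imp_neq[THEN not_sym])
      then show ?thesis
        using reach' by blast
    qed
  next
    case later
    have "weighted_lyap (l', k', j', am', Jm') \<le> \<omega> * weighted_lyap (l1, k1, j1, am1, Jm1)"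
      by (rule adv_weighted_lyap[OF adv reach1])
    also have "\<dots> \<le> \<omega> * ?B n"
      using later \<omega>_bounds by (intro mult_left_mono) auto
    also have "\<dots> = ?B (Suc n)"
      by simp
    finally show ?thesis
      using reach' by blast
  qed
qed

lemma qe_adv_power:
  assumes "(adv ^^ n) (l, k, j, am, Jm) (l', k', j', am', Jm')" "reach l k j am Jm"
  shows "qe (l', k', j') \<le> C_lin * q_lin ^ n * qe (l, k, j)"
proof -
  let ?\<Omega> = "\<omega> ^ (j\<^sub>0 + 1)"
  have \<Omega>: "0 < ?\<Omega>"
    using \<omega>_bounds by simp
  have C_lin: "1 / ?\<Omega> \<le> C_lin" "sqrt (C_up * C_low) / ?\<Omega> \<le> C_lin"
    using \<Omega> C_pos by (simp_all add: C_lin_def divide_right_mono)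
  have reach': "reach l' k' j' am' Jm'"
    using adv_power[OF assms] by blast
  from adv_power[OF assms] consider
    (same) "j' = j + n" "qe (l', k', j') \<le> qe (l, k, j)"
    | (later) "weighted_lyap (l', k', j', am', Jm') \<le> C_low / ?\<Omega> * \<omega> ^ n * (qe (l, k, j))\<^sup>2"
    by blast
  then show ?thesis
  proof cases
    \<comment> \<open>Here \<open>n\<close> is at most \<open>j\<^sub>0\<close>, so the missing
      decay is a bounded power of \<open>q_lin\<close> and is hidden in
      \<open>C_lin\<close>.\<close>
    case same
    have "\<omega> \<le> q_lin"
      unfolding q_lin_def using \<omega>_bounds by (intro real_le_rsqrt) (simp add: power2_eq_square mult_left_le)
    then have "?\<Omega> \<le> q_lin ^ (j\<^sub>0 + 1)"
      using \<omega>_bounds by (intro power_mono) auto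
    also have "\<dots> \<le> q_lin ^ n"
      using j_le[OF reach'] same(1) lin_constants by (intro power_decreasing) auto
    finally have "1 / ?\<Omega> * ?\<Omega> \<le> C_lin * q_lin ^ n"
      using C_lin(1) \<Omega> lin_constants by (intro mult_mono) auto
    then have "1 * qe (l, k, j) \<le> C_lin * q_lin ^ n * qe (l, k, j)"
      using less_imp_neq[OF \<Omega>] by (intro mult_right_mono) auto
    then show ?thesis
      using same(2) by simp
  next
    \<comment> \<open>\<open>?\<Omega>\<close> is divided out twice, once from
      \<open>adv_power\<close> and once for the weight of the last state. The quasi-error is
      comparable to the root of the Lyapunov function; taking roots leaves
      \<open>1 / ?\<Omega>\<close> and turns \<omega> into \<open>q_lin\<close>.\<close>
    case later
    have "?\<Omega> * lyap (\<T> l') (u l' k' 0) \<le> C_low / ?\<Omega> * \<omega> ^ n * (qe (l, k, j))\<^sup>2"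
      using weighted_lyap_ge[OF reach'] later by linarith
    then have "lyap (\<T> l') (u l' k' 0) \<le> C_low / ?\<Omega> * \<omega> ^ n * (qe (l, k, j))\<^sup>2 / ?\<Omega>"
      unfolding pos_le_divide_eq[OF \<Omega>] by (subst mult.commute)
    then have "C_up * lyap (\<T> l') (u l' k' 0) \<le> C_up * (C_low / ?\<Omega> * \<omega> ^ n * (qe (l, k, j))\<^sup>2 / ?\<Omega>)"
      using C_pos by (intro mult_left_mono) auto
    also have "\<dots> = (sqrt (C_up * C_low) / ?\<Omega> * q_lin ^ n * qe (l, k, j))\<^sup>2"
    proof -
      have "(q_lin ^ n)\<^sup>2 = (q_lin\<^sup>2) ^ n"
        by (simp add: mult.commute flip: power_mult)
      then have "(q_lin ^ n)\<^sup>2 = \<omega> ^ n"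
        using \<omega>_bounds by (simp add: q_lin_def)
      moreover have "(sqrt (C_up * C_low))\<^sup>2 = C_up * C_low"
        using C_pos by simp
      moreover have "(sqrt (C_up * C_low) / ?\<Omega> * q_lin ^ n * qe (l, k, j))\<^sup>2
          = (sqrt (C_up * C_low))\<^sup>2 * (q_lin ^ n)\<^sup>2 * (qe (l, k, j))\<^sup>2 / (?\<Omega> * ?\<Omega>)"
        by (simp add: power2_eq_square)
      ultimately show ?thesis
        by (simp only:) (simp add: mult.assoc)
    qed
    finally have "(qe (l', k', j'))\<^sup>2 \<le> (sqrt (C_up * C_low) / ?\<Omega> * q_lin ^ n * qe (l, k, j))\<^sup>2"
      using qe_upper[OF reach'] by linarith
    then have "qe (l', k', j') \<le> sqrt (C_up * C_low) / ?\<Omega> * q_lin ^ n * qe (l, k, j)"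
      by (rule power2_le_imp_le) (use C_pos \<Omega> lin_constants in auto)
    also have "\<dots> \<le> C_lin * q_lin ^ n * qe (l, k, j)"
      using C_lin(2) lin_constants by (intro mult_right_mono) auto
    finally show ?thesis .
  qed
qed

lemma full_linear_convergence:
  assumes "q' \<in> Q" "q \<in> Q" "steps Q q' < steps Q q"
  shows "qe q \<le> C_lin * q_lin ^ (steps Q q - steps Q q') * qe q'"
proof -
  obtain s t where st: "adv\<^sup>*\<^sup>* (0, 0, 0, amin A, jmax A) s" "q' = state_idx s" "q = state_idx t"
    "(adv ^^ (steps Q q - steps Q q')) s t"
    using run.steps_less[of q' P A \<T> u q] assms unfolding run_Q by metis
  obtain l k j am Jm where s: "s = (l, k, j, am, Jm)"
    by (metis prod_cases5)
  obtain l' k' j' am' Jm' where t: "t = (l', k', j', am', Jm')"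
    by (metis prod_cases5)
  show ?thesis
    using qe_adv_power[of "steps Q q - steps Q q'" l k j am Jm l' k' j' am' Jm'] st
    unfolding s t reached_advances by simp
qed

end

text \<open>Used in contrapositive form: constants that violate the sign conditions admit no
  setting. The strict bound on \<open>q_nrg\<close> holds because the term subtracted from 1 is
  positive.\<close>

lemma constants_if_setting:
  assumes "problem_data P \<alpha> L" "linearization_form P a C_ell C_cnt"
    "contractive_solver P p \<T>\<^sub>0 \<Phi> \<Psi> q_alg" "stability P p \<T>\<^sub>0 C_stab" "reduction P p \<T>\<^sub>0 q_red"
    "reliability P \<T>\<^sub>0 us ush C_rel" "admissible_params A" "theta A = \<theta>" "lam_lin A = lam"
    "0 < C_nrg" "0 < q_nrg" "q_nrg \<le> 1 - 2 * C_nrg / L * (\<alpha>\<^sup>2 / C_cnt\<^sup>2) * (1 - q_alg)\<^sup>2"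
  shows "constants L \<alpha> q_red q_nrg C_stab C_rel \<theta> lam"
proof
  interpret pde P \<alpha> L
    by unfold_locales fact
  show "0 < L" "0 < \<alpha>"
    using L_pos \<alpha>_pos by simp_all
  then have "0 < 2 * C_nrg / L * (\<alpha>\<^sup>2 / C_cnt\<^sup>2) * (1 - q_alg)\<^sup>2"
    using assms(2,3,10) by (auto simp: linearization_form_def contractive_solver_def
        intro!: mult_pos_pos divide_pos_pos)
  with assms(12) show "q_nrg < 1"
    by linarith
qed (use assms in \<open>auto simp: stability_def reduction_def reliability_def admissible_params_def\<close>)

lemma (in constants) setting_linear_convergence:
  assumes data: "problem_data P \<alpha> L" and "initial_mesh (pdim P) (pdom P) \<T>\<^sub>0"
    "galerkin_solution P (XX P) us"
    "\<forall>\<T>'\<in>meshes (pdim P) \<T>\<^sub>0. galerkin_solution P (fe_space P p \<T>') (ush \<T>')"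
    and lin: "linearization_form P a C_ell C_cnt" "linearization_map P p \<T>\<^sub>0 a \<Phi>" "0 < C_nrg_star"
    and q_star: "0 < q_nrg_star" "q_nrg_star \<le> 1 - 2 * C_nrg_star / L * (\<alpha>\<^sup>2 / C_cnt\<^sup>2)"
    and contr_star: "\<forall>\<T>'\<in>meshes (pdim P) \<T>\<^sub>0. \<forall>v\<in>fe_space P p \<T>'.
      0 \<le> dsq P (ush \<T>') (\<Phi> \<T>' v) \<and>
      dsq P (ush \<T>') (\<Phi> \<T>' v) \<le> q_nrg_star * dsq P (ush \<T>') v"
    and "contractive_solver P p \<T>\<^sub>0 \<Phi> \<Psi> q_alg" "stability P p \<T>\<^sub>0 C_stab" "reduction P p \<T>\<^sub>0 q_red"
    "reliability P \<T>\<^sub>0 us ush C_rel" "theta A = \<theta>" "lam_lin A = lam"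
    "ailfem_run P p \<T>\<^sub>0 A \<Phi> \<Psi> \<T> \<M> u" and Q: "Q = QQ P A \<T> u"
    and j_last: "\<forall>l k. (l, k, 0) \<in> Q \<longrightarrow> j_last Q l k \<le> enat j\<^sub>0"
    and contr: "\<forall>l k. (l, k, 0) \<in> Q \<and> 1 \<le> k \<longrightarrow>
      0 \<le> dsq P (ush (\<T> l)) (u_last Q u l k) \<and>
      dsq P (ush (\<T> l)) (u_last Q u l k) \<le> q_nrg * dsq P (ush (\<T> l)) (u_last Q u l (k - 1))"
  shows "\<forall>q'\<in>Q. \<forall>q\<in>Q. steps Q q' < steps Q q \<longrightarrow>
    quasi_error P ush \<Phi> \<T> u q
      \<le> C_lin * q_lin ^ (steps Q q - steps Q q') * quasi_error P ush \<Phi> \<T> u q'"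
proof -
  interpret pde P \<alpha> L
    by unfold_locales fact
  have energy: "dsq P (ush H) (\<Phi> H v) \<le> dsq P (ush H) v"
    if "H \<in> meshes (pdim P) \<T>\<^sub>0" "v \<in> fe_space P p H" for H v
  proof -
    have *: "0 \<le> dsq P (ush H) (\<Phi> H v)" "dsq P (ush H) (\<Phi> H v) \<le> q_nrg_star * dsq P (ush H) v"
      using contr_star that by blast+
    \<comment> \<open>A negative value would make the upper bound in \<open>*\<close> negative,
      below a nonnegative left side.\<close>
    then have "0 \<le> dsq P (ush H) v"
      using q_star(1) by (meson order_trans zero_le_mult_iff not_le)
    moreover have "0 \<le> 2 * C_nrg_star / L * (\<alpha>\<^sup>2 / C_cnt\<^sup>2)"
      using lin(3) pos by simp
    then have "q_nrg_star \<le> 1"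
      using q_star(2) by linarith
    ultimately have "q_nrg_star * dsq P (ush H) v \<le> 1 * dsq P (ush H) v"
      by (intro mult_right_mono)
    with * show ?thesis
      by linarith
  qed
  interpret ailfem_iteration L \<alpha> q_red q_nrg C_stab C_rel \<theta> lam j\<^sub>0 P p \<T>\<^sub>0 A \<Phi> \<Psi> us ush q_alg \<T> \<M> u
    by unfold_locales (use assms energy in \<open>auto simp: linearization_map_def\<close>)
  show ?thesis
    unfolding Q using full_linear_convergence by blast
qed

theorem theorem6:
  fixes L \<alpha> q_red q_nrg C_stab C_rel \<theta> lam q_nrg_star :: real and j\<^sub>0 :: nat
  shows "\<exists>q_lin C_lin :: real. 0 < q_lin \<and> q_lin < 1 \<and> 0 < C_lin \<and>
    (\<forall>(P :: problem) (p :: nat) (\<T>\<^sub>0 :: mesh) (A :: params)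
      (a :: fn \<Rightarrow> fn \<Rightarrow> fn \<Rightarrow> real) (\<Phi> :: mesh \<Rightarrow> fn \<Rightarrow> fn) (\<Psi> :: mesh \<Rightarrow> fn \<Rightarrow> fn \<Rightarrow> fn)
      (us :: fn) (ush :: mesh \<Rightarrow> fn)
      (C_ell :: real) (C_cnt :: real) (C_nrg_star :: real) (C_nrg :: real) (q_alg :: real)
      (\<T> :: nat \<Rightarrow> mesh) (\<M> :: nat \<Rightarrow> mesh) (u :: nat \<Rightarrow> nat \<Rightarrow> nat \<Rightarrow> fn) (Q :: (nat \<times> nat \<times> nat) set).
      problem_data P \<alpha> L \<and> initial_mesh (pdim P) (pdom P) \<T>\<^sub>0 \<and> 1 \<le> p \<and>
      galerkin_solution P (XX P) us \<and>
      (\<forall>\<T>'\<in>meshes (pdim P) \<T>\<^sub>0. galerkin_solution P (fe_space P p \<T>') (ush \<T>')) \<and>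
      linearization_form P a C_ell C_cnt \<and> linearization_map P p \<T>\<^sub>0 a \<Phi> \<and>
      0 < C_nrg_star \<and>
      (\<forall>\<T>'\<in>meshes (pdim P) \<T>\<^sub>0. \<forall>v\<in>fe_space P p \<T>'.
         C_nrg_star * (enorm P (\<Phi> \<T>' v - v))\<^sup>2 \<le> dsq P (\<Phi> \<T>' v) v) \<and>
      0 < q_nrg_star \<and> q_nrg_star \<le> 1 - 2 * C_nrg_star / L * (\<alpha>\<^sup>2 / C_cnt\<^sup>2) \<and>
      (\<forall>\<T>'\<in>meshes (pdim P) \<T>\<^sub>0. \<forall>v\<in>fe_space P p \<T>'.
         0 \<le> dsq P (ush \<T>') (\<Phi> \<T>' v) \<and>
         dsq P (ush \<T>') (\<Phi> \<T>' v) \<le> q_nrg_star * dsq P (ush \<T>') v) \<and>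
      contractive_solver P p \<T>\<^sub>0 \<Phi> \<Psi> q_alg \<and>
      estimator_well_defined P p \<T>\<^sub>0 \<and>
      stability P p \<T>\<^sub>0 C_stab \<and> reduction P p \<T>\<^sub>0 q_red \<and> reliability P \<T>\<^sub>0 us ush C_rel \<and>
      admissible_params A \<and> theta A = \<theta> \<and> lam_lin A = lam \<and>
      ailfem_run P p \<T>\<^sub>0 A \<Phi> \<Psi> \<T> \<M> u \<and> Q = QQ P A \<T> u \<and>
      1 \<le> j\<^sub>0 \<and> (\<forall>l k. (l, k, 0) \<in> Q \<longrightarrow> j_last Q l k \<le> enat j\<^sub>0) \<and>
      0 < C_nrg \<and> C_nrg < C_nrg_star \<and>
      (\<forall>l k. (l, k, 0) \<in> Q \<and> 1 \<le> k \<longrightarrow>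
         C_nrg * (enorm P (u_last Q u l k - u_last Q u l (k - 1)))\<^sup>2
           \<le> dsq P (u_last Q u l k) (u_last Q u l (k - 1))) \<and>
      0 < q_nrg \<and>
      q_nrg \<le> 1 - 2 * C_nrg / L * (\<alpha>\<^sup>2 / C_cnt\<^sup>2) * (1 - q_alg)\<^sup>2 \<and>
      (\<forall>l k. (l, k, 0) \<in> Q \<and> 1 \<le> k \<longrightarrow>
         0 \<le> dsq P (ush (\<T> l)) (u_last Q u l k) \<and>
         dsq P (ush (\<T> l)) (u_last Q u l k)
           \<le> q_nrg * dsq P (ush (\<T> l)) (u_last Q u l (k - 1)))
      \<longrightarrow>
      (\<forall>q'\<in>Q. \<forall>q\<in>Q. steps Q q' < steps Q q \<longrightarrow>
         quasi_error P ush \<Phi> \<T> u q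
           \<le> C_lin * q_lin ^ (steps Q q - steps Q q') * quasi_error P ush \<Phi> \<T> u q'))"
proof (cases "constants L \<alpha> q_red q_nrg C_stab C_rel \<theta> lam")
  case True
  then interpret constants L \<alpha> q_red q_nrg C_stab C_rel \<theta> lam j\<^sub>0 .
  show ?thesis
    by (intro exI[of _ q_lin] exI[of _ C_lin] conjI lin_constants allI impI, elim conjE,
        rule setting_linear_convergence, assumption+)
next
  case False
  \<comment> \<open>The premises are contradictory for such constants, so arbitrary witnesses will
    do.\<close>
  show ?thesis
    by (intro exI[of _ "1 / 2"] exI[of _ 1] conjI allI impI, simp, simp, simp, elim conjE,
        rule notE[OF False], rule constants_if_setting, assumption+)
qed

end
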